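(* Let $W\times T\subset\mathbb{R}^2\times\mathbb{R}$ be a bounded non-empty open set, let $\boldsymbol\theta_0\in\boldsymbol\Theta$ be the true parameter value, let $\boldsymbol f(\cdot;\boldsymbol\theta)=[f^{(1)}(\cdot;\boldsymbol\theta),\dots,f^{(m)}(\cdot;\boldsymbol\theta)]^\top:W\times T\to\mathbb{R}^m$, $\boldsymbol\theta\in\boldsymbol\Theta$, be measurable test functions such that every $f^{(i)}\lambda$ is absolutely integrable, and assume: (i) $\{Y_i\}_{i\ge1}$ and $\{E_i\}_{i\ge1}$ are two independent sequences of independent and identically distributed point processes on $W\times T$, defined on the same underlying probability space; $X_n=\bigcup_{i=1}^nY_i$ and $D_n=\bigcup_{i=1}^nE_i$. (ii) Each $Y_i$ is a point process with intensity function $\lambda(u;\boldsymbol\theta)=b(u)\exp(\boldsymbol\theta^\top\boldsymbol z(u))$, where $b:W\times T\to(0,\infty)$ is absolutely integrable, $\boldsymbol z=[z^{(1)},\dots,z^{(m)}]^\top:W\times T\to\mathbb{R}^m$ is measurable, and $\boldsymbol\theta$ lies in an open set $\boldsymbol\Theta\subset\mathbb{R}^m$; each $E_i$ has an absolutely integrable intensity function $\rho(u)>0$. (iii) $E_i$ and $Y_i$ have bounded pair correlation functions $g$ and $h$, respectively: $\sup_{(u,v)\in(W\times T)^2}g(u,v)<\infty$ and $\sup_{(u,v)\in(W\times T)^2}h(u,v)<\infty$. (iv) For every $\boldsymbol\theta\in\boldsymbol\Theta$ there exist $\epsilon_1(\boldsymbol\theta),\epsilon_2(\boldsymbol\theta)>0$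 with $\epsilon_1(\boldsymbol\theta)<\inf_{u}\rho(u)/\lambda(u;\boldsymbol\theta)$ and $\sup_{u}\rho(u)/\lambda(u;\boldsymbol\theta)<\epsilon_2(\boldsymbol\theta)$, where $u$ ranges over $W\times T$. (v) $\sup_{u\in W\times T}\|\boldsymbol z(u)\|<\infty$. (vi) The functions $f^{(i)}(u;\boldsymbol\theta)$ are twice continuously differentiable with respect to $\boldsymbol\theta$; moreover, for $\boldsymbol\theta$ in a neighbourhood of $\boldsymbol\theta_0$, the functions $f^{(i)}(u;\boldsymbol\theta)$, $\frac{\partial}{\partial\theta^{(l)}}f^{(i)}(u;\boldsymbol\theta)$ and $\frac{\partial^2}{\partial\theta^{(k)}\partial\theta^{(l)}}f^{(i)}(u;\boldsymbol\theta)$ are bounded in absolute value by functions $d^{(i)}(u)$, $d^{(i)}_l(u)$ and $d^{(i)}_{k,l}(u)$, respectively, that are absolutely integrable with respect to $\lambda(u;\boldsymbol\theta_0)$. (vii) There exist $\alpha\in(0,1]$ and functions $e^{(i)}_{k,l}(u)$, absolutely integrable with respect to $\lambda(u;\boldsymbol\theta_0)$, such that for $\boldsymbol\theta$ in a neighbourhood of $\boldsymbol\theta_0$ $$\left|\frac{\partial^2}{\partial\theta^{(k)}\partial\theta^{(l)}}f^{(i)}(u;\boldsymbol\theta)-\frac{\partial^2}{\partial\theta^{(k)}\partial\theta^{(l)}}f^{(i)}(u;\boldsymbol\theta_0)\right|\le e^{(i)}_{k,l}(u)\|\boldsymbol\theta-\boldsymbol\theta_0\|^\alpha .$$ (viii)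 The matrix $\widetilde{\boldsymbol U}=\left[\int_{W\times T}f^{(k)}(u;\boldsymbol\theta_0)\lambda(u;\boldsymbol\theta_0)z^{(l)}(u)\,du\right]_{k,l=1}^m$ is invertible. (ix) For all $1\le k,l\le m$, $f^{(k)}(u;\boldsymbol\theta_0)f^{(l)}(u;\boldsymbol\theta_0)$ is absolutely integrable with respect to $\lambda(u;\boldsymbol\theta_0)$. Here $1\le i,k,l\le m$ throughout. For $\boldsymbol\theta\in\boldsymbol\Theta$ define $$\boldsymbol s_n(\boldsymbol\theta)=\sum_{x\in X_n}\boldsymbol f(x;\boldsymbol\theta)-\sum_{x\in D_n}\boldsymbol f(x;\boldsymbol\theta)\frac{\lambda(x;\boldsymbol\theta)}{\rho(x)}.$$ Then for every $n$ there exists an estimator $\widehat{\boldsymbol\theta}_n$ that solves $\boldsymbol s_n(\boldsymbol\theta)=\boldsymbol 0$ with a probability (under $P_{\boldsymbol\theta_0}$) tending to one as $n\to\infty$. Moreover, as $n\to\infty$, $\widehat{\boldsymbol\theta}_n$ converges under $P_{\boldsymbol\theta_0}$ in probability to $\boldsymbol\theta_0$, and $n^{1/2}(\widehat{\boldsymbol\theta}_n-\boldsymbol\theta_0)$ converges under $P_{\boldsymbol\theta_0}$ in distribution to an $m$-dimensional normally distributed random vector with mean $\boldsymbol 0$ and covariance matrix $\widetilde{\boldsymbol U}^{-1}\widetilde{\boldsymbol V}(\widetilde{\boldsymbol U}^{-1})^\top$, where $$\widetilde{\boldsymbol V}=\left[\int_{W\times T}f^{(k)}(u;\boldsymbol\theta_0)f^{(l)}(u;\boldsymbol\theta_0)\lambda(u;\boldsymbol\theta_0)\left(1+\frac{\lambda(u;\boldsymbol\theta_0)}{\rho(u)}\right)du\right]_{k,l=1}^m$$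 $$+\left[\int_{W\times T}\int_{W\times T}f^{(k)}(u;\boldsymbol\theta_0)\lambda(u;\boldsymbol\theta_0)f^{(l)}(v;\boldsymbol\theta_0)\lambda(v;\boldsymbol\theta_0)(g(u,v)+h(u,v)-2)\,du\,dv\right]_{k,l=1}^m.$$
   Context: A point process $Z$ on $W\times T$ has intensity function $\kappa:W\times T\to[0,\infty)$ if $\mathbb{E}\{\sum_{x\in Z}1(x\in B)\}=\int_B\kappa(u)\,du$ for every Borel set $B\subset W\times T$. It has second-order product density $\kappa^{(2)}$ if $\mathbb{E}\{\sum^{\neq}_{x,y\in Z}1(x\in B_1,y\in B_2)\}=\int_{B_1}\int_{B_2}\kappa^{(2)}(u,v)\,du\,dv$ for all Borel $B_1,B_2$ (sum over ordered pairs of distinct points, the left-hand side defining a $\sigma$-finite measure); the pair correlation function is then $\kappa^{(2)}(u,v)/(\kappa(u)\kappa(v))$. Unions of point processes are superpositions, so $\sum_{x\in X_n}=\sum_{i=1}^n\sum_{x\in Y_i}$ and likewise for $D_n$. $P_{\boldsymbol\theta_0}$ denotes the probability distribution under the true parameter value $\boldsymbol\theta_0$, i.e. when each $Y_i$ has intensity function $\lambda(\cdot;\boldsymbol\theta_0)$; the law of the $E_i$ does not depend on $\boldsymbol\theta$. A function $d$ is absolutely integrable with respect to $\lambda(u;\boldsymbol\theta_0)$ if $\int_{W\times T}|d(u)|\lambda(u;\boldsymbol\theta_0)\,du<\infty$. *)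

theory Defs
  imports "HOL-Probability.Probability"
begin

text \<open>
  All state spaces here are bounded, so a locally finite configuration is a finite one, and
  configurations are finite multisets. A set of points is the special case without repeated
  points, and the superposition of point processes is the sum of multisets. The configurations
  in \<open>S\<close> carry the usual sigma-algebra, generated by the numbers of points in Borel sets.
\<close>

definition config :: "'a::topological_space set \<Rightarrow> 'a multiset measure" where
  "config S = sigma {Z. set_mset Z \<subseteq> S}
     {{Z. set_mset Z \<subseteq> S \<and> size (filter_mset (\<lambda>x. x \<in> B) Z) = k} | B k. B \<in> sets borel}"

definition point_process ::
    "'w measure \<Rightarrow> 'a::topological_space set \<Rightarrow> ('w \<Rightarrow> 'a multiset) \<Rightarrow> bool" where
  "point_process P S Z \<longleftrightarrow> Z \<in> P \<rightarrow>\<^sub>M config S"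

definition superposition :: "(nat \<Rightarrow> 'w \<Rightarrow> 'a multiset) \<Rightarrow> nat \<Rightarrow> 'w \<Rightarrow> 'a multiset" where
  "superposition Y n \<omega> = (\<Sum>i = 1..n. Y i \<omega>)"

definition iid_point_processes ::
    "'w measure \<Rightarrow> 'a::topological_space set \<Rightarrow> (nat \<Rightarrow> 'w \<Rightarrow> 'a multiset) \<Rightarrow> bool" where
  "iid_point_processes P S Y \<longleftrightarrow>
     (\<forall>i\<ge>1. point_process P S (Y i)) \<and>
     prob_space.indep_vars P (\<lambda>_. config S) Y {1..} \<and>
     (\<forall>i\<ge>1. distr P (config S) (Y i) = distr P (config S) (Y 1))"

definition independent_sequences ::
    "'w measure \<Rightarrow> 'a::topological_space set \<Rightarrow> (nat \<Rightarrow> 'w \<Rightarrow> 'a multiset) \<Rightarrow>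
      (nat \<Rightarrow> 'w \<Rightarrow> 'a multiset) \<Rightarrow> bool" where
  "independent_sequences P S Y E \<longleftrightarrow>
     prob_space.indep_var P
       (\<Pi>\<^sub>M i\<in>{1..}. config S) (\<lambda>\<omega>. \<lambda>i\<in>{1..}. Y i \<omega>)
       (\<Pi>\<^sub>M i\<in>{1..}. config S) (\<lambda>\<omega>. \<lambda>i\<in>{1..}. E i \<omega>)"

definition has_intensity ::
    "'w measure \<Rightarrow> 'a::euclidean_space set \<Rightarrow> ('w \<Rightarrow> 'a multiset) \<Rightarrow> ('a \<Rightarrow> real) \<Rightarrow> bool" where
  "has_intensity P S Z \<kappa> \<longleftrightarrow>
     (\<forall>u\<in>S. 0 \<le> \<kappa> u) \<and> set_borel_measurable lborel S \<kappa> \<and>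
     (\<forall>B\<in>sets borel. B \<subseteq> S \<longrightarrow>
        (\<integral>\<^sup>+\<omega>. (\<Sum>x\<in>#Z \<omega>. indicator B x) \<partial>P) = (\<integral>\<^sup>+u\<in>B. ennreal (\<kappa> u) \<partial>lborel))"

text \<open>
  The expected number of ordered pairs of distinct points in \<open>C\<close>. Two copies of a repeated point
  count as distinct points, which for a set of points changes nothing.
\<close>

definition expected_pairs :: "'w measure \<Rightarrow> ('w \<Rightarrow> 'a multiset) \<Rightarrow> ('a \<times> 'a) set \<Rightarrow> ennreal" where
  "expected_pairs P Z C =
     (\<integral>\<^sup>+\<omega>. (\<Sum>x\<in>#Z \<omega>. \<Sum>y\<in>#Z \<omega> - {#x#}. indicator C (x, y)) \<partial>P)"

definition pair_moment_measure ::
    "'w measure \<Rightarrow> 'a::topological_space set \<Rightarrow> ('w \<Rightarrow> 'a multiset) \<Rightarrow> ('a \<times> 'a) measure" where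
  "pair_moment_measure P S Z =
     measure_of (S \<times> S) (sets (restrict_space borel (S \<times> S))) (expected_pairs P Z)"

definition has_second_product_density ::
    "'w measure \<Rightarrow> 'a::euclidean_space set \<Rightarrow> ('w \<Rightarrow> 'a multiset) \<Rightarrow> ('a \<Rightarrow> 'a \<Rightarrow> real) \<Rightarrow> bool" where
  "has_second_product_density P S Z \<kappa>2 \<longleftrightarrow>
     (\<forall>u\<in>S. \<forall>v\<in>S. 0 \<le> \<kappa>2 u v) \<and>
     set_borel_measurable lborel (S \<times> S) (\<lambda>(u, v). \<kappa>2 u v) \<and>
     sigma_finite_measure (pair_moment_measure P S Z) \<and>
     (\<forall>B1\<in>sets borel. \<forall>B2\<in>sets borel. B1 \<subseteq> S \<longrightarrow> B2 \<subseteq> S \<longrightarrow>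
        expected_pairs P Z (B1 \<times> B2) =
          (\<integral>\<^sup>+u\<in>B1. (\<integral>\<^sup>+v\<in>B2. ennreal (\<kappa>2 u v) \<partial>lborel) \<partial>lborel))"

definition has_pair_correlation ::
    "'w measure \<Rightarrow> 'a::euclidean_space set \<Rightarrow> ('w \<Rightarrow> 'a multiset) \<Rightarrow> ('a \<Rightarrow> real) \<Rightarrow>
      ('a \<Rightarrow> 'a \<Rightarrow> real) \<Rightarrow> bool" where
  "has_pair_correlation P S Z \<kappa> g \<longleftrightarrow>
     has_intensity P S Z \<kappa> \<and>
     (\<exists>\<kappa>2. has_second_product_density P S Z \<kappa>2 \<and>
        (\<forall>u\<in>S. \<forall>v\<in>S. g u v = \<kappa>2 u v / (\<kappa> u * \<kappa> v)))"

definition partial_deriv :: "'m::finite \<Rightarrow> (real^'m \<Rightarrow> real) \<Rightarrow> real^'m \<Rightarrow> real" where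
  "partial_deriv l F \<theta> = frechet_derivative F (at \<theta>) (axis l 1)"

definition cont_differentiable_on :: "(real^'m::finite \<Rightarrow> real) \<Rightarrow> (real^'m) set \<Rightarrow> bool" where
  "cont_differentiable_on F \<Theta> \<longleftrightarrow>
     F differentiable_on \<Theta> \<and> (\<forall>l. continuous_on \<Theta> (partial_deriv l F))"

definition twice_cont_differentiable_on :: "(real^'m::finite \<Rightarrow> real) \<Rightarrow> (real^'m) set \<Rightarrow> bool" where
  "twice_cont_differentiable_on F \<Theta> \<longleftrightarrow>
     cont_differentiable_on F \<Theta> \<and> (\<forall>l. cont_differentiable_on (partial_deriv l F) \<Theta>)"

definition converges_in_probability ::
    "'w measure \<Rightarrow> (nat \<Rightarrow> 'w \<Rightarrow> 'b::metric_space) \<Rightarrow> 'b \<Rightarrow> bool" where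
  "converges_in_probability P X c \<longleftrightarrow>
     (\<forall>\<epsilon>>0. (\<lambda>n. measure P {\<omega> \<in> space P. dist (X n \<omega>) c > \<epsilon>}) \<longlonglongrightarrow> 0)"

definition converges_in_distribution ::
    "'w measure \<Rightarrow> (nat \<Rightarrow> 'w \<Rightarrow> 'b::topological_space) \<Rightarrow> 'b measure \<Rightarrow> bool" where
  "converges_in_distribution P X \<nu> \<longleftrightarrow>
     (\<forall>\<phi>::'b \<Rightarrow> real. continuous_on UNIV \<phi> \<and> bounded (range \<phi>) \<longrightarrow>
        (\<lambda>n. \<integral>\<omega>. \<phi> (X n \<omega>) \<partial>P) \<longlonglongrightarrow> (\<integral>x. \<phi> x \<partial>\<nu>))"

text \<open>
  The covariance matrix of a normal vector may be singular, so point masses count as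
  one-dimensional normal distributions.
\<close>

definition normal_law :: "real measure \<Rightarrow> bool" where
  "normal_law \<nu> \<longleftrightarrow>
     (\<exists>\<mu>. \<nu> = return borel \<mu>) \<or>
     (\<exists>\<mu> \<sigma>. \<sigma> > 0 \<and> \<nu> = density lborel (\<lambda>x. ennreal (normal_density \<mu> \<sigma> x)))"

definition multivariate_normal ::
    "real^'m::finite \<Rightarrow> real^'m^'m \<Rightarrow> (real^'m) measure \<Rightarrow> bool" where
  "multivariate_normal \<mu> \<Sigma> \<nu> \<longleftrightarrow>
     prob_space \<nu> \<and> sets \<nu> = sets borel \<and>
     (\<forall>a. normal_law (distr \<nu> borel (\<lambda>x. a \<bullet> x))) \<and>
     (\<forall>k. (\<integral>x. x $ k \<partial>\<nu>) = \<mu> $ k) \<and>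
     (\<forall>k l. (\<integral>x. (x $ k - \<mu> $ k) * (x $ l - \<mu> $ l) \<partial>\<nu>) = \<Sigma> $ k $ l)"

definition loglinear_intensity ::
    "('a \<Rightarrow> real) \<Rightarrow> ('a \<Rightarrow> real^'m::finite) \<Rightarrow> real^'m \<Rightarrow> 'a \<Rightarrow> real" where
  "loglinear_intensity b z \<theta> u = b u * exp (\<theta> \<bullet> z u)"

definition score ::
    "(real^'m::finite \<Rightarrow> 'a \<Rightarrow> real^'m) \<Rightarrow> (real^'m \<Rightarrow> 'a \<Rightarrow> real) \<Rightarrow> ('a \<Rightarrow> real) \<Rightarrow>
      'a multiset \<Rightarrow> 'a multiset \<Rightarrow> real^'m \<Rightarrow> real^'m" where
  "score f lam \<rho> X D \<theta> =
     (\<Sum>x\<in>#X. f \<theta> x) - (\<Sum>x\<in>#D. (lam \<theta> x / \<rho> x) *\<^sub>R f \<theta> x)"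

text \<open>
  An estimator is a measurable function of the two observed configurations, with values in the
  parameter set.
\<close>

definition estimator ::
    "'a::topological_space set \<Rightarrow> 'b::topological_space set \<Rightarrow>
      ('a multiset \<times> 'a multiset \<Rightarrow> 'b) \<Rightarrow> bool" where
  "estimator S \<Theta> \<tau> \<longleftrightarrow> \<tau> \<in> config S \<Otimes>\<^sub>M config S \<rightarrow>\<^sub>M restrict_space borel \<Theta>"

text \<open>
  In the two matrices, \<open>f0\<close> and \<open>lam0\<close> are the test function and the intensity at the true
  parameter value.
\<close>

definition U_matrix ::
    "'a::euclidean_space set \<Rightarrow> ('a \<Rightarrow> real^'m::finite) \<Rightarrow> ('a \<Rightarrow> real) \<Rightarrow> ('a \<Rightarrow> real^'m) \<Rightarrow>
      real^'m^'m" where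
  "U_matrix S f0 lam0 z = (\<chi> k l. LINT u:S|lborel. f0 u $ k * lam0 u * z u $ l)"

definition V_matrix ::
    "'a::euclidean_space set \<Rightarrow> ('a \<Rightarrow> real^'m::finite) \<Rightarrow> ('a \<Rightarrow> real) \<Rightarrow> ('a \<Rightarrow> real) \<Rightarrow>
      ('a \<Rightarrow> 'a \<Rightarrow> real) \<Rightarrow> ('a \<Rightarrow> 'a \<Rightarrow> real) \<Rightarrow> real^'m^'m" where
  "V_matrix S f0 lam0 \<rho> g h =
     (\<chi> k l. LINT u:S|lborel. f0 u $ k * f0 u $ l * lam0 u * (1 + lam0 u / \<rho> u)) +
     (\<chi> k l. LINT v:S|lborel. (LINT u:S|lborel.
        f0 u $ k * lam0 u * (f0 v $ l * lam0 v) * (g u v + h u v - 2)))"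

end

theory Submission
  imports Defs
begin

text \<open>
  Write \<open>F\<^sub>n = s\<^sub>n / n\<close> and \<open>A\<close> for the inverse of the matrix \<open>U\<close>. By the law of large numbers the
  derivative of \<open>F\<^sub>n\<close> at \<open>\<theta>0\<close> tends to \<open>- U\<close>, and the bounds on the second derivatives make that
  derivative Lipschitz on a fixed ball around \<open>\<theta>0\<close> with a constant that is bounded in probability.
  Hence, with probability tending to one, \<open>\<theta> \<mapsto> \<theta> + A (F\<^sub>n \<theta>)\<close> is a contraction of a fixed small ball;
  its fixed point is the estimator, and it is measurable as the limit of the iterates started at
  \<open>\<theta>0\<close>. The contraction estimate also shows that the estimator differs from \<open>\<theta>0 + A (F\<^sub>n \<theta>0)\<close> by a
  term of smaller order than \<open>n\<close> to the power \<open>- 1/2\<close>. The summands of \<open>F\<^sub>n \<theta>0\<close> are independent and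
  centred, and Campbell's formulas of first and second order give their covariance matrix, so the
  one-dimensional central limit theorem and the Cramer-Wold device yield the normal limit.
\<close>

section \<open>Limit theorems for sums of independent random variables\<close>

text \<open>The centring of the score and the limit \<open>- U\<close> have one source: a point of
  the second sample carries the weight \<lambda>/\<rho>, which turns integrals against \<rho> into
  integrals against \<lambda>. So the two sums have equal means at \<theta>0, and in the derivative
  the terms with derivatives of \<open>f\<close> cancel, leaving only the derivative of the
  intensity, which is the intensity times \<open>z\<close>. The functions dominating the derivatives
  are merely integrable: sums of them over a process have a mean but possibly no variance, so the
  law of large numbers has to work in L1. Second moments are available for the score at \<theta>0,
  because products of its components are integrable and pair correlations are bounded. An estimator
  has to be a measurable function of the data, defined for every configuration and every
  \<open>n\<close>, which rules out picking a root by mere existence. Iterating with the fixed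
  inverse of \<open>U\<close> instead of that of the random derivative settles this; using the true
  \<theta>0 and \<open>U\<close> in the construction is legitimate, since the claim is one of
  existence.\<close>

lemma (in prob_space) integral_indep_sum_sq:
  fixes X :: "nat \<Rightarrow> 'a \<Rightarrow> real"
  assumes indep: "indep_vars (\<lambda>_. borel) X UNIV"
    and sq: "\<And>i. integrable M (\<lambda>\<omega>. (X i \<omega>)\<^sup>2)"
    and mean: "\<And>i. expectation (X i) = 0"
    and var: "\<And>i. expectation (\<lambda>\<omega>. (X i \<omega>)\<^sup>2) = v"
  shows "integrable M (\<lambda>\<omega>. (\<Sum>i<n. X i \<omega>)\<^sup>2)"
    and "expectation (\<lambda>\<omega>. (\<Sum>i<n. X i \<omega>)\<^sup>2) = real n * v"
proof -
  have rv[measurable]: "X i \<in> borel_measurable M" for i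
    using indep by (auto simp: indep_vars_def2)
  have int: "integrable M (X i)" for i
    using sq by (rule square_integrable_imp_integrable[rotated]) simp
  have prod: "integrable M (\<lambda>\<omega>. X i \<omega> * X j \<omega>) \<and> expectation (\<lambda>\<omega>. X i \<omega> * X j \<omega>) = 0"
    if "i \<noteq> j" for i j
  proof -
    \<comment> \<open>The independence of a variable from a sum over other indices is applied with a
      sum of one term.\<close>
    have "indep_var borel (X i) borel (X j)"
      using indep_vars_sum[of "{j}" i X] indep_vars_subset[OF indep, of "{i, j}"] that
      by (simp add: insert_commute)
    from indep_var_lebesgue_integral[OF this int int] indep_var_integrable[OF this int int]
    show ?thesis by (simp add: mean)
  qed
  have *: "integrable M (\<lambda>\<omega>. X i \<omega> * X j \<omega>)" for i j
    using prod[of i j] sq[of i] by (cases "i = j") (auto simp: power2_eq_square)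
  have eq: "(\<Sum>i<n. X i \<omega>)\<^sup>2 = (\<Sum>i<n. \<Sum>j<n. X i \<omega> * X j \<omega>)" for \<omega>
    by (simp add: power2_eq_square sum_product)
  show "integrable M (\<lambda>\<omega>. (\<Sum>i<n. X i \<omega>)\<^sup>2)"
    unfolding eq by (intro Bochner_Integration.integrable_sum *)
  have "expectation (\<lambda>\<omega>. (\<Sum>i<n. X i \<omega>)\<^sup>2) = (\<Sum>i<n. \<Sum>j<n. expectation (\<lambda>\<omega>. X i \<omega> * X j \<omega>))"
    unfolding eq using * by (simp add: Bochner_Integration.integral_sum)
  also have "\<dots> = (\<Sum>i<n. \<Sum>j<n. if i = j then v else 0)"
    using prod var by (intro sum.cong refl) (auto simp: power2_eq_square)
  also have "\<dots> = real n * v" by simp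
  finally show "expectation (\<lambda>\<omega>. (\<Sum>i<n. X i \<omega>)\<^sup>2) = real n * v" .
qed

lemma (in prob_space) expectation_eq_of_distr_eq:
  fixes g :: "real \<Rightarrow> real"
  assumes [measurable]: "X \<in> borel_measurable M" "Y \<in> borel_measurable M" "g \<in> borel_measurable borel"
    and eq: "distr M borel X = distr M borel Y"
  shows "expectation (\<lambda>\<omega>. g (X \<omega>)) = expectation (\<lambda>\<omega>. g (Y \<omega>))"
    and "integrable M (\<lambda>\<omega>. g (X \<omega>)) \<longleftrightarrow> integrable M (\<lambda>\<omega>. g (Y \<omega>))"
proof -
  have "expectation (\<lambda>\<omega>. g (X \<omega>)) = (LINT x|distr M borel X. g x)"
    by (simp add: integral_distr)
  then show "expectation (\<lambda>\<omega>. g (X \<omega>)) = expectation (\<lambda>\<omega>. g (Y \<omega>))"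
    unfolding eq by (simp add: integral_distr)
  have "integrable M (\<lambda>\<omega>. g (X \<omega>)) \<longleftrightarrow> integrable (distr M borel X) g"
    by (simp add: integrable_distr_eq)
  then show "integrable M (\<lambda>\<omega>. g (X \<omega>)) \<longleftrightarrow> integrable M (\<lambda>\<omega>. g (Y \<omega>))"
    unfolding eq by (simp add: integrable_distr_eq)
qed

lemma (in prob_space) prob_abs_gt_le_expectation:
  assumes "integrable M f" "0 < (c::real)"
  shows "prob {\<omega>\<in>space M. \<bar>f \<omega>\<bar> > c} \<le> expectation (\<lambda>\<omega>. \<bar>f \<omega>\<bar>) / c"
proof -
  have [measurable]: "f \<in> borel_measurable M" using assms by auto
  have "prob {\<omega>\<in>space M. \<bar>f \<omega>\<bar> > c} \<le> prob {\<omega>\<in>space M. \<bar>f \<omega>\<bar> \<ge> c}"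
    by (intro finite_measure_mono) auto
  also have "\<dots> \<le> expectation (\<lambda>\<omega>. \<bar>f \<omega>\<bar>) / c"
    using integral_Markov_inequality_measure[of M "\<lambda>\<omega>. \<bar>f \<omega>\<bar>" "{}" c] assms by simp
  finally show ?thesis .
qed

text \<open>Truncation: the bounded parts obey Chebyshev's inequality, and the remainders are small in
  \<open>L\<^sup>1\<close>, so that no second moment is required.\<close>

lemma (in prob_space) weak_law_of_large_numbers:
  fixes X :: "nat \<Rightarrow> 'a \<Rightarrow> real"
  assumes indep: "indep_vars (\<lambda>_. borel) X UNIV"
    and ident: "\<And>i. distr M borel (X i) = distr M borel (X 0)"
    and int: "integrable M (X 0)" and "0 < \<epsilon>"
  shows "(\<lambda>n. prob {\<omega>\<in>space M. \<bar>(\<Sum>i<n. X i \<omega>) / real n - expectation (X 0)\<bar> > \<epsilon>}) \<longlonglongrightarrow> 0"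
proof (rule LIMSEQ_I)
  fix r :: real assume "0 < r"
  have rv[measurable]: "X i \<in> borel_measurable M" for i
    using indep by (auto simp: indep_vars_def2)
  define h where "h K x = (if \<bar>x\<bar> \<le> K then x else (0::real))" for K x
  have [measurable]: "h K \<in> borel_measurable borel" for K
    unfolding h_def by measurable
  have abs_h: "\<bar>h K x\<bar> \<le> \<bar>x\<bar>" "\<bar>x - h K x\<bar> \<le> \<bar>x\<bar>" for K x by (auto simp: h_def)
  \<comment> \<open>For fixed \<omega> the remainder is zero once \<open>k\<close> exceeds the
    absolute value of \<open>X 0 \<omega>\<close>, and the integrable \<open>X 0\<close> dominates;
    so some level \<open>k\<close> makes the remainder small in mean.\<close>
  have "(\<lambda>k. expectation (\<lambda>\<omega>. \<bar>X 0 \<omega> - h (real k) (X 0 \<omega>)\<bar>)) \<longlonglongrightarrow> expectation (\<lambda>_. 0)"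
  proof (rule integral_dominated_convergence[where w="\<lambda>\<omega>. \<bar>X 0 \<omega>\<bar>"])
    show "AE \<omega> in M. (\<lambda>k. \<bar>X 0 \<omega> - h (real k) (X 0 \<omega>)\<bar>) \<longlonglongrightarrow> 0"
    proof (rule AE_I2, rule tendsto_eventually)
      fix \<omega>
      obtain N :: nat where "\<bar>X 0 \<omega>\<bar> \<le> real N" using real_arch_simple by blast
      then show "\<forall>\<^sub>F k in sequentially. \<bar>X 0 \<omega> - h (real k) (X 0 \<omega>)\<bar> = 0"
        by (intro eventually_sequentiallyI[of N]) (auto simp: h_def)
    qed
  qed (use int abs_h in auto)
  then have "(\<lambda>k. expectation (\<lambda>\<omega>. \<bar>X 0 \<omega> - h (real k) (X 0 \<omega>)\<bar>)) \<longlonglongrightarrow> 0" by simp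
  \<comment> \<open>The first bound keeps the shift of the mean below \<epsilon>/3; the second makes
    the Markov bound 3\<eta>/\<epsilon> for the remainders at most r/4.\<close>
  moreover define \<eta> where "\<eta> = min (\<epsilon> / 3) (r * \<epsilon> / 12)"
  moreover have "0 < \<eta>" using \<open>0 < r\<close> \<open>0 < \<epsilon>\<close> by (simp add: \<eta>_def)
  ultimately obtain k where k: "expectation (\<lambda>\<omega>. \<bar>X 0 \<omega> - h (real k) (X 0 \<omega>)\<bar>) < \<eta>"
    by (metis (lifting) LIMSEQ_D abs_less_iff diff_0_right order_refl real_norm_def)
  define K where "K = real k"
  define m where "m = expectation (\<lambda>\<omega>. h K (X 0 \<omega>))"
  define Z where "Z i \<omega> = h K (X i \<omega>) - m" for i \<omega>
  define R where "R i \<omega> = X i \<omega> - h K (X i \<omega>)" for i \<omega>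
  have int_h: "integrable M (\<lambda>\<omega>. h K (X i \<omega>))" for i
    by (rule integrable_const_bound[where B=K]) (auto simp: h_def K_def)
  have Em: "expectation (\<lambda>\<omega>. h K (X i \<omega>)) = m" for i
    unfolding m_def by (rule expectation_eq_of_distr_eq[OF _ _ _ ident]) auto
  have bd: "\<bar>h K (X i \<omega>)\<bar> \<le> K" "\<bar>m\<bar> \<le> K" for i \<omega>
  proof -
    show *: "\<bar>h K (X i \<omega>)\<bar> \<le> K" for i \<omega> by (auto simp: h_def K_def)
    have "norm m \<le> expectation (\<lambda>\<omega>. norm (h K (X 0 \<omega>)))" unfolding m_def by (rule integral_norm_bound)
    also have "\<dots> \<le> expectation (\<lambda>\<omega>. K)" using int_h * by (intro integral_mono) auto
    finally show "\<bar>m\<bar> \<le> K" by (simp add: prob_space)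
  qed
  have Zb: "\<bar>Z i \<omega>\<bar> \<le> 2 * K" for i \<omega> unfolding Z_def using bd(1)[of i \<omega>] bd(2) by linarith
  have Z_indep: "indep_vars (\<lambda>_. borel) Z UNIV"
    unfolding Z_def using indep by (rule indep_vars_compose2[where Y="\<lambda>i x. h K x - m"]) auto
  have [measurable]: "Z i \<in> borel_measurable M" "R i \<in> borel_measurable M" for i
    by (simp_all add: Z_def[abs_def] R_def[abs_def])
  define v where "v = expectation (\<lambda>\<omega>. (Z 0 \<omega>)\<^sup>2)"
  have Zsq: "integrable M (\<lambda>\<omega>. (Z i \<omega>)\<^sup>2)" for i
  proof (rule integrable_const_bound[where B="(2*K)\<^sup>2"])
    have "(Z i \<omega>)\<^sup>2 \<le> (2*K)\<^sup>2" for \<omega>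
      using power_mono[OF Zb[of i \<omega>], of 2] by simp
    then show "AE \<omega> in M. norm ((Z i \<omega>)\<^sup>2) \<le> (2*K)\<^sup>2"
      by (intro AE_I2) (simp del: power_mult_distrib)
  qed auto
  have EZsq: "expectation (\<lambda>\<omega>. (Z i \<omega>)\<^sup>2) = v" for i
    unfolding v_def Z_def
    by (rule expectation_eq_of_distr_eq[where g="\<lambda>x. (h K x - m)\<^sup>2", OF _ _ _ ident]) auto
  have EZ: "expectation (Z i) = 0" for i
    unfolding Z_def using int_h Em by (simp add: prob_space)
  note sumsq = integral_indep_sum_sq[OF Z_indep Zsq EZ EZsq]
  have intX: "integrable M (X i)" for i
    using expectation_eq_of_distr_eq(2)[of "X i" "X 0" "\<lambda>x. x"] ident[of i] int rv by simp
  have intR: "integrable M (\<lambda>\<omega>. \<bar>R i \<omega>\<bar>)" for i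
    unfolding R_def by (intro integrable_abs Bochner_Integration.integrable_diff intX int_h)
  have ER: "expectation (\<lambda>\<omega>. \<bar>R i \<omega>\<bar>) < \<eta>" for i
  proof -
    have "expectation (\<lambda>\<omega>. \<bar>R i \<omega>\<bar>) = expectation (\<lambda>\<omega>. \<bar>R 0 \<omega>\<bar>)"
      unfolding R_def
      by (rule expectation_eq_of_distr_eq(1)[of "X i" "X 0" "\<lambda>x. \<bar>x - h K x\<bar>", OF _ _ _ ident]) auto
    then show ?thesis using k by (simp add: R_def K_def)
  qed
  have mean_diff: "\<bar>expectation (X 0) - m\<bar> \<le> \<epsilon> / 3"
  proof -
    have "expectation (X 0) - m = expectation (R 0)"
      unfolding R_def m_def using int int_h by simp
    also have "\<bar>\<dots>\<bar> \<le> expectation (\<lambda>\<omega>. \<bar>R 0 \<omega>\<bar>)"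
      using integral_norm_bound[of M "R 0"] by simp
    finally show ?thesis using ER[of 0] by (simp add: \<eta>_def)
  qed
  have bound: "prob {\<omega>\<in>space M. \<bar>(\<Sum>i<n. X i \<omega>) / real n - expectation (X 0)\<bar> > \<epsilon>}
      \<le> 9 * v / (real n * \<epsilon>\<^sup>2) + r / 4" if "0 < n" for n
  proof -
    let ?A = "{\<omega>\<in>space M. \<bar>(\<Sum>i<n. Z i \<omega>)\<^sup>2\<bar> > (real n * \<epsilon> / 3)\<^sup>2}"
    let ?B = "{\<omega>\<in>space M. \<bar>\<Sum>i<n. \<bar>R i \<omega>\<bar>\<bar> > real n * \<epsilon> / 3}"
    \<comment> \<open>A deviation is the sum of three parts: centred truncated variables,
      remainders, and the shift of the mean. If the last two stay within a third of \<epsilon>, the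
      first must exceed a third.\<close>
    have "{\<omega>\<in>space M. \<bar>(\<Sum>i<n. X i \<omega>) / real n - expectation (X 0)\<bar> > \<epsilon>} \<subseteq> ?A \<union> ?B"
    proof safe
      fix \<omega> assume w: "\<omega> \<in> space M" "\<epsilon> < \<bar>(\<Sum>i<n. X i \<omega>) / real n - expectation (X 0)\<bar>"
        and nB: "\<not> \<bar>\<Sum>i<n. \<bar>R i \<omega>\<bar>\<bar> > real n * \<epsilon> / 3"
      have "(\<Sum>i<n. X i \<omega>) = (\<Sum>i<n. Z i \<omega>) + (\<Sum>i<n. R i \<omega>) + real n * m"
        by (simp add: Z_def R_def sum.distrib[symmetric] sum_subtractf)
      then have "(\<Sum>i<n. X i \<omega>) / real n = (\<Sum>i<n. Z i \<omega>) / real n + (\<Sum>i<n. R i \<omega>) / real n + m"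
        using that by (simp add: field_simps)
      moreover have "\<bar>(\<Sum>i<n. R i \<omega>) / real n\<bar> \<le> \<epsilon> / 3"
      proof -
        have "\<bar>\<Sum>i<n. R i \<omega>\<bar> \<le> real n * \<epsilon> / 3"
          using nB sum_abs[of "\<lambda>i. R i \<omega>" "{..<n}"] by linarith
        then show ?thesis using that by (simp add: abs_divide field_simps)
      qed
      ultimately have "\<bar>(\<Sum>i<n. Z i \<omega>) / real n\<bar> > \<epsilon> / 3"
        using w mean_diff by linarith
      then have "\<bar>\<Sum>i<n. Z i \<omega>\<bar> > real n * \<epsilon> / 3"
        using that by (simp add: abs_divide field_simps)
      then have "(real n * \<epsilon> / 3)\<^sup>2 < \<bar>\<Sum>i<n. Z i \<omega>\<bar>\<^sup>2"
        using \<open>0 < \<epsilon>\<close> by (intro power_strict_mono) auto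
      then show "(real n * \<epsilon> / 3)\<^sup>2 < \<bar>(\<Sum>i<n. Z i \<omega>)\<^sup>2\<bar>" by simp
    qed
    then have "prob {\<omega>\<in>space M. \<bar>(\<Sum>i<n. X i \<omega>) / real n - expectation (X 0)\<bar> > \<epsilon>} \<le> prob (?A \<union> ?B)"
      by (intro finite_measure_mono) auto
    also have "\<dots> \<le> prob ?A + prob ?B" by (intro measure_Un_le) auto
    also have "prob ?A \<le> real n * v / (real n * \<epsilon> / 3)\<^sup>2"
      using prob_abs_gt_le_expectation[OF sumsq(1)[of n], of "(real n * \<epsilon> / 3)\<^sup>2"] sumsq(2)[of n] that \<open>0 < \<epsilon>\<close>
      by simp
    also have "prob ?B \<le> (real n * \<eta>) / (real n * \<epsilon> / 3)"
    proof -
      have "prob ?B \<le> expectation (\<lambda>\<omega>. \<bar>\<Sum>i<n. \<bar>R i \<omega>\<bar>\<bar>) / (real n * \<epsilon> / 3)"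
        using intR that \<open>0 < \<epsilon>\<close> by (intro prob_abs_gt_le_expectation) auto
      also have "expectation (\<lambda>\<omega>. \<bar>\<Sum>i<n. \<bar>R i \<omega>\<bar>\<bar>) = (\<Sum>i<n. expectation (\<lambda>\<omega>. \<bar>R i \<omega>\<bar>))"
        using intR by (simp add: sum_nonneg)
      also have "\<dots> \<le> (\<Sum>i<n. \<eta>)" using ER by (intro sum_mono) (auto intro: less_imp_le)
      finally show ?thesis using that \<open>0 < \<epsilon>\<close> by (simp add: divide_right_mono)
    qed
    also have "(real n * \<eta>) / (real n * \<epsilon> / 3) \<le> r / 4"
      using that \<open>0 < \<epsilon>\<close> by (simp add: \<eta>_def field_simps min_def)
    finally show ?thesis using that \<open>0 < \<epsilon>\<close> by (simp add: field_simps power2_eq_square)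
  qed
  have "(\<lambda>n. 9 * v / (real n * \<epsilon>\<^sup>2) + r / 4) \<longlonglongrightarrow> 0 + r / 4"
    using \<open>0 < \<epsilon>\<close> by (intro tendsto_intros tendsto_divide_0[OF tendsto_const] filterlim_at_top_imp_at_infinity
       filterlim_tendsto_pos_mult_at_top[OF tendsto_const _ filterlim_real_sequentially, of "\<epsilon>\<^sup>2", simplified mult.commute[of "\<epsilon>\<^sup>2"]]) auto
  then have "\<forall>\<^sub>F n in sequentially. 9 * v / (real n * \<epsilon>\<^sup>2) + r / 4 < r"
    by (rule order_tendstoD(2)) (use \<open>0 < r\<close> in simp)
  then have "\<forall>\<^sub>F n in sequentially. prob {\<omega>\<in>space M. \<bar>(\<Sum>i<n. X i \<omega>) / real n - expectation (X 0)\<bar> > \<epsilon>} < r"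
    using eventually_gt_at_top[of 0]
  proof eventually_elim
    case (elim n)
    show ?case using bound[OF elim(2)] elim(1) by (rule le_less_trans)
  qed
  then show "\<exists>no. \<forall>n\<ge>no. norm (prob {\<omega>\<in>space M. \<bar>(\<Sum>i<n. X i \<omega>) / real n - expectation (X 0)\<bar> > \<epsilon>} - 0) < r"
    by (simp add: eventually_sequentially)
qed

section \<open>The Cramer-Wold device\<close>

text \<open>These are functions whose expectations are determined by the laws of the projections
  \<open>a \<bullet> x\<close>. The phase \<open>b\<close> makes sines and constants available
  without further clauses.\<close>

inductive trig_poly :: "('a::real_inner \<Rightarrow> real) \<Rightarrow> bool" where
  trig_poly_cos: "trig_poly (\<lambda>x. c * cos (a \<bullet> x + b))"
| trig_poly_add: "trig_poly p \<Longrightarrow> trig_poly q \<Longrightarrow> trig_poly (\<lambda>x. p x + q x)"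

lemma trig_poly_const: "trig_poly (\<lambda>x. c)"
  using trig_poly_cos[of c 0 0] by simp

lemma trig_poly_sum: "(\<And>i. i \<in> I \<Longrightarrow> trig_poly (p i)) \<Longrightarrow> trig_poly (\<lambda>x. \<Sum>i\<in>I. p i x)"
  by (induction I rule: infinite_finite_induct) (simp_all add: trig_poly_const trig_poly_add)

text \<open>By the product-to-sum formula products of cosines are sums of cosines, so the class
  becomes an algebra and polynomials in its members stay inside it.\<close>

lemma trig_poly_cos_mult:
  assumes "trig_poly q"
  shows "trig_poly (\<lambda>x. c * cos (a \<bullet> x + b) * q x)"
  using assms
proof induction
  case (trig_poly_cos c' a' b')
  have "(\<lambda>x. c * cos (a \<bullet> x + b) * (c' * cos (a' \<bullet> x + b'))) =
    (\<lambda>x. c * c' / 2 * cos ((a - a') \<bullet> x + (b - b')) + c * c' / 2 * cos ((a + a') \<bullet> x + (b + b')))"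
  proof
    fix x
    have "cos (a \<bullet> x + b) * cos (a' \<bullet> x + b') =
      (cos ((a - a') \<bullet> x + (b - b')) + cos ((a + a') \<bullet> x + (b + b'))) / 2"
      by (subst cos_times_cos) (simp add: inner_diff_left inner_add_left algebra_simps)
    then show "c * cos (a \<bullet> x + b) * (c' * cos (a' \<bullet> x + b')) =
      c * c' / 2 * cos ((a - a') \<bullet> x + (b - b')) + c * c' / 2 * cos ((a + a') \<bullet> x + (b + b'))"
      by (simp add: field_simps)
  qed
  then show ?case
    by (simp only:) (intro trig_poly.intros)
next
  case (trig_poly_add p q)
  then show ?case using trig_poly.trig_poly_add by (simp add: distrib_left)
qed

lemma trig_poly_mult:
  assumes "trig_poly p" "trig_poly q"
  shows "trig_poly (\<lambda>x. p x * q x)"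
  using assms(1)
proof induction
  case (trig_poly_cos c a b)
  then show ?case using assms(2) by (rule trig_poly_cos_mult)
next
  case (trig_poly_add p1 p2)
  then show ?case using trig_poly.trig_poly_add by (simp add: distrib_right)
qed

text \<open>A bounded substitute for the coordinates, each component being a trigonometric
  polynomial. On the cube of half-width \<open>R\<close> it is injective, because 1 is less than
  pi/2, and \<open>arcsin\<close> undoes it.\<close>

definition sin_coords :: "real \<Rightarrow> 'a::euclidean_space \<Rightarrow> 'a" where
  "sin_coords R x = (\<Sum>b\<in>Basis. sin (x \<bullet> b / R) *\<^sub>R b)"

lemma sin_coords_inner: "b \<in> Basis \<Longrightarrow> sin_coords R x \<bullet> b = sin (x \<bullet> b / R)"
  by (simp add: sin_coords_def)

lemma trig_poly_polynomial_sin_coords: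
  fixes p :: "'a::euclidean_space \<Rightarrow> real"
  assumes "real_polynomial_function p"
  shows "trig_poly (\<lambda>x. p (sin_coords R x))"
  using assms
proof induction
  case (linear h)
  interpret h: bounded_linear h by fact
  have "h (sin_coords R x) = (\<Sum>b\<in>Basis. h b * cos (((1 / R) *\<^sub>R b) \<bullet> x + (- pi/2)))" for x
    unfolding sin_coords_def
  proof (subst h.sum, intro sum.cong refl)
    fix b :: 'a
    have "cos (((1 / R) *\<^sub>R b) \<bullet> x + (- pi/2)) = sin (x \<bullet> b / R)"
    proof -
      have "((1 / R) *\<^sub>R b) \<bullet> x + (- pi/2) = x \<bullet> b / R - pi/2"
        by (simp add: inner_commute)
      then show ?thesis by (simp add: cos_diff inner_commute)
    qed
    then show "h (sin (x \<bullet> b / R) *\<^sub>R b) = h b * cos (((1 / R) *\<^sub>R b) \<bullet> x + (- pi/2))"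
      by (simp add: h.scaleR)
  qed
  then show ?case by (simp only:) (intro trig_poly_sum trig_poly_cos)
next
  case (const c)
  show ?case by (rule trig_poly_const)
next
  case (add p q)
  from add.IH show ?case by (rule trig_poly_add)
next
  case (mult p q)
  from mult.IH show ?case by (rule trig_poly_mult)
qed

lemma trig_poly_continuous: "trig_poly p \<Longrightarrow> continuous_on UNIV p"
  by (induction rule: trig_poly.induct) (auto intro!: continuous_intros)

lemma trig_poly_bounded:
  assumes "trig_poly p" obtains B where "\<And>x. \<bar>p x\<bar> \<le> B"
proof -
  have "\<exists>B. \<forall>x. \<bar>p x\<bar> \<le> B" using assms
  proof induction
    case (trig_poly_cos c a b)
    have "\<bar>c * cos (a \<bullet> x + b)\<bar> \<le> \<bar>c\<bar>" for x
      by (simp add: abs_mult mult_left_le)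
    then show ?case by blast
  next
    case (trig_poly_add p q)
    then obtain B C where "\<And>x. \<bar>p x\<bar> \<le> B" "\<And>x. \<bar>q x\<bar> \<le> C" by auto
    then have "\<bar>p x + q x\<bar> \<le> B + C" for x by (meson abs_triangle_ineq add_mono order_trans)
    then show ?case by blast
  qed
  then show ?thesis using that by blast
qed

lemma integrable_continuous_bounded:
  fixes \<phi> :: "'b::topological_space \<Rightarrow> real"
  assumes "prob_space N" "Z \<in> borel_measurable N" "continuous_on UNIV \<phi>" "\<And>x. \<bar>\<phi> x\<bar> \<le> B"
  shows "integrable N (\<lambda>\<omega>. \<phi> (Z \<omega>))"
proof -
  interpret N: prob_space N by fact
  note [measurable] = assms(2) borel_measurable_continuous_onI[OF assms(3)]
  show ?thesis
    using assms(4) by (intro N.integrable_const_bound[where B=B]) auto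
qed

text \<open>The polynomials in the sines of the rescaled coordinates approximate a given bounded function
  uniformly on a large cube and keep its bounds elsewhere, since the sines are bounded.\<close>

theorem cramer_wold:
  fixes Z :: "nat \<Rightarrow> 'w \<Rightarrow> 'b::euclidean_space" and \<nu> :: "'b measure"
  assumes P: "prob_space P" and \<nu>: "prob_space \<nu>" and sets_\<nu>: "sets \<nu> = sets borel"
    and Z[measurable]: "\<And>n. Z n \<in> borel_measurable P"
    and conv: "\<And>a. weak_conv_m (\<lambda>n. distr P borel (\<lambda>\<omega>. a \<bullet> Z n \<omega>)) (distr \<nu> borel (\<lambda>x. a \<bullet> x))"
  shows "converges_in_distribution P Z \<nu>"
  unfolding converges_in_distribution_def
proof (intro allI impI)
  interpret P: prob_space P by (rule P)
  interpret \<nu>: prob_space \<nu> by (rule \<nu>)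
  note [measurable_cong] = sets_\<nu>
  have id[measurable]: "(\<lambda>x. x) \<in> borel_measurable \<nu>" by measurable
  have conv1: "(\<lambda>n. \<integral>\<omega>. \<psi> (a \<bullet> Z n \<omega>) \<partial>P) \<longlonglongrightarrow> (\<integral>x. \<psi> (a \<bullet> x) \<partial>\<nu>)"
    if \<psi>: "continuous_on UNIV \<psi>" "\<And>s. \<bar>\<psi> s\<bar> \<le> B" for \<psi> :: "real \<Rightarrow> real" and B a
  proof -
    have [measurable]: "\<psi> \<in> borel_measurable borel" by (intro borel_measurable_continuous_onI \<psi>)
    have "(\<lambda>n. integral\<^sup>L (distr P borel (\<lambda>\<omega>. a \<bullet> Z n \<omega>)) \<psi>) \<longlonglongrightarrow> integral\<^sup>L (distr \<nu> borel (\<lambda>x. a \<bullet> x)) \<psi>"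
    proof (rule weak_conv_imp_integral_bdd_continuous_conv[OF _ _ conv])
      show "real_distribution (distr P borel (\<lambda>\<omega>. a \<bullet> Z n \<omega>))" for n
        by (intro P.real_distribution_distr) measurable
      show "real_distribution (distr \<nu> borel (\<lambda>x. a \<bullet> x))"
        by (intro \<nu>.real_distribution_distr) measurable
      show "isCont \<psi> x" for x using \<psi>(1) by (simp add: continuous_on_eq_continuous_at)
      show "norm (\<psi> x) \<le> B" for x using \<psi>(2) by simp
    qed
    then show ?thesis by (simp add: integral_distr)
  qed
  \<comment> \<open>Each generator is a bounded continuous function of a single projection, where
    the assumed one-dimensional convergence applies.\<close>
  have conv_trig: "(\<lambda>n. \<integral>\<omega>. p (Z n \<omega>) \<partial>P) \<longlonglongrightarrow> (\<integral>x. p x \<partial>\<nu>)" if "trig_poly p" for p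
    using that
  proof induction
    case (trig_poly_cos c a b)
    show ?case
      by (rule conv1[of "\<lambda>s. c * cos (s + b)" "\<bar>c\<bar>"])
         (auto intro!: continuous_intros simp: abs_mult mult_left_le)
  next
    case (trig_poly_add p q)
    have "integrable P (\<lambda>\<omega>. p (Z n \<omega>))" "integrable \<nu> p" if p: "trig_poly p" for p n
    proof -
      obtain B where "\<And>x. \<bar>p x\<bar> \<le> B" by (rule trig_poly_bounded[OF p]) blast
      from integrable_continuous_bounded[OF P Z trig_poly_continuous[OF p] this]
        integrable_continuous_bounded[OF \<nu> id trig_poly_continuous[OF p] this]
      show "integrable P (\<lambda>\<omega>. p (Z n \<omega>))" "integrable \<nu> p" by simp_all
    qed
    note this[OF trig_poly_add.hyps(1)] this[OF trig_poly_add.hyps(2)]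
    with trig_poly_add.IH show ?case by (simp add: tendsto_add)
  qed
  fix \<phi> :: "'b \<Rightarrow> real" assume \<phi>: "continuous_on UNIV \<phi> \<and> bounded (range \<phi>)"
  then obtain B where B: "\<And>x. \<bar>\<phi> x\<bar> \<le> B" "0 < B" by (auto simp: bounded_pos)
  have int_\<phi>: "integrable P (\<lambda>\<omega>. \<phi> (Z n \<omega>))" "integrable \<nu> \<phi>" for n
    using integrable_continuous_bounded[OF P Z conjunct1[OF \<phi>] B(1)]
      integrable_continuous_bounded[OF \<nu> id conjunct1[OF \<phi>] B(1)] by simp_all
  \<comment> \<open>A continuous stand-in for the indicator of \<open>\<bar>s\<bar> > K\<close>, to
    which the one-dimensional convergence applies. The sum \<open>C\<close> over the coordinates
    controls the mass outside a cube, and its convergence transfers tightness from \<nu> to the laws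
    of \<open>Z n\<close>.\<close>
  define cut where "cut K s = min 1 (max 0 (\<bar>s\<bar> - K))" for K s :: real
  have cut: "continuous_on UNIV (cut K)" "\<And>s. \<bar>cut K s\<bar> \<le> 1" "\<And>s. 0 \<le> cut K s"
    "\<And>s. \<bar>s\<bar> > K + 1 \<Longrightarrow> cut K s = 1" for K
    by (auto simp: cut_def intro!: continuous_intros)
  have [measurable]: "cut K \<in> borel_measurable borel" for K
    using cut by (intro borel_measurable_continuous_onI)
  define C where "C K x = (\<Sum>b\<in>Basis. cut K (b \<bullet> x))" for K and x :: 'b
  have C0: "0 \<le> C K x" for K x using cut by (auto simp: C_def intro: sum_nonneg)
  have int_cut: "integrable P (\<lambda>\<omega>. cut K (b \<bullet> Z n \<omega>))" "integrable \<nu> (\<lambda>x. cut K (b \<bullet> x))" for K b n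
    using cut by (auto intro!: P.integrable_const_bound[where B=1] \<nu>.integrable_const_bound[where B=1])
  have int_C: "integrable P (\<lambda>\<omega>. C K (Z n \<omega>))" "integrable \<nu> (C K)" for K n
    using int_cut by (auto simp: C_def[abs_def])
  have conv_C: "(\<lambda>n. \<integral>\<omega>. C K (Z n \<omega>) \<partial>P) \<longlonglongrightarrow> (\<integral>x. C K x \<partial>\<nu>)" for K
    unfolding C_def using int_cut
    by (simp add: Bochner_Integration.integral_sum) (intro tendsto_sum conv1[OF cut(1,2)])
  have tight: "(\<lambda>k. \<integral>x. C (real k) x \<partial>\<nu>) \<longlonglongrightarrow> (\<integral>x. 0 \<partial>\<nu>)"
  proof (rule integral_dominated_convergence[where w="\<lambda>x. real (card (Basis::'b set))"])
    show "AE x in \<nu>. (\<lambda>k. C (real k) x) \<longlonglongrightarrow> 0"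
    proof (rule AE_I2, rule tendsto_eventually)
      fix x :: 'b
      obtain N :: nat where N: "norm x \<le> real N" using real_arch_simple by blast
      have "C (real k) x = 0" if "N \<le> k" for k
        unfolding C_def
      proof (intro sum.neutral ballI)
        fix b :: 'b assume "b \<in> Basis"
        then have "\<bar>b \<bullet> x\<bar> \<le> real k" using N that Basis_le_norm[of b x] by (simp add: inner_commute)
        then show "cut (real k) (b \<bullet> x) = 0" by (simp add: cut_def)
      qed
      then show "\<forall>\<^sub>F k in sequentially. C (real k) x = 0" by (rule eventually_sequentiallyI)
    qed
    show "AE x in \<nu>. norm (C (real k) x) \<le> real (card (Basis::'b set))" for k
    proof (rule AE_I2)
      fix x
      have "\<bar>C (real k) x\<bar> \<le> (\<Sum>b\<in>(Basis::'b set). 1)"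
        unfolding C_def using cut(2) by (intro order_trans[OF sum_abs] sum_mono) auto
      then show "norm (C (real k) x) \<le> real (card (Basis::'b set))" by simp
    qed
  qed (auto simp: C_def[abs_def])
  show "(\<lambda>n. \<integral>\<omega>. \<phi> (Z n \<omega>) \<partial>P) \<longlonglongrightarrow> (\<integral>x. \<phi> x \<partial>\<nu>)"
  proof (rule LIMSEQ_I)
    fix r :: real assume "0 < r"
    \<comment> \<open>The final estimate adds three times \<epsilon> and twice
      \<open>(2 * B + 1) * \<epsilon>\<close>: one \<epsilon> for the convergence of
      \<open>q\<close>, the rest for replacing \<phi> by \<open>q\<close> under both laws.\<close>
    define \<epsilon> where "\<epsilon> = min 1 (r / (2 * (4 + 4 * B + 2)))"
    have "0 < \<epsilon>" "\<epsilon> \<le> 1" using \<open>0 < r\<close> B(2) by (auto simp: \<epsilon>_def)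
    have "\<epsilon> \<le> r / (2 * (4 + 4 * B + 2))" by (simp add: \<epsilon>_def)
    then have "\<epsilon> * (2 * (4 + 4 * B + 2)) \<le> r" using B(2) by (subst (asm) pos_le_divide_eq) auto
    then have "\<epsilon> * (4 + 4 * B + 2) < r" using \<open>0 < r\<close> by linarith
    obtain k where k: "(\<integral>x. C (real k) x \<partial>\<nu>) < \<epsilon>"
      using order_tendstoD(2)[OF tight, of \<epsilon>] \<open>0 < \<epsilon>\<close> by (auto simp: eventually_sequentially)
    \<comment> \<open>Outside the cube of half-width \<open>k + 1\<close> at least one cut-off has
      reached the value 1.\<close>
    define R where "R = real k + 1"
    have "0 < R" by (simp add: R_def)
    define g where "g v = (\<Sum>b\<in>Basis. (R * arcsin (v \<bullet> b)) *\<^sub>R b)" for v :: 'b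
    define S where "S = cbox (- One) (One::'b)"
    \<comment> \<open>\<open>g\<close> inverts \<open>sin_coords R\<close> on the cube of half-width
      \<open>R\<close>. Pulling \<phi> back along it gives a continuous function on a compact cube,
      to which the Stone-Weierstrass theorem applies.\<close>
    have "continuous_on S (\<lambda>v. \<phi> (g v))"
    proof (rule continuous_on_compose2[of UNIV \<phi> S g])
      show "continuous_on S g"
        unfolding g_def S_def by (auto intro!: continuous_intros simp: mem_box)
    qed (use \<phi> in auto)
    then obtain p where p: "real_polynomial_function p" "\<And>v. v \<in> S \<Longrightarrow> \<bar>\<phi> (g v) - p v\<bar> < \<epsilon>"
      using Stone_Weierstrass_real_polynomial_function[of S "\<lambda>v. \<phi> (g v)" \<epsilon>] \<open>0 < \<epsilon>\<close>
      by (auto simp: S_def)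
    define q where "q x = p (sin_coords R x)" for x
    have q: "trig_poly q" unfolding q_def using p(1) by (rule trig_poly_polynomial_sin_coords)
    have near: "\<bar>\<phi> (g (sin_coords R x)) - q x\<bar> < \<epsilon>" for x
      unfolding q_def by (rule p) (simp add: S_def mem_box sin_coords_inner)
    have g_id: "g (sin_coords R x) = x" if "\<And>b. b \<in> Basis \<Longrightarrow> \<bar>x \<bullet> b\<bar> \<le> R" for x
    proof (rule euclidean_eqI)
      fix b :: 'b assume b: "b \<in> Basis"
      have "\<bar>x \<bullet> b / R\<bar> \<le> 1" using that[OF b] \<open>0 < R\<close> by (simp add: abs_divide)
      then have "arcsin (sin (x \<bullet> b / R)) = x \<bullet> b / R"
        using pi_gt3 by (intro arcsin_sin) linarith+
      then show "g (sin_coords R x) \<bullet> b = x \<bullet> b"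
        using b \<open>0 < R\<close> by (simp add: g_def sin_coords_inner)
    qed
    \<comment> \<open>Off the cube \<open>q x\<close> is still close to a value of \<phi>, namely
      the one at \<open>g (sin_coords R x)\<close>. So the error is at most
      \<open>2 * B + \<epsilon>\<close> there, while \<open>C\<close> is at least 1.\<close>
    have bound: "\<bar>\<phi> x - q x\<bar> \<le> \<epsilon> + (2 * B + 1) * C (real k) x" for x
    proof (cases "\<forall>b\<in>Basis. \<bar>x \<bullet> b\<bar> \<le> R")
      case True
      then show ?thesis using near[of x] g_id[of x] C0[of "real k" x] B(2)
        by (simp add: add_increasing2)
    next
      case False
      then obtain b where b: "b \<in> Basis" "\<bar>x \<bullet> b\<bar> > R" by (auto simp: not_le)
      have "1 = cut (real k) (b \<bullet> x)" using cut(4)[of "real k" "b \<bullet> x"] b by (simp add: R_def inner_commute)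
      also have "\<dots> \<le> C (real k) x"
        unfolding C_def using cut(3) b by (intro member_le_sum) auto
      finally have "(2 * B + 1) * 1 \<le> (2 * B + 1) * C (real k) x"
        using B(2) by (intro mult_left_mono) auto
      then have "\<epsilon> + (2 * B + 1) \<le> \<epsilon> + (2 * B + 1) * C (real k) x" by simp
      moreover have "\<bar>\<phi> x - q x\<bar> \<le> \<epsilon> + (2 * B + 1)"
        using near[of x] B(1)[of x] B(1)[of "g (sin_coords R x)"] by linarith
      ultimately show ?thesis by (rule order_trans[rotated])
    qed
    obtain D where D: "\<And>x. \<bar>q x\<bar> \<le> D" by (rule trig_poly_bounded[OF q]) blast
    have int_q: "integrable P (\<lambda>\<omega>. q (Z n \<omega>))" "integrable \<nu> q" for n
      using integrable_continuous_bounded[OF P Z trig_poly_continuous[OF q] D]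
        integrable_continuous_bounded[OF \<nu> id trig_poly_continuous[OF q] D] by simp_all
    have diff: "\<bar>(\<integral>\<omega>. \<phi> (V \<omega>) \<partial>N) - (\<integral>\<omega>. q (V \<omega>) \<partial>N)\<bar> \<le> \<epsilon> + (2 * B + 1) * (\<integral>\<omega>. C (real k) (V \<omega>) \<partial>N)"
      if "prob_space N" "integrable N (\<lambda>\<omega>. \<phi> (V \<omega>))" "integrable N (\<lambda>\<omega>. q (V \<omega>))"
        "integrable N (\<lambda>\<omega>. C (real k) (V \<omega>))" for N :: "'c measure" and V
    proof -
      interpret N: prob_space N by fact
      have "\<bar>(\<integral>\<omega>. \<phi> (V \<omega>) \<partial>N) - (\<integral>\<omega>. q (V \<omega>) \<partial>N)\<bar> = \<bar>\<integral>\<omega>. \<phi> (V \<omega>) - q (V \<omega>) \<partial>N\<bar>"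
        using that by simp
      also have "\<dots> \<le> (\<integral>\<omega>. \<bar>\<phi> (V \<omega>) - q (V \<omega>)\<bar> \<partial>N)" by (rule integral_abs_bound)
      also have "\<dots> \<le> (\<integral>\<omega>. \<epsilon> + (2 * B + 1) * C (real k) (V \<omega>) \<partial>N)"
        using that bound by (intro integral_mono) auto
      also have "\<dots> = \<epsilon> + (2 * B + 1) * (\<integral>\<omega>. C (real k) (V \<omega>) \<partial>N)"
        using that by (simp add: N.prob_space)
      finally show ?thesis .
    qed
    have "\<forall>\<^sub>F n in sequentially. \<bar>(\<integral>\<omega>. q (Z n \<omega>) \<partial>P) - (\<integral>x. q x \<partial>\<nu>)\<bar> < \<epsilon>"
      using tendstoD[OF conv_trig[OF q] \<open>0 < \<epsilon>\<close>] by (simp add: dist_real_def)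
    moreover have "\<forall>\<^sub>F n in sequentially. (\<integral>\<omega>. C (real k) (Z n \<omega>) \<partial>P) < \<epsilon>"
      using order_tendstoD(2)[OF conv_C k] .
    ultimately have "\<forall>\<^sub>F n in sequentially. norm ((\<integral>\<omega>. \<phi> (Z n \<omega>) \<partial>P) - (\<integral>x. \<phi> x \<partial>\<nu>)) < r"
    proof eventually_elim
      case (elim n)
      have "(2 * B + 1) * (\<integral>\<omega>. C (real k) (Z n \<omega>) \<partial>P) \<le> (2 * B + 1) * \<epsilon>"
        "(2 * B + 1) * (\<integral>x. C (real k) x \<partial>\<nu>) \<le> (2 * B + 1) * \<epsilon>"
        using elim k B(2) by (auto intro!: mult_left_mono)
      then have "\<bar>(\<integral>\<omega>. \<phi> (Z n \<omega>) \<partial>P) - (\<integral>x. \<phi> x \<partial>\<nu>)\<bar> < 3 * \<epsilon> + 2 * ((2 * B + 1) * \<epsilon>)"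
        using elim diff[OF P int_\<phi>(1) int_q(1) int_C(1), of n] diff[OF \<nu> int_\<phi>(2) int_q(2) int_C(2)]
        by linarith
      also have "\<dots> \<le> \<epsilon> * (4 + 4 * B + 2)" using \<open>0 < \<epsilon>\<close> by (simp add: algebra_simps)
      also have "\<dots> < r" by fact
      finally show ?case by simp
    qed
    then show "\<exists>no. \<forall>n\<ge>no. norm ((\<integral>\<omega>. \<phi> (Z n \<omega>) \<partial>P) - (\<integral>x. \<phi> x \<partial>\<nu>)) < r"
      by (simp add: eventually_sequentially)
  qed
qed

section \<open>Normal vectors and characteristic functions\<close>

text \<open>Testing positivity along lines in a coordinate direction supplies every inequality of
  the decomposition below. Symmetry of \<open>Q\<close> is not assumed here, hence the two separate
  linear terms.\<close>

lemma quadratic_form_shift: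
  fixes Q :: "'m::finite \<Rightarrow> 'm \<Rightarrow> real"
  shows "(\<Sum>k\<in>UNIV. \<Sum>l\<in>UNIV. (x k + t * (if k = j then 1 else 0)) * (x l + t * (if l = j then 1 else 0)) * Q k l) =
    (\<Sum>k\<in>UNIV. \<Sum>l\<in>UNIV. x k * x l * Q k l) + t * (\<Sum>l\<in>UNIV. x l * Q j l)
      + t * (\<Sum>k\<in>UNIV. x k * Q k j) + t\<^sup>2 * Q j j"
proof -
  have "(\<Sum>k\<in>UNIV. \<Sum>l\<in>UNIV. (x k + t * (if k = j then 1 else 0)) * (x l + t * (if l = j then 1 else 0)) * Q k l) =
    (\<Sum>k\<in>UNIV. \<Sum>l\<in>UNIV. x k * x l * Q k l + (if k = j then t * (x l * Q k l) else 0)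
       + (if l = j then t * (x k * Q k l) else 0) + (if l = j then if k = j then t\<^sup>2 * Q k l else 0 else 0))"
    by (intro sum.cong refl) (auto simp: algebra_simps power2_eq_square)
  also have "\<dots> = (\<Sum>k\<in>UNIV. \<Sum>l\<in>UNIV. x k * x l * Q k l)
      + (\<Sum>l\<in>UNIV. \<Sum>k\<in>UNIV. if k = j then t * (x l * Q k l) else 0)
      + (\<Sum>k\<in>UNIV. t * (x k * Q k j)) + t\<^sup>2 * Q j j"
    by (subst (2) sum.swap) (simp add: sum.distrib)
  finally show ?thesis by (simp add: sum_distrib_left)
qed

text \<open>Cholesky's decomposition: eliminating the index \<open>j\<close> replaces \<open>Q\<close> by its Schur complement.\<close>

lemma psd_eq_sum_squares_on:
  fixes Q :: "'m::finite \<Rightarrow> 'm \<Rightarrow> real"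
  assumes "finite J" and "\<And>k l. Q k l = Q l k"
    and "\<And>x. 0 \<le> (\<Sum>k\<in>UNIV. \<Sum>l\<in>UNIV. x k * x l * Q k l)"
    and "\<And>k l. k \<notin> J \<Longrightarrow> Q k l = 0"
  shows "\<exists>a. \<forall>k l. Q k l = (\<Sum>j\<in>J. a j k * a j l)"
  using assms
proof (induction J arbitrary: Q rule: finite_induct)
  case empty
  then show ?case by simp
next
  case (insert j J)
  note sym = insert.prems(1) and psd = insert.prems(2) and supp = insert.prems(3)
  have Qjj: "0 \<le> Q j j"
    using psd[of "\<lambda>k. 0 + 1 * (if k = j then 1 else 0)"] unfolding quadratic_form_shift by simp
  have fun_upd: "(\<Sum>i\<in>insert j J. (a(j := v)) i k * (a(j := v)) i l) = v k * v l + (\<Sum>i\<in>J. a i k * a i l)"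
    for a and v :: "'m \<Rightarrow> real" and k l
    using insert.hyps by (auto intro!: sum.cong)
  show ?case
  proof (cases "Q j j = 0")
    case True
    have Qj: "Q j k = 0" for k
    proof (rule ccontr)
      assume "Q j k \<noteq> 0"
      \<comment> \<open>With \<open>Q j j = 0\<close> the form is affine in \<open>t\<close> along
        this line. A nonzero slope would give it the value -1 at the \<open>t\<close> chosen
        below.\<close>
      have "0 \<le> Q k k + t * Q j k + t * Q k j" for t
        using psd[of "\<lambda>i. (0 + 1 * (if i = k then 1 else 0)) + t * (if i = j then 1 else 0)"]
        unfolding quadratic_form_shift using True by (simp add: if_distrib[of "\<lambda>x. x * _"] cong: if_cong)
      from this[of "- (Q k k + 1) / (2 * Q j k)"] show False
        using \<open>Q j k \<noteq> 0\<close> sym[of k j] by (simp add: field_simps)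
    qed
    have "Q k l = 0" if "k \<notin> J" for k l
      using supp[of k l] Qj[of l] that by auto
    then obtain a where "\<And>k l. Q k l = (\<Sum>i\<in>J. a i k * a i l)"
      using insert.IH[of Q] sym psd by metis
    then show ?thesis using fun_upd[of a "\<lambda>_. 0"] by (intro exI[of _ "a(j := \<lambda>_. 0)"]) simp
  next
    case False
    define Q' where "Q' k l = Q k l - Q k j * Q l j / Q j j" for k l
    have "Q' k l = Q' l k" for k l using sym by (simp add: Q'_def)
    moreover have "Q' k l = 0" if "k \<notin> J" for k l
      using supp[of k l] supp[of k j] that False sym[of j l] by (cases "k = j") (auto simp: Q'_def)
    moreover have "0 \<le> (\<Sum>k\<in>UNIV. \<Sum>l\<in>UNIV. x k * x l * Q' k l)" for x
    proof -
      define c where "c = (\<Sum>k\<in>UNIV. x k * Q k j)"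
      have c': "(\<Sum>k\<in>UNIV. x k * Q j k) = c" unfolding c_def using sym by simp
      \<comment> \<open>The shift \<open>- c / Q j j\<close> minimises the form in the direction
        \<open>j\<close>; the minimum is the form of the Schur complement.\<close>
      have "0 \<le> (\<Sum>k\<in>UNIV. \<Sum>l\<in>UNIV. x k * x l * Q k l) + (- c / Q j j) * c + (- c / Q j j) * c + (- c / Q j j)\<^sup>2 * Q j j"
        using psd[of "\<lambda>k. x k + (- c / Q j j) * (if k = j then 1 else 0)"]
        unfolding quadratic_form_shift c' c_def[symmetric] .
      also have "\<dots> = (\<Sum>k\<in>UNIV. \<Sum>l\<in>UNIV. x k * x l * Q k l) - c * c / Q j j"
        using False by (simp add: power2_eq_square field_simps)
      also have "c * c / Q j j = (\<Sum>k\<in>UNIV. \<Sum>l\<in>UNIV. x k * x l * (Q k j * Q l j / Q j j))"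
        unfolding c_def sum_product sum_divide_distrib by (intro sum.cong refl) simp
      finally show ?thesis by (simp add: Q'_def algebra_simps sum_subtractf)
    qed
    ultimately obtain a where a: "\<And>k l. Q' k l = (\<Sum>i\<in>J. a i k * a i l)"
      using insert.IH[of Q'] by metis
    have "Q k l = (\<Sum>i\<in>insert j J. (a(j := \<lambda>k. Q k j / sqrt (Q j j))) i k * (a(j := \<lambda>k. Q k j / sqrt (Q j j))) i l)"
      for k l
      unfolding fun_upd a[symmetric] using Qjj by (simp add: Q'_def)
    then show ?thesis by blast
  qed
qed

text \<open>Written as a sum of squares of linear functionals, the form is the variance of a linear
  functional of independent standard normal variables. Singular matrices are covered.\<close>

lemma psd_matrix_eq_sum_squares:
  fixes \<Sigma> :: "real^'m^'m"
  assumes sym: "transpose \<Sigma> = \<Sigma>" and psd: "\<And>x. 0 \<le> x \<bullet> (\<Sigma> *v x)"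
  obtains a :: "'m \<Rightarrow> real^'m" where "\<And>x. x \<bullet> (\<Sigma> *v x) = (\<Sum>j\<in>UNIV. (x \<bullet> a j)\<^sup>2)"
proof -
  have quad: "x \<bullet> (\<Sigma> *v x) = (\<Sum>k\<in>UNIV. \<Sum>l\<in>UNIV. x $ k * x $ l * \<Sigma> $ k $ l)" for x
    by (simp add: inner_vec_def matrix_vector_mult_def sum_distrib_left mult_ac)
  have "\<exists>a. \<forall>k l. \<Sigma> $ k $ l = (\<Sum>j\<in>(UNIV::'m set). a j k * a j l)"
  proof (rule psd_eq_sum_squares_on[where Q="\<lambda>k l. \<Sigma> $ k $ l"])
    show "\<Sigma> $ k $ l = \<Sigma> $ l $ k" for k l
      using sym by (metis transpose_def vec_lambda_beta)
    show "0 \<le> (\<Sum>k\<in>UNIV. \<Sum>l\<in>UNIV. x k * x l * \<Sigma> $ k $ l)" for x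
      using psd[of "\<chi> k. x k"] unfolding quad by simp
  qed auto
  then obtain a where a: "\<And>k l. \<Sigma> $ k $ l = (\<Sum>j\<in>(UNIV::'m set). a j k * a j l)" by blast
  have "x \<bullet> (\<Sigma> *v x) = (\<Sum>j\<in>UNIV. (x \<bullet> (\<chi> k. a j k))\<^sup>2)" for x
  proof -
    have "x \<bullet> (\<Sigma> *v x) = (\<Sum>k\<in>UNIV. \<Sum>l\<in>UNIV. \<Sum>j\<in>UNIV. (x $ k * a j k) * (x $ l * a j l))"
      unfolding quad a by (simp add: sum_distrib_left mult_ac)
    also have "\<dots> = (\<Sum>k\<in>UNIV. \<Sum>j\<in>UNIV. \<Sum>l\<in>UNIV. (x $ k * a j k) * (x $ l * a j l))"
      by (intro sum.cong refl sum.swap)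
    also have "\<dots> = (\<Sum>j\<in>UNIV. \<Sum>k\<in>UNIV. \<Sum>l\<in>UNIV. (x $ k * a j k) * (x $ l * a j l))"
      by (rule sum.swap)
    finally show ?thesis by (simp add: inner_vec_def power2_eq_square sum_product)
  qed
  then show ?thesis by (rule that)
qed

lemma (in prob_space) char_distr_mult:
  assumes [measurable]: "X \<in> borel_measurable M"
  shows "char (distr M borel (\<lambda>\<omega>. c * X \<omega>)) t = char (distr M borel X) (t * c)"
  by (simp add: char_def integral_distr mult.assoc)

lemma char_scaled_std_normal:
  "char (distr std_normal_distribution borel (\<lambda>s. \<sigma> * s)) t = complex_of_real (exp (- (t\<^sup>2 * \<sigma>\<^sup>2) / 2))"
proof -
  interpret prob_space std_normal_distribution by (intro prob_space_normal_density) simp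
  have "distr std_normal_distribution borel (\<lambda>s. s) = std_normal_distribution"
    by (rule distr_id2) simp
  then show ?thesis
    using char_distr_mult[of "\<lambda>s. s" \<sigma> t] by (simp add: char_std_normal_distribution power_mult_distrib)
qed

text \<open>Scale 0 gives a point mass; by symmetry a negative scale acts as its absolute
  value.\<close>

lemma normal_law_scaled_std_normal: "normal_law (distr std_normal_distribution borel (\<lambda>s. \<sigma> * s))"
proof (cases "\<sigma> = 0")
  case True
  interpret prob_space std_normal_distribution by (intro prob_space_normal_density) simp
  have "distr std_normal_distribution borel (\<lambda>s. \<sigma> * s) = return borel 0"
    using True distr_const[of 0 borel] by simp
  then show ?thesis unfolding normal_law_def by blast
next
  case False
  interpret prob_space std_normal_distribution by (intro prob_space_normal_density) simp
  have "distributed std_normal_distribution lborel (\<lambda>x. x) std_normal_density"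
    by (auto simp: distributed_def intro!: distr_id2)
  from normal_density_affine[OF this _ False, of 0]
  have "distr std_normal_distribution lborel (\<lambda>x. \<sigma> * x) = density lborel (normal_density 0 \<bar>\<sigma>\<bar>)"
    by (simp add: distributed_def)
  moreover have "distr std_normal_distribution lborel (\<lambda>x. \<sigma> * x) = distr std_normal_distribution borel (\<lambda>x. \<sigma> * x)"
    by (rule distr_cong) auto
  ultimately have "distr std_normal_distribution borel (\<lambda>s. \<sigma> * s) = density lborel (normal_density 0 \<bar>\<sigma>\<bar>)"
    by simp
  moreover have "0 < \<bar>\<sigma>\<bar>" using False by simp
  ultimately show ?thesis unfolding normal_law_def by blast
qed

text \<open>The random vector is the combination of the vectors \<open>c j\<close> of the
  sum-of-squares representation with independent standard normal coefficients. The laws of its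
  projections are kept as a second conclusion, since Cramer-Wold compares exactly these.\<close>

lemma multivariate_normal_exists:
  fixes \<Sigma> :: "real^'m^'m"
  assumes sym: "transpose \<Sigma> = \<Sigma>" and psd: "\<And>x. 0 \<le> x \<bullet> (\<Sigma> *v x)"
  obtains \<nu> where "multivariate_normal 0 \<Sigma> \<nu>"
    "\<And>a. distr \<nu> borel (\<lambda>x. a \<bullet> x) = distr std_normal_distribution borel (\<lambda>s. sqrt (a \<bullet> (\<Sigma> *v a)) * s)"
proof -
  obtain c :: "'m \<Rightarrow> real^'m" where c: "\<And>x. x \<bullet> (\<Sigma> *v x) = (\<Sum>j\<in>UNIV. (x \<bullet> c j)\<^sup>2)"
    by (rule psd_matrix_eq_sum_squares[OF assms]) blast
  have std: "prob_space std_normal_distribution" by (intro prob_space_normal_density) simp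
  interpret product_prob_space "\<lambda>_::'m. std_normal_distribution" UNIV
    using std by (simp add: product_prob_space_def product_prob_space_axioms_def product_sigma_finite_def
       prob_space_imp_sigma_finite)
  define N where "N = (\<Pi>\<^sub>M j\<in>(UNIV::'m set). std_normal_distribution)"
  interpret N: prob_space N unfolding N_def by (rule prob_space_PiM) (rule std)
  have comp[measurable]: "(\<lambda>x. x j) \<in> borel_measurable N" for j
    using measurable_component_singleton[of j UNIV "\<lambda>_. std_normal_distribution"] by (simp add: N_def)
  have distr_comp: "distr N borel (\<lambda>x. x j) = std_normal_distribution" for j
  proof -
    have "distr N borel (\<lambda>x. x j) = distr N std_normal_distribution (\<lambda>x. x j)"
      by (rule distr_cong) auto
    then show ?thesis unfolding N_def by (simp add: PiM_component)
  qed
  \<comment> \<open>The joint law of the coordinates is the product measure itself.\<close>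
  have indep: "N.indep_vars (\<lambda>_. borel) (\<lambda>j x. x j) UNIV"
  proof (subst N.indep_vars_iff_distr_eq_PiM)
    show "distr N (\<Pi>\<^sub>M j\<in>UNIV. borel) (\<lambda>x. \<lambda>j\<in>UNIV. x j) = (\<Pi>\<^sub>M j\<in>UNIV. distr N borel (\<lambda>x. x j))"
    proof -
      have "distr N (\<Pi>\<^sub>M j\<in>UNIV. borel) (\<lambda>x. \<lambda>j\<in>UNIV. x j) = distr N N (\<lambda>x. x)"
        by (rule distr_cong) (auto simp: N_def intro!: sets_PiM_cong)
      then show ?thesis unfolding distr_comp by (simp add: N_def)
    qed
  qed auto
  define G where "G x = (\<Sum>j\<in>UNIV. x j *\<^sub>R c j)" for x
  have G[measurable]: "G \<in> borel_measurable N" unfolding G_def[abs_def] by measurable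
  define \<nu> where "\<nu> = distr N borel G"
  interpret \<nu>: prob_space \<nu> unfolding \<nu>_def by (rule N.prob_space_distr) (rule G)
  have marginal: "distr \<nu> borel (\<lambda>x. a \<bullet> x) = distr std_normal_distribution borel (\<lambda>s. sqrt (a \<bullet> (\<Sigma> *v a)) * s)"
    (is "?L = ?R") for a
  proof (rule Levy_uniqueness)
    show "real_distribution ?L" unfolding \<nu>_def by (intro prob_space.real_distribution_distr N.prob_space_distr) simp_all
    show "real_distribution ?R" by (intro prob_space.real_distribution_distr std) simp
    show "char ?L = char ?R"
    proof
      fix t
      have "?L = distr N borel (\<lambda>x. \<Sum>j\<in>UNIV. (a \<bullet> c j) * x j)"
        by (simp add: \<nu>_def distr_distr comp_def G_def inner_sum_right mult.commute)
      then have "char ?L t = (\<Prod>j\<in>UNIV. char (distr N borel (\<lambda>x. (a \<bullet> c j) * x j)) t)"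
        using N.char_distr_sum[OF N.indep_vars_compose2[OF indep, of "\<lambda>j s. (a \<bullet> c j) * s" "\<lambda>_. borel"], of t]
        by simp
      also have "\<dots> = (\<Prod>j\<in>UNIV. complex_of_real (exp (- (t\<^sup>2 * (a \<bullet> c j)\<^sup>2) / 2)))"
        by (simp add: N.char_distr_mult distr_comp char_std_normal_distribution power_mult_distrib)
      also have "\<dots> = complex_of_real (exp (\<Sum>j\<in>UNIV. - (t\<^sup>2 * (a \<bullet> c j)\<^sup>2) / 2))"
        by (simp only: of_real_prod exp_sum finite)
      also have "(\<Sum>j\<in>UNIV. - (t\<^sup>2 * (a \<bullet> c j)\<^sup>2) / 2) = - (t\<^sup>2 * (a \<bullet> (\<Sigma> *v a))) / 2"
        by (simp add: c sum_negf sum_divide_distrib[symmetric] sum_distrib_left)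
      finally show "char ?L t = char ?R t"
        using psd[of a] by (simp add: char_scaled_std_normal)
    qed
  qed
  have sets[measurable_cong]: "sets \<nu> = sets borel" by (simp add: \<nu>_def)
  have mom: "integrable \<nu> (\<lambda>x. (a \<bullet> x)^p)"
      "(\<integral>x. (a \<bullet> x)^p \<partial>\<nu>) = (sqrt (a \<bullet> (\<Sigma> *v a)))^p * (LINT s|std_normal_distribution. s^p)" for a p
  proof -
    have "integrable (distr \<nu> borel (\<lambda>x. a \<bullet> x)) (\<lambda>s. s^p)"
      unfolding marginal by (subst integrable_distr_eq)
        (auto simp: power_mult_distrib intro!: integrable_mult_right integrable_std_normal_distribution_moment)
    then show "integrable \<nu> (\<lambda>x. (a \<bullet> x)^p)" by (simp add: integrable_distr_eq)
    have "(\<integral>x. (a \<bullet> x)^p \<partial>\<nu>) = (LINT s|distr \<nu> borel (\<lambda>x. a \<bullet> x). s^p)"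
      by (simp add: integral_distr)
    also have "\<dots> = (sqrt (a \<bullet> (\<Sigma> *v a)))^p * (LINT s|std_normal_distribution. s^p)"
      unfolding marginal by (simp add: integral_distr power_mult_distrib)
    finally show "(\<integral>x. (a \<bullet> x)^p \<partial>\<nu>) = (sqrt (a \<bullet> (\<Sigma> *v a)))^p * (LINT s|std_normal_distribution. s^p)" .
  qed
  have mom2: "(\<integral>x. (a \<bullet> x)\<^sup>2 \<partial>\<nu>) = a \<bullet> (\<Sigma> *v a)" for a
    using mom(2)[of a 2] psd[of a] std_normal_distribution_even_moments(1)[of 1] by (simp add: fact_numeral)
  have coord: "x $ k = axis k 1 \<bullet> x" for x :: "real^'m" and k by (simp add: inner_axis')
  have "(\<integral>x. x $ k * x $ l \<partial>\<nu>) = \<Sigma> $ k $ l" for k l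
  proof -
    \<comment> \<open>Polarization: mixed moments follow from the second moments of three
      projections.\<close>
    have eq: "x $ k * x $ l = (((axis k 1 + axis l 1) \<bullet> x)\<^sup>2 - (axis k 1 \<bullet> x)\<^sup>2 - (axis l 1 \<bullet> x)\<^sup>2) / 2"
      for x :: "real^'m"
      by (simp add: inner_axis' inner_add_left power2_eq_square field_simps)
    have sum: "axis k 1 \<bullet> (\<Sigma> *v axis l 1) = \<Sigma> $ k $ l" for k l
      by (simp add: inner_axis' matrix_vector_mul_component inner_axis)
    have "\<Sigma> $ l $ k = \<Sigma> $ k $ l" using sym by (metis transpose_def vec_lambda_beta)
    moreover have "(\<integral>x. x $ k * x $ l \<partial>\<nu>) = ((axis k 1 + axis l 1) \<bullet> (\<Sigma> *v (axis k 1 + axis l 1))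
        - axis k 1 \<bullet> (\<Sigma> *v axis k 1) - axis l 1 \<bullet> (\<Sigma> *v axis l 1)) / 2"
      unfolding eq using mom(1)[of _ 2] by (simp add: mom2)
    ultimately show ?thesis
      by (simp add: matrix_vector_right_distrib inner_add_left inner_add_right sum)
  qed
  moreover have "(\<integral>x. x $ k \<partial>\<nu>) = 0" for k
    using mom(2)[of "axis k 1" 1] integral_std_normal_distribution_moment_odd[of 1] by (simp add: coord)
  ultimately have "multivariate_normal 0 \<Sigma> \<nu>"
    unfolding multivariate_normal_def marginal
    by (simp add: \<nu>.prob_space_axioms sets normal_law_scaled_std_normal)
  then show ?thesis using marginal by (rule that)
qed

text \<open>The formulation by characteristic functions fits two independent samples, for which they
  multiply. For \<open>v = 0\<close> the summands vanish almost surely and the limit is the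
  transform of a point mass, so one formula covers both cases.\<close>

lemma (in prob_space) char_clt:
  fixes X :: "nat \<Rightarrow> 'a \<Rightarrow> real"
  assumes indep: "indep_vars (\<lambda>_. borel) X UNIV"
    and ident: "\<And>i. distr M borel (X i) = distr M borel (X 0)"
    and sq: "\<And>i. integrable M (\<lambda>\<omega>. (X i \<omega>)\<^sup>2)"
    and mean: "\<And>i. expectation (X i) = 0"
    and var: "\<And>i. expectation (\<lambda>\<omega>. (X i \<omega>)\<^sup>2) = v"
  shows "(\<lambda>n. char (distr M borel (\<lambda>\<omega>. (\<Sum>i<n. X i \<omega>) / sqrt (real n))) t)
    \<longlonglongrightarrow> complex_of_real (exp (- (t\<^sup>2 * v) / 2))"
proof -
  have rv[measurable]: "X i \<in> borel_measurable M" for i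
    using indep by (auto simp: indep_vars_def2)
  have "0 \<le> v" using var[of 0] by (metis integral_nonneg_AE AE_I2 zero_le_power2)
  show ?thesis
  proof (cases "v = 0")
    case True
    have "AE \<omega> in M. (X i \<omega>)\<^sup>2 = 0" for i
      using integral_nonneg_eq_0_iff_AE[OF sq[of i]] var[of i] True by simp
    then have "AE \<omega> in M. \<forall>i. X i \<omega> = 0" by (simp add: AE_all_countable)
    then have AE: "AE \<omega> in M. (\<Sum>i<n. X i \<omega>) / sqrt (real n) = 0" for n
      by eventually_elim simp
    have "char (distr M borel (\<lambda>\<omega>. (\<Sum>i<n. X i \<omega>) / sqrt (real n))) t = (\<integral>\<omega>. iexp (t * ((\<Sum>i<n. X i \<omega>) / sqrt (real n))) \<partial>M)" for n
      unfolding char_def by (subst integral_distr) auto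
    also have "\<dots> n = (\<integral>\<omega>. 1 \<partial>M)" for n
      using AE[of n]
      by (intro integral_cong_AE, simp, simp, eventually_elim) (simp only: of_real_0 mult_zero_right exp_zero)
    finally show ?thesis using True by (simp add: prob_space)
  next
    case False
    define \<sigma> where "\<sigma> = sqrt v"
    have \<sigma>: "0 < \<sigma>" "\<sigma>\<^sup>2 = v" using False \<open>0 \<le> v\<close> by (auto simp: \<sigma>_def)
    have "weak_conv_m (\<lambda>n. distr M borel (\<lambda>\<omega>. (\<Sum>i<n. X i \<omega>) / sqrt (n * \<sigma>\<^sup>2))) std_normal_distribution"
      using central_limit_theorem_zero_mean[OF indep mean \<sigma>(1) sq _ ident] mean var \<sigma> by simp
    then have "(\<lambda>n. char (distr M borel (\<lambda>\<omega>. (\<Sum>i<n. X i \<omega>) / sqrt (n * \<sigma>\<^sup>2))) (t * \<sigma>))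
       \<longlonglongrightarrow> char std_normal_distribution (t * \<sigma>)"
      by (intro levy_continuity1 real_dist_normal_dist real_distribution_distr) measurable
    moreover have "char (distr M borel (\<lambda>\<omega>. (\<Sum>i<n. X i \<omega>) / sqrt (n * \<sigma>\<^sup>2))) (t * \<sigma>) =
      char (distr M borel (\<lambda>\<omega>. (\<Sum>i<n. X i \<omega>) / sqrt (real n))) t" for n
      using char_distr_mult[of "\<lambda>\<omega>. (\<Sum>i<n. X i \<omega>) / sqrt (real n)" "1 / \<sigma>" "t * \<sigma>"] \<sigma>(1)
      by (simp add: real_sqrt_mult field_simps)
    ultimately show ?thesis
      using \<sigma> by (simp add: char_std_normal_distribution power_mult_distrib)
  qed
qed

lemma cmod_iexp_diff_le: "cmod (iexp x - iexp y) \<le> \<bar>x - y\<bar>"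
proof -
  have "iexp x - iexp y = iexp y * (iexp (x - y) - 1)"
    by (simp add: algebra_simps exp_diff)
  moreover have "cmod (iexp (x - y) - 1) \<le> \<bar>x - y\<bar>"
    using iexp_approx1[of "x - y" 0] by simp
  ultimately show ?thesis by (simp add: norm_mult)
qed

text \<open>Where the variables differ by more than \<epsilon> the exponentials differ by at most 2;
  elsewhere they differ by at most \<epsilon> times the absolute value of \<open>t\<close>, since
  the exponential is 1-Lipschitz in its phase.\<close>

lemma (in prob_space) char_slutsky:
  fixes X Y :: "nat \<Rightarrow> 'a \<Rightarrow> real"
  assumes [measurable]: "\<And>n. X n \<in> borel_measurable M" "\<And>n. Y n \<in> borel_measurable M"
    and close: "\<And>\<epsilon>. 0 < \<epsilon> \<Longrightarrow> (\<lambda>n. prob {\<omega>\<in>space M. \<bar>X n \<omega> - Y n \<omega>\<bar> > \<epsilon>}) \<longlonglongrightarrow> 0"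
    and lim: "(\<lambda>n. char (distr M borel (Y n)) t) \<longlonglongrightarrow> L"
  shows "(\<lambda>n. char (distr M borel (X n)) t) \<longlonglongrightarrow> L"
proof -
  have bound: "cmod (char (distr M borel (X n)) t - char (distr M borel (Y n)) t) \<le>
     \<bar>t\<bar> * \<epsilon> + 2 * prob {\<omega>\<in>space M. \<bar>X n \<omega> - Y n \<omega>\<bar> > \<epsilon>}" if "0 < \<epsilon>" for n \<epsilon>
  proof -
    let ?A = "{\<omega>\<in>space M. \<bar>X n \<omega> - Y n \<omega>\<bar> > \<epsilon>}"
    have int: "integrable M (\<lambda>\<omega>. iexp (t * X n \<omega>))" "integrable M (\<lambda>\<omega>. iexp (t * Y n \<omega>))"
      by (auto intro!: integrable_const_bound[where B=1])
    have intA: "integrable M (\<lambda>\<omega>. indicator ?A \<omega> :: real)"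
      by (intro integrable_real_indicator) (auto simp: emeasure_eq_measure)
    have "char (distr M borel (X n)) t - char (distr M borel (Y n)) t =
      (\<integral>\<omega>. iexp (t * X n \<omega>) - iexp (t * Y n \<omega>) \<partial>M)"
      using int by (simp add: char_def integral_distr)
    also have "cmod \<dots> \<le> (\<integral>\<omega>. cmod (iexp (t * X n \<omega>) - iexp (t * Y n \<omega>)) \<partial>M)"
      by (rule integral_norm_bound)
    also have "\<dots> \<le> (\<integral>\<omega>. \<bar>t\<bar> * \<epsilon> + 2 * indicator ?A \<omega> \<partial>M)"
    proof (rule integral_mono)
      fix \<omega> assume "\<omega> \<in> space M"
      have 1: "cmod (iexp (t * X n \<omega>) - iexp (t * Y n \<omega>)) \<le> \<bar>t\<bar> * \<bar>X n \<omega> - Y n \<omega>\<bar>"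
        using cmod_iexp_diff_le[of "t * X n \<omega>" "t * Y n \<omega>"] by (simp add: abs_mult right_diff_distrib[symmetric])
      have 2: "cmod (iexp (t * X n \<omega>) - iexp (t * Y n \<omega>)) \<le> 2"
        using norm_triangle_ineq4[of "iexp (t * X n \<omega>)" "iexp (t * Y n \<omega>)"] by simp
      show "cmod (iexp (t * X n \<omega>) - iexp (t * Y n \<omega>)) \<le> \<bar>t\<bar> * \<epsilon> + 2 * indicator ?A \<omega>"
      proof (cases "\<omega> \<in> ?A")
        case True
        then show ?thesis using 2 that by (simp add: add_increasing)
      next
        case False
        then have "\<bar>t\<bar> * \<bar>X n \<omega> - Y n \<omega>\<bar> \<le> \<bar>t\<bar> * \<epsilon>"
          using \<open>\<omega> \<in> space M\<close> by (intro mult_left_mono) auto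
        then show ?thesis using 1 False by simp
      qed
    qed (use int intA in auto)
    also have "\<dots> = \<bar>t\<bar> * \<epsilon> + 2 * prob ?A"
      using intA by (subst Bochner_Integration.integral_add) (auto simp: prob_space)
    finally show ?thesis .
  qed
  have "(\<lambda>n. char (distr M borel (X n)) t - char (distr M borel (Y n)) t) \<longlonglongrightarrow> 0"
  proof (rule LIMSEQ_I)
    fix r :: real assume "0 < r"
    define \<epsilon> where "\<epsilon> = r / (2 * (\<bar>t\<bar> + 1))"
    have \<epsilon>: "0 < \<epsilon>" using \<open>0 < r\<close> by (simp add: \<epsilon>_def)
    have "\<bar>t\<bar> * \<epsilon> \<le> (\<bar>t\<bar> + 1) * \<epsilon>" using \<epsilon> by (intro mult_right_mono) auto
    also have "\<dots> = r / 2" unfolding \<epsilon>_def using abs_ge_zero[of t] by (simp add: field_simps)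
    finally have t: "\<bar>t\<bar> * \<epsilon> \<le> r / 2" .
    have "\<forall>\<^sub>F n in sequentially. prob {\<omega>\<in>space M. \<bar>X n \<omega> - Y n \<omega>\<bar> > \<epsilon>} < r / 4"
      by (rule order_tendstoD(2)[OF close[OF \<epsilon>]]) (use \<open>0 < r\<close> in simp)
    then obtain N where "\<And>n. N \<le> n \<Longrightarrow> prob {\<omega>\<in>space M. \<bar>X n \<omega> - Y n \<omega>\<bar> > \<epsilon>} < r / 4"
      unfolding eventually_sequentially by blast
    then have "norm (char (distr M borel (X n)) t - char (distr M borel (Y n)) t - 0) < r" if "N \<le> n" for n
      using that bound[OF \<epsilon>, of n] t by fastforce
    then show "\<exists>N. \<forall>n\<ge>N. norm (char (distr M borel (X n)) t - char (distr M borel (Y n)) t - 0) < r"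
      by blast
  qed
  from tendsto_add[OF this lim] show ?thesis by simp
qed

section \<open>Campbell's formulas\<close>

lemma space_config: "space (config S) = {Z. set_mset Z \<subseteq> S}"
  by (simp add: config_def space_measure_of_conv)

lemma measurable_count_in:
  assumes "B \<in> sets borel"
  shows "(\<lambda>Z. size (filter_mset (\<lambda>x. x \<in> B) Z)) \<in> measurable (config S) (count_space UNIV)"
  unfolding measurable_count_space_eq2_countable
proof (intro conjI ballI)
  fix k
  have "{Z. set_mset Z \<subseteq> S \<and> size (filter_mset (\<lambda>x. x \<in> B) Z) = k} \<in> sets (config S)"
    unfolding config_def using assms by (intro in_measure_of) auto
  also have "{Z. set_mset Z \<subseteq> S \<and> size (filter_mset (\<lambda>x. x \<in> B) Z) = k} =
    (\<lambda>Z. size (filter_mset (\<lambda>x. x \<in> B) Z)) -` {k} \<inter> space (config S)"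
    by (auto simp: space_config)
  finally show "(\<lambda>Z. size (filter_mset (\<lambda>x. x \<in> B) Z)) -` {k} \<inter> space (config S) \<in> sets (config S)" .
qed auto

lemma sum_mset_indicator:
  "(\<Sum>x\<in>#Z. indicator B x :: ennreal) = of_nat (size (filter_mset (\<lambda>x. x \<in> B) Z))"
  by (induction Z) (auto simp: add.commute)

lemma sum_mset_SUP:
  fixes U :: "nat \<Rightarrow> 'a \<Rightarrow> ennreal"
  assumes "incseq U"
  shows "(\<Sum>x\<in>#Z. (SUP i. U i) x) = (SUP i. \<Sum>x\<in>#Z. U i x)"
proof (induction Z)
  case (add x Z)
  have "incseq (\<lambda>i. U i x)" using assms by (auto simp: incseq_def le_fun_def)
  moreover have "incseq (\<lambda>i. \<Sum>x\<in>#Z. U i x)"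
    using assms by (auto simp: incseq_def le_fun_def intro!: sum_mset_mono)
  ultimately show ?case using add by (simp add: ennreal_SUP_add image_comp)
qed simp

lemma sum_mset_nonneg: "(\<And>x. 0 \<le> q x) \<Longrightarrow> 0 \<le> (\<Sum>x\<in>#Z. q x :: real)"
  by (induction Z) auto

lemma sum_mset_ennreal:
  "(\<And>x. 0 \<le> q x) \<Longrightarrow> (\<Sum>x\<in>#Z. ennreal (q x)) = ennreal (\<Sum>x\<in>#Z. q x)"
proof (induction Z)
  case (add x Z)
  moreover have "0 \<le> (\<Sum>x\<in>#Z. q x)" using add.prems by (intro sum_mset_nonneg) auto
  ultimately show ?case by (simp add: ennreal_plus)
qed simp

lemma sum_mset_diff: "(\<Sum>x\<in>#Z. f x - g x :: 'b::ab_group_add) = (\<Sum>x\<in>#Z. f x) - (\<Sum>x\<in>#Z. g x)"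
  by (induction Z) auto

lemma sum_mset_pos_neg: "(\<Sum>x\<in>#Z. q x :: real) = (\<Sum>x\<in>#Z. max 0 (q x)) - (\<Sum>x\<in>#Z. max 0 (- q x))"
  unfolding sum_mset_diff[symmetric] by (intro arg_cong[of _ _ sum_mset] image_mset_cong) auto

text \<open>For indicators the sum is a point count, and counts generate the sigma-algebra;
  increasing limits pass through the sum because configurations are finite. \<open>q\<close> is
  controlled only on \<open>S\<close>, which contains all points of a configuration.\<close>

lemma borel_measurable_sum_mset_ennreal:
  fixes q :: "'a::topological_space \<Rightarrow> ennreal"
  assumes S: "S \<in> sets borel" and q: "q \<in> borel_measurable (restrict_space borel S)"
  shows "(\<lambda>Z. \<Sum>x\<in>#Z. q x) \<in> borel_measurable (config S)"
  using q
proof (induction rule: borel_measurable_induct)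
  case (cong f g)
  have "(\<Sum>x\<in>#Z. f x) = (\<Sum>x\<in>#Z. g x)" if "Z \<in> space (config S)" for Z
    using that cong(3) by (intro arg_cong[of _ _ sum_mset] image_mset_cong)
      (auto simp: space_config space_restrict_space)
  then show ?case using cong(4) by (simp cong: measurable_cong)
next
  case (set A)
  then have "A \<in> sets borel" using S by (auto simp: sets_restrict_space)
  from measurable_count_in[OF this] show ?case
    unfolding sum_mset_indicator by measurable
next
  case (mult u c)
  then show ?case by (simp add: sum_mset_distrib_left[symmetric])
next
  case (add u v)
  then show ?case by (simp add: sum_mset.distrib)
next
  case (seq U)
  then show ?case unfolding sum_mset_SUP[OF seq(3)] by measurable
qed

lemma borel_measurable_sum_mset:
  fixes q :: "'a::topological_space \<Rightarrow> real"
  assumes S: "S \<in> sets borel" and [measurable]: "q \<in> borel_measurable (restrict_space borel S)"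
  shows "(\<lambda>Z. \<Sum>x\<in>#Z. q x) \<in> borel_measurable (config S)"
proof -
  have "(\<lambda>Z. \<Sum>x\<in>#Z. max 0 (p x)) \<in> borel_measurable (config S)"
    if [measurable]: "p \<in> borel_measurable (restrict_space borel S)" for p :: "'a \<Rightarrow> real"
  proof -
    have "(\<lambda>Z. enn2real (\<Sum>x\<in>#Z. ennreal (max 0 (p x)))) \<in> borel_measurable (config S)"
      by (intro borel_measurable_enn2real borel_measurable_sum_mset_ennreal[OF S]) measurable
    then show ?thesis
      by (subst (asm) sum_mset_ennreal) (auto simp: sum_mset_nonneg)
  qed
  from this[OF assms(2)] this[of "\<lambda>x. - q x"] show ?thesis
    by (subst sum_mset_pos_neg) (intro borel_measurable_diff, simp_all)
qed

text \<open>Separates the diagonal. Removing one copy of \<open>x\<close> rather than all is the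
  convention of \<open>expected_pairs\<close>; with it the identity holds for repeated points
  too.\<close>

lemma sum_mset_mult_sum_mset:
  fixes a b :: "'a \<Rightarrow> 'b::comm_semiring_0"
  shows "(\<Sum>x\<in>#Z. a x) * (\<Sum>y\<in>#Z. b y) = (\<Sum>x\<in>#Z. \<Sum>y\<in>#Z - {#x#}. a x * b y) + (\<Sum>x\<in>#Z. a x * b x)"
proof -
  have "(\<Sum>x\<in>#Z. a x) * (\<Sum>y\<in>#Z. b y) = (\<Sum>x\<in>#Z. a x * (\<Sum>y\<in>#Z. b y))"
    by (simp add: sum_mset_distrib_right)
  also have "\<dots> = (\<Sum>x\<in>#Z. (\<Sum>y\<in>#Z - {#x#}. a x * b y) + a x * b x)"
  proof (intro arg_cong[of _ _ sum_mset] image_mset_cong)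
    fix x assume "x \<in># Z"
    then have "(\<Sum>y\<in>#Z. b y) = b x + (\<Sum>y\<in>#Z - {#x#}. b y)"
      by (metis insert_DiffM image_mset_add_mset sum_mset.insert)
    then show "a x * (\<Sum>y\<in>#Z. b y) = (\<Sum>y\<in>#Z - {#x#}. a x * b y) + a x * b x"
      by (simp add: distrib_left sum_mset_distrib_left add.commute)
  qed
  finally show ?thesis by (simp add: sum_mset.distrib)
qed

section \<open>Campbell's formula of first order\<close>

locale intensity_process = prob_space P for P :: "'w measure" +
  fixes S :: "'a::euclidean_space set" and Z :: "'w \<Rightarrow> 'a multiset" and \<kappa> :: "'a \<Rightarrow> real"
  assumes S_borel: "S \<in> sets borel" and process: "point_process P S Z"
    and intensity: "has_intensity P S Z \<kappa>"
begin

abbreviation "\<L> \<equiv> restrict_space lborel S"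

lemma S_sets[simp]: "S \<inter> space lborel \<in> sets lborel"
  using S_borel by simp

lemma space_window: "space \<L> = S"
  by (simp add: space_restrict_space)

lemma sets_window: "sets \<L> = sets (restrict_space borel S)"
  by (rule sets_restrict_space_cong) simp

lemma measurable_process[measurable]: "Z \<in> measurable P (config S)"
  using process by (simp add: point_process_def)

lemma \<kappa>_measurable[measurable]: "\<kappa> \<in> borel_measurable \<L>"
  using intensity borel_measurable_restrict_space_iff[OF S_sets, of \<kappa>]
  by (simp add: has_intensity_def set_borel_measurable_def)

lemma \<kappa>_nonneg: "u \<in> S \<Longrightarrow> 0 \<le> \<kappa> u"
  using intensity by (simp add: has_intensity_def)

lemma measurable_sum_ennreal[measurable (raw)]:
  fixes q :: "'a \<Rightarrow> ennreal"
  assumes "q \<in> borel_measurable \<L>"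
  shows "(\<lambda>\<omega>. \<Sum>x\<in>#Z \<omega>. q x) \<in> borel_measurable P"
proof -
  have "q \<in> borel_measurable (restrict_space borel S)"
    using assms by (simp cong: measurable_cong_sets add: measurable_cong_sets[OF sets_window refl])
  from measurable_compose[OF measurable_process borel_measurable_sum_mset_ennreal[OF S_borel this]]
  show ?thesis .
qed

lemma measurable_sum[measurable (raw)]:
  fixes q :: "'a \<Rightarrow> real"
  assumes "q \<in> borel_measurable \<L>"
  shows "(\<lambda>\<omega>. \<Sum>x\<in>#Z \<omega>. q x) \<in> borel_measurable P"
proof -
  have "q \<in> borel_measurable (restrict_space borel S)"
    using assms by (simp cong: measurable_cong_sets add: measurable_cong_sets[OF sets_window refl])
  from measurable_compose[OF measurable_process borel_measurable_sum_mset[OF S_borel this]]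
  show ?thesis .
qed

lemma points_in: "\<omega> \<in> space P \<Longrightarrow> x \<in># Z \<omega> \<Longrightarrow> x \<in> S"
  using measurable_space[OF measurable_process] by (auto simp: space_config)

lemma sum_cong:
  assumes "\<omega> \<in> space P" "\<And>x. x \<in> S \<Longrightarrow> f x = g x"
  shows "(\<Sum>x\<in>#Z \<omega>. f x) = (\<Sum>x\<in>#Z \<omega>. g x)"
  using assms points_in by (intro arg_cong[of _ _ sum_mset] image_mset_cong) auto

text \<open>The definition of the intensity is the case of indicators; both sides respect sums,
  nonnegative multiples and increasing limits.\<close>

lemma nn_campbell:
  assumes "q \<in> borel_measurable \<L>"
  shows "(\<integral>\<^sup>+\<omega>. (\<Sum>x\<in>#Z \<omega>. q x) \<partial>P) = (\<integral>\<^sup>+u. q u * ennreal (\<kappa> u) \<partial>\<L>)"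
  using assms
proof (induction rule: borel_measurable_induct)
  case (cong f g)
  then have "(\<integral>\<^sup>+\<omega>. (\<Sum>x\<in>#Z \<omega>. f x) \<partial>P) = (\<integral>\<^sup>+\<omega>. (\<Sum>x\<in>#Z \<omega>. g x) \<partial>P)"
    by (intro nn_integral_cong sum_cong) (auto simp: space_window)
  also have "\<dots> = (\<integral>\<^sup>+u. f u * ennreal (\<kappa> u) \<partial>\<L>)"
    unfolding cong(4) using cong(3) by (intro nn_integral_cong) auto
  finally show ?case .
next
  case (set A)
  then have A: "A \<in> sets borel" "A \<subseteq> S"
    using S_borel by (auto simp: sets_restrict_space)
  then have "(\<integral>\<^sup>+\<omega>. (\<Sum>x\<in>#Z \<omega>. indicator A x) \<partial>P) = (\<integral>\<^sup>+u\<in>A. ennreal (\<kappa> u) \<partial>lborel)"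
    using intensity by (simp add: has_intensity_def)
  also have "\<dots> = (\<integral>\<^sup>+u. indicator A u * ennreal (\<kappa> u) \<partial>\<L>)"
    unfolding nn_integral_restrict_space[OF S_sets] using A
    by (intro nn_integral_cong) (auto split: split_indicator)
  finally show ?case .
next
  case (mult u c)
  then show ?case
    by (simp add: sum_mset_distrib_left[symmetric] nn_integral_cmult mult.assoc)
next
  case (add u v)
  then show ?case
    by (simp add: sum_mset.distrib nn_integral_add distrib_right)
next
  case (seq U)
  have "(\<integral>\<^sup>+\<omega>. (\<Sum>x\<in>#Z \<omega>. (SUP i. U i) x) \<partial>P) = (\<integral>\<^sup>+\<omega>. (SUP i. \<Sum>x\<in>#Z \<omega>. U i x) \<partial>P)"
    unfolding sum_mset_SUP[OF seq(3)] ..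
  also have "\<dots> = (SUP i. \<integral>\<^sup>+\<omega>. (\<Sum>x\<in>#Z \<omega>. U i x) \<partial>P)"
    using seq by (intro nn_integral_monotone_convergence_SUP)
      (auto simp: incseq_def le_fun_def intro!: sum_mset_mono)
  also have "\<dots> = (SUP i. \<integral>\<^sup>+u. U i u * ennreal (\<kappa> u) \<partial>\<L>)" by (simp add: seq)
  also have "\<dots> = (\<integral>\<^sup>+u. (SUP i. U i u * ennreal (\<kappa> u)) \<partial>\<L>)"
    using seq by (intro nn_integral_monotone_convergence_SUP[symmetric])
      (auto simp: incseq_def le_fun_def intro!: mult_right_mono)
  also have "\<dots> = (\<integral>\<^sup>+u. (SUP i. U i) u * ennreal (\<kappa> u) \<partial>\<L>)"
    by (simp add: SUP_mult_right_ennreal image_comp)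
  finally show ?case .
qed

lemma campbell:
  fixes q :: "'a \<Rightarrow> real"
  assumes [measurable]: "q \<in> borel_measurable \<L>" and int: "integrable \<L> (\<lambda>u. q u * \<kappa> u)"
  shows "integrable P (\<lambda>\<omega>. \<Sum>x\<in>#Z \<omega>. q x)"
    and "(\<integral>\<omega>. (\<Sum>x\<in>#Z \<omega>. q x) \<partial>P) = (\<integral>u. q u * \<kappa> u \<partial>\<L>)"
proof -
  have *: "integrable P (\<lambda>\<omega>. \<Sum>x\<in>#Z \<omega>. max 0 (p x))"
    "(\<integral>\<omega>. (\<Sum>x\<in>#Z \<omega>. max 0 (p x)) \<partial>P) = (\<integral>u. max 0 (p u) * \<kappa> u \<partial>\<L>)"
    "integrable \<L> (\<lambda>u. max 0 (p u) * \<kappa> u)"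
    if [measurable]: "p \<in> borel_measurable \<L>" and int: "integrable \<L> (\<lambda>u. p u * \<kappa> u)" for p :: "'a \<Rightarrow> real"
  proof -
    show i: "integrable \<L> (\<lambda>u. max 0 (p u) * \<kappa> u)"
      by (rule Bochner_Integration.integrable_bound[OF int])
         (auto intro!: AE_I2 mult_right_mono simp: space_window abs_mult \<kappa>_nonneg)
    have "(\<integral>\<^sup>+\<omega>. ennreal (\<Sum>x\<in>#Z \<omega>. max 0 (p x)) \<partial>P) = (\<integral>\<^sup>+\<omega>. (\<Sum>x\<in>#Z \<omega>. ennreal (max 0 (p x))) \<partial>P)"
      by (simp only: sum_mset_ennreal[of "\<lambda>x. max 0 (p x)", OF max.cobounded1])
    also have "\<dots> = (\<integral>\<^sup>+u. ennreal (max 0 (p u)) * ennreal (\<kappa> u) \<partial>\<L>)"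
      by (rule nn_campbell) measurable
    also have "\<dots> = (\<integral>\<^sup>+u. ennreal (max 0 (p u) * \<kappa> u) \<partial>\<L>)"
      by (intro nn_integral_cong) (simp add: ennreal_mult space_window \<kappa>_nonneg)
    also have "\<dots> = ennreal (\<integral>u. max 0 (p u) * \<kappa> u \<partial>\<L>)"
      by (rule nn_integral_eq_integral[OF i]) (auto intro!: AE_I2 simp: space_window \<kappa>_nonneg)
    finally have nn: "(\<integral>\<^sup>+\<omega>. ennreal (\<Sum>x\<in>#Z \<omega>. max 0 (p x)) \<partial>P) = ennreal (\<integral>u. max 0 (p u) * \<kappa> u \<partial>\<L>)" .
    show "integrable P (\<lambda>\<omega>. \<Sum>x\<in>#Z \<omega>. max 0 (p x))"
      by (rule integrableI_nonneg) (auto simp: nn sum_mset_nonneg)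
    show "(\<integral>\<omega>. (\<Sum>x\<in>#Z \<omega>. max 0 (p x)) \<partial>P) = (\<integral>u. max 0 (p u) * \<kappa> u \<partial>\<L>)"
    proof -
      have "0 \<le> (\<integral>u. max 0 (p u) * \<kappa> u \<partial>\<L>)"
        by (intro Bochner_Integration.integral_nonneg) (simp add: space_window \<kappa>_nonneg)
      then show ?thesis by (subst integral_eq_nn_integral) (auto simp: nn sum_mset_nonneg)
    qed
  qed
  have neg: "(\<lambda>u. - q u) \<in> borel_measurable \<L>" "integrable \<L> (\<lambda>u. - q u * \<kappa> u)"
    using int by auto
  show "integrable P (\<lambda>\<omega>. \<Sum>x\<in>#Z \<omega>. q x)"
    by (subst sum_mset_pos_neg) (intro Bochner_Integration.integrable_diff *(1) neg int assms)
  have "(\<integral>\<omega>. (\<Sum>x\<in>#Z \<omega>. q x) \<partial>P) = (\<integral>u. max 0 (q u) * \<kappa> u \<partial>\<L>) - (\<integral>u. max 0 (- q u) * \<kappa> u \<partial>\<L>)"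
    by (subst sum_mset_pos_neg) (simp add: *(1,2)[OF assms(1) int] *(1,2)[OF neg])
  also have "\<dots> = (\<integral>u. max 0 (q u) * \<kappa> u - max 0 (- q u) * \<kappa> u \<partial>\<L>)"
    by (rule Bochner_Integration.integral_diff[symmetric]) (intro *(3) neg int assms)+
  also have "\<dots> = (\<integral>u. q u * \<kappa> u \<partial>\<L>)"
    by (intro Bochner_Integration.integral_cong refl) (auto simp: max_def)
  finally show "(\<integral>\<omega>. (\<Sum>x\<in>#Z \<omega>. q x) \<partial>P) = (\<integral>u. q u * \<kappa> u \<partial>\<L>)" .
qed

end

section \<open>Campbell's formula of second order\<close>

locale second_order_process = intensity_process P S Z \<kappa>
  for P :: "'w measure" and S :: "'a::euclidean_space set" and Z :: "'w \<Rightarrow> 'a multiset" and \<kappa> +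
  fixes \<kappa>2 :: "'a \<Rightarrow> 'a \<Rightarrow> real"
  assumes density2: "has_second_product_density P S Z \<kappa>2"
begin

lemma \<kappa>2_nonneg: "u \<in> S \<Longrightarrow> v \<in> S \<Longrightarrow> 0 \<le> \<kappa>2 u v"
  using density2 by (simp add: has_second_product_density_def)

text \<open>The density is given as measurable for Lebesgue measure on the product space, whereas
  Fubini's theorem works with the product of the two restricted measures; the identity map links the
  two.\<close>

lemma \<kappa>2_measurable[measurable]: "(\<lambda>p. \<kappa>2 (fst p) (snd p)) \<in> borel_measurable (\<L> \<Otimes>\<^sub>M \<L>)"
proof -
  have id: "(\<lambda>x. x) \<in> measurable \<L> lborel" by (rule measurable_restrict_space1) simp
  have "(\<lambda>p. (fst p, snd p)) \<in> measurable (\<L> \<Otimes>\<^sub>M \<L>) (lborel \<Otimes>\<^sub>M lborel)"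
    by (intro measurable_Pair measurable_compose[OF measurable_fst id] measurable_compose[OF measurable_snd id])
  then have [measurable]: "(\<lambda>p. p) \<in> measurable (\<L> \<Otimes>\<^sub>M \<L>) (lborel :: ('a \<times> 'a) measure)"
    by (simp add: lborel_prod)
  have [measurable]: "(\<lambda>p. indicator (S \<times> S) p *\<^sub>R (case p of (u, v) \<Rightarrow> \<kappa>2 u v)) \<in> borel_measurable (lborel :: ('a \<times> 'a) measure)"
    using density2 unfolding has_second_product_density_def set_borel_measurable_def by blast
  have "(\<lambda>p. indicator (S \<times> S) p *\<^sub>R (case p of (u, v) \<Rightarrow> \<kappa>2 u v)) \<in> borel_measurable (\<L> \<Otimes>\<^sub>M \<L>)"
    by (rule measurable_compose[of "\<lambda>p. p" _ lborel]) measurable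
  moreover have "indicator (S \<times> S) p *\<^sub>R (case p of (u, v) \<Rightarrow> \<kappa>2 u v) = \<kappa>2 (fst p) (snd p)"
    if "p \<in> space (\<L> \<Otimes>\<^sub>M \<L>)" for p
    using that by (auto simp: space_pair_measure space_window)
  ultimately show ?thesis by (simp cong: measurable_cong)
qed

lemma sigma_finite_window: "sigma_finite_measure \<L>"
  using S_borel by (intro sigma_finite_measure_restrict_space lborel.sigma_finite_measure_axioms) simp

sublocale window: pair_sigma_finite \<L> \<L>
  using sigma_finite_window by (simp add: pair_sigma_finite_def)

lemma nn_campbell2_indicator:
  assumes A: "A \<in> sets \<L>" and B: "B \<in> sets \<L>"
  shows "(\<integral>\<^sup>+\<omega>. (\<Sum>x\<in>#Z \<omega>. indicator A x) * (\<Sum>x\<in>#Z \<omega>. indicator B x) \<partial>P) =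
    (\<integral>\<^sup>+p. indicator A (fst p) * indicator B (snd p) * ennreal (\<kappa>2 (fst p) (snd p)) \<partial>(\<L> \<Otimes>\<^sub>M \<L>)) +
    (\<integral>\<^sup>+u. indicator A u * indicator B u * ennreal (\<kappa> u) \<partial>\<L>)"
proof -
  have A': "A \<in> sets borel" "A \<subseteq> S" and B': "B \<in> sets borel" "B \<subseteq> S"
    using A B S_borel by (auto simp: sets_restrict_space)
  note [measurable] = A B
  let ?N = "\<lambda>C \<omega>. \<Sum>x\<in>#Z \<omega>. indicator C x :: ennreal"
  let ?D = "\<lambda>\<omega>. \<Sum>x\<in>#Z \<omega>. \<Sum>y\<in>#Z \<omega> - {#x#}. indicator (A \<times> B) (x, y) :: ennreal"
  have split: "?N A \<omega> * ?N B \<omega> = ?D \<omega> + ?N (A \<inter> B) \<omega>" for \<omega>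
    unfolding sum_mset_mult_sum_mset by (simp add: indicator_times indicator_inter_arith)
  \<comment> \<open>The pair sum becomes measurable as a difference of expressions in counts. The
    counts are finite, so subtraction in the extended reals undoes the addition.\<close>
  have "?D \<omega> = ?N A \<omega> * ?N B \<omega> - ?N (A \<inter> B) \<omega>" for \<omega>
    unfolding split by (simp add: sum_mset_indicator)
  then have D[measurable]: "?D \<in> borel_measurable P" by simp
  have "(\<integral>\<^sup>+\<omega>. ?N A \<omega> * ?N B \<omega> \<partial>P) = (\<integral>\<^sup>+\<omega>. ?D \<omega> \<partial>P) + (\<integral>\<^sup>+\<omega>. ?N (A \<inter> B) \<omega> \<partial>P)"
    unfolding split by (rule nn_integral_add) (auto intro: D measurable_sum_ennreal)
  also have "(\<integral>\<^sup>+\<omega>. ?N (A \<inter> B) \<omega> \<partial>P) = (\<integral>\<^sup>+u. indicator A u * indicator B u * ennreal (\<kappa> u) \<partial>\<L>)"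
    by (subst nn_campbell) (auto simp: indicator_inter_arith)
  also have "(\<integral>\<^sup>+\<omega>. ?D \<omega> \<partial>P) = (\<integral>\<^sup>+u\<in>A. (\<integral>\<^sup>+v\<in>B. ennreal (\<kappa>2 u v) \<partial>lborel) \<partial>lborel)"
    using density2 A' B' unfolding has_second_product_density_def expected_pairs_def by blast
  also have "\<dots> = (\<integral>\<^sup>+u. (\<integral>\<^sup>+v. indicator A u * indicator B v * ennreal (\<kappa>2 u v) \<partial>\<L>) \<partial>\<L>)"
    unfolding nn_integral_restrict_space[OF S_sets]
  proof (intro nn_integral_cong)
    fix u
    have "(\<integral>\<^sup>+v\<in>B. ennreal (\<kappa>2 u v) \<partial>lborel) * indicator A u =
        (\<integral>\<^sup>+v\<in>S. (indicator A u * indicator B v * ennreal (\<kappa>2 u v)) \<partial>lborel)"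
      using A' B' by (cases "u \<in> A") (auto intro!: nn_integral_cong split: split_indicator)
    then show "(\<integral>\<^sup>+v\<in>B. ennreal (\<kappa>2 u v) \<partial>lborel) * indicator A u =
        (\<integral>\<^sup>+v\<in>S. (indicator A u * indicator B v * ennreal (\<kappa>2 u v)) \<partial>lborel) * indicator S u"
      using A' by (cases "u \<in> S") (auto split: split_indicator)
  qed
  also have "\<dots> = (\<integral>\<^sup>+p. indicator A (fst p) * indicator B (snd p) * ennreal (\<kappa>2 (fst p) (snd p)) \<partial>(\<L> \<Otimes>\<^sub>M \<L>))"
    using sigma_finite_measure.nn_integral_fst[OF sigma_finite_window, of "\<lambda>p. indicator A (fst p) * indicator B (snd p) * ennreal (\<kappa>2 (fst p) (snd p))" \<L>]
    by simp
  finally show ?thesis .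
qed

text \<open>The density is specified on rectangles. Both sides are additive and continuous along
  increasing sequences in each argument separately, so the induction over measurable functions runs
  first in \<open>a\<close>, with an indicator for \<open>b\<close>, and then in \<open>b\<close>
  for arbitrary \<open>a\<close>.\<close>

lemma nn_campbell2:
  assumes a: "a \<in> borel_measurable \<L>" and b: "b \<in> borel_measurable \<L>"
  shows "(\<integral>\<^sup>+\<omega>. (\<Sum>x\<in>#Z \<omega>. a x) * (\<Sum>x\<in>#Z \<omega>. b x) \<partial>P) =
    (\<integral>\<^sup>+p. a (fst p) * b (snd p) * ennreal (\<kappa>2 (fst p) (snd p)) \<partial>(\<L> \<Otimes>\<^sub>M \<L>)) +
    (\<integral>\<^sup>+u. a u * b u * ennreal (\<kappa> u) \<partial>\<L>)" (is "?L a b = ?R a b")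
proof -
  have set_a: "?L a (indicator B) = ?R a (indicator B)" if B[measurable]: "B \<in> sets \<L>" for B
    using a
  proof (induction rule: borel_measurable_induct)
    case (cong f g)
    have "?L f (indicator B) = ?L g (indicator B)"
      using cong(3) by (intro nn_integral_cong arg_cong2[of _ _ _ _ "(*)"] sum_cong) (auto simp: space_window)
    moreover have "?R f (indicator B) = ?R g (indicator B)"
      using cong(3) by (intro arg_cong2[of _ _ _ _ "(+)"] nn_integral_cong) (auto simp: space_pair_measure)
    ultimately show ?case using cong(4) by simp
  next
    case (set A)
    then show ?case using B by (rule nn_campbell2_indicator)
  next
    case (mult u c)
    then show ?case
      by (simp add: sum_mset_distrib_left[symmetric] nn_integral_cmult mult.assoc distrib_left)
  next
    case (add u v)
    then show ?case
      by (simp add: sum_mset.distrib nn_integral_add distrib_right add_ac)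
  next
    case (seq U)
    have mono: "U i x \<le> U j x" if "i \<le> j" for i j x
      using seq(3) that by (simp add: incseq_def le_fun_def)
    have "?L (SUP i. U i) (indicator B) = (\<integral>\<^sup>+\<omega>. (SUP i. (\<Sum>x\<in>#Z \<omega>. U i x) * (\<Sum>x\<in>#Z \<omega>. indicator B x)) \<partial>P)"
      unfolding sum_mset_SUP[OF seq(3)] SUP_mult_right_ennreal ..
    also have "\<dots> = (SUP i. ?L (U i) (indicator B))"
      using seq(1) by (intro nn_integral_monotone_convergence_SUP)
        (auto simp: incseq_def le_fun_def intro!: mult_right_mono sum_mset_mono mono)
    also have "\<dots> = (SUP i. ?R (U i) (indicator B))" by (simp add: seq)
    also have "\<dots> = (SUP i. (\<integral>\<^sup>+p. U i (fst p) * indicator B (snd p) * ennreal (\<kappa>2 (fst p) (snd p)) \<partial>(\<L> \<Otimes>\<^sub>M \<L>)))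
        + (SUP i. (\<integral>\<^sup>+u. U i u * indicator B u * ennreal (\<kappa> u) \<partial>\<L>))"
      by (intro ennreal_SUP_add) (auto simp: incseq_def intro!: nn_integral_mono mult_right_mono mono)
    also have "\<dots> = (\<integral>\<^sup>+p. (SUP i. U i (fst p) * indicator B (snd p) * ennreal (\<kappa>2 (fst p) (snd p))) \<partial>(\<L> \<Otimes>\<^sub>M \<L>))
        + (\<integral>\<^sup>+u. (SUP i. U i u * indicator B u * ennreal (\<kappa> u)) \<partial>\<L>)"
      using seq(1) by (intro arg_cong2[of _ _ _ _ "(+)"] nn_integral_monotone_convergence_SUP[symmetric])
        (auto simp: incseq_def le_fun_def intro!: mult_right_mono mono)
    also have "\<dots> = ?R (SUP i. U i) (indicator B)"
      by (simp add: SUP_mult_right_ennreal image_comp)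
    finally show ?case .
  qed
  show ?thesis
    using b
  proof (induction rule: borel_measurable_induct)
    case (cong f g)
    have "?L a f = ?L a g"
      using cong(3) by (intro nn_integral_cong arg_cong2[of _ _ _ _ "(*)"] sum_cong) (auto simp: space_window)
    moreover have "?R a f = ?R a g"
      using cong(3) by (intro arg_cong2[of _ _ _ _ "(+)"] nn_integral_cong) (auto simp: space_pair_measure)
    ultimately show ?case using cong(4) by simp
  next
    case (set B)
    then show ?case by (rule set_a)
  next
    case (mult u c)
    have eq: "x * (c * y) = c * (x * y)" for x y :: ennreal by (simp add: mult_ac)
    show ?case using mult a
      by (simp add: sum_mset_distrib_left[symmetric] nn_integral_cmult eq mult.assoc distrib_left)
  next
    case (add u v)
    then show ?case using a
      by (simp add: sum_mset.distrib nn_integral_add distrib_right distrib_left add_ac)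
  next
    case (seq U)
    have mono: "U i x \<le> U j x" if "i \<le> j" for i j x
      using seq(3) that by (simp add: incseq_def le_fun_def)
    have "?L a (SUP i. U i) = (\<integral>\<^sup>+\<omega>. (SUP i. (\<Sum>x\<in>#Z \<omega>. a x) * (\<Sum>x\<in>#Z \<omega>. U i x)) \<partial>P)"
      unfolding sum_mset_SUP[OF seq(3)] SUP_mult_left_ennreal ..
    also have "\<dots> = (SUP i. ?L a (U i))"
      using seq(1) a by (intro nn_integral_monotone_convergence_SUP)
        (auto simp: incseq_def le_fun_def intro!: mult_left_mono sum_mset_mono mono)
    also have "\<dots> = (SUP i. ?R a (U i))" by (simp add: seq)
    also have "\<dots> = (SUP i. (\<integral>\<^sup>+p. a (fst p) * U i (snd p) * ennreal (\<kappa>2 (fst p) (snd p)) \<partial>(\<L> \<Otimes>\<^sub>M \<L>)))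
        + (SUP i. (\<integral>\<^sup>+u. a u * U i u * ennreal (\<kappa> u) \<partial>\<L>))"
      by (intro ennreal_SUP_add) (auto simp: incseq_def intro!: nn_integral_mono mult_right_mono mult_left_mono mono)
    also have "\<dots> = (\<integral>\<^sup>+p. (SUP i. a (fst p) * U i (snd p) * ennreal (\<kappa>2 (fst p) (snd p))) \<partial>(\<L> \<Otimes>\<^sub>M \<L>))
        + (\<integral>\<^sup>+u. (SUP i. a u * U i u * ennreal (\<kappa> u)) \<partial>\<L>)"
      using seq(1) a by (intro arg_cong2[of _ _ _ _ "(+)"] nn_integral_monotone_convergence_SUP[symmetric])
        (auto simp: incseq_def le_fun_def intro!: mult_right_mono mult_left_mono mono)
    also have "\<dots> = ?R a (SUP i. U i)"
      by (simp add: SUP_mult_right_ennreal[symmetric] SUP_mult_left_ennreal[symmetric] image_comp)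
    finally show ?case .
  qed
qed

text \<open>For nonnegative functions this is the previous lemma; both sides being bilinear, it extends to
  differences of nonnegative functions.\<close>

lemma campbell2:
  fixes a b :: "'a \<Rightarrow> real"
  assumes a: "a \<in> borel_measurable \<L>" and b: "b \<in> borel_measurable \<L>"
    and int2: "integrable (\<L> \<Otimes>\<^sub>M \<L>) (\<lambda>p. a (fst p) * b (snd p) * \<kappa>2 (fst p) (snd p))"
    and int1: "integrable \<L> (\<lambda>u. a u * b u * \<kappa> u)"
  shows "integrable P (\<lambda>\<omega>. (\<Sum>x\<in>#Z \<omega>. a x) * (\<Sum>x\<in>#Z \<omega>. b x))"
    and "(\<integral>\<omega>. (\<Sum>x\<in>#Z \<omega>. a x) * (\<Sum>x\<in>#Z \<omega>. b x) \<partial>P) =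
      (\<integral>p. a (fst p) * b (snd p) * \<kappa>2 (fst p) (snd p) \<partial>(\<L> \<Otimes>\<^sub>M \<L>)) + (\<integral>u. a u * b u * \<kappa> u \<partial>\<L>)"
proof -
  let ?L = "\<lambda>a b \<omega>. (\<Sum>x\<in>#Z \<omega>. a x) * (\<Sum>x\<in>#Z \<omega>. b x) :: real"
  let ?R2 = "\<lambda>a b p. a (fst p) * b (snd p) * \<kappa>2 (fst p) (snd p) :: real"
  let ?R1 = "\<lambda>a b u. a u * b u * \<kappa> u :: real"
  \<comment> \<open>Integrability of all three functions travels with the identity, for otherwise
    the integrals of differences could not be split.\<close>
  define ok where "ok a b \<longleftrightarrow> integrable P (?L a b) \<and> integrable (\<L> \<Otimes>\<^sub>M \<L>) (?R2 a b) \<and> integrable \<L> (?R1 a b) \<and>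
    integral\<^sup>L P (?L a b) = integral\<^sup>L (\<L> \<Otimes>\<^sub>M \<L>) (?R2 a b) + integral\<^sup>L \<L> (?R1 a b)" for a b
  have diff1: "ok (\<lambda>x. a x - a' x) b" if "ok a b" "ok a' b" for a a' b
    using that by (simp add: ok_def sum_mset_diff left_diff_distrib)
  have diff2: "ok a (\<lambda>x. b x - b' x)" if "ok a b" "ok a b'" for a b b'
    using that by (simp add: ok_def sum_mset_diff left_diff_distrib right_diff_distrib)
  \<comment> \<open>Domination by \<open>a\<close> and \<open>b\<close> in absolute value lets
    positive and negative parts inherit the assumed integrability.\<close>
  have nonneg: "ok c d" if [measurable]: "c \<in> borel_measurable \<L>" "d \<in> borel_measurable \<L>"
    and c: "\<And>x. 0 \<le> c x" "\<And>x. \<bar>c x\<bar> \<le> \<bar>a x\<bar>" and d: "\<And>x. 0 \<le> d x" "\<And>x. \<bar>d x\<bar> \<le> \<bar>b x\<bar>" for c d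
  proof -
    have i2: "integrable (\<L> \<Otimes>\<^sub>M \<L>) (?R2 c d)"
      by (rule Bochner_Integration.integrable_bound[OF int2])
         (auto intro!: AE_I2 mult_mono c d simp: abs_mult)
    have i1: "integrable \<L> (?R1 c d)"
      by (rule Bochner_Integration.integrable_bound[OF int1])
         (auto intro!: AE_I2 mult_mono c d simp: abs_mult)
    have nonneg2: "0 \<le> ?R2 c d p" if "p \<in> space (\<L> \<Otimes>\<^sub>M \<L>)" for p
      using that c d by (auto simp: space_pair_measure space_window intro!: mult_nonneg_nonneg \<kappa>2_nonneg)
    have nonneg1: "0 \<le> ?R1 c d u" if "u \<in> space \<L>" for u
      using that c d by (auto simp: space_window intro!: mult_nonneg_nonneg \<kappa>_nonneg)
    have "(\<integral>\<^sup>+\<omega>. ennreal (?L c d \<omega>) \<partial>P) = (\<integral>\<^sup>+\<omega>. (\<Sum>x\<in>#Z \<omega>. ennreal (c x)) * (\<Sum>x\<in>#Z \<omega>. ennreal (d x)) \<partial>P)"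
      using c d by (simp add: sum_mset_ennreal ennreal_mult sum_mset_nonneg)
    also have "\<dots> = (\<integral>\<^sup>+p. ennreal (c (fst p)) * ennreal (d (snd p)) * ennreal (\<kappa>2 (fst p) (snd p)) \<partial>(\<L> \<Otimes>\<^sub>M \<L>)) +
      (\<integral>\<^sup>+u. ennreal (c u) * ennreal (d u) * ennreal (\<kappa> u) \<partial>\<L>)"
      by (rule nn_campbell2) measurable
    also have "\<dots> = (\<integral>\<^sup>+p. ennreal (?R2 c d p) \<partial>(\<L> \<Otimes>\<^sub>M \<L>)) + (\<integral>\<^sup>+u. ennreal (?R1 c d u) \<partial>\<L>)"
      using c d by (intro arg_cong2[of _ _ _ _ "(+)"] nn_integral_cong)
        (auto simp: ennreal_mult space_pair_measure space_window \<kappa>2_nonneg \<kappa>_nonneg)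
    also have "\<dots> = ennreal (integral\<^sup>L (\<L> \<Otimes>\<^sub>M \<L>) (?R2 c d)) + ennreal (integral\<^sup>L \<L> (?R1 c d))"
      using nonneg1 nonneg2 by (intro arg_cong2[of _ _ _ _ "(+)"] nn_integral_eq_integral i1 i2 AE_I2)
    also have "\<dots> = ennreal (integral\<^sup>L (\<L> \<Otimes>\<^sub>M \<L>) (?R2 c d) + integral\<^sup>L \<L> (?R1 c d))"
      using nonneg1 nonneg2 by (intro ennreal_plus[symmetric] Bochner_Integration.integral_nonneg)
    finally have nn: "(\<integral>\<^sup>+\<omega>. ennreal (?L c d \<omega>) \<partial>P) = ennreal (integral\<^sup>L (\<L> \<Otimes>\<^sub>M \<L>) (?R2 c d) + integral\<^sup>L \<L> (?R1 c d))" .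
    have L0: "0 \<le> ?L c d \<omega>" for \<omega>
      using c d by (intro mult_nonneg_nonneg sum_mset_nonneg)
    have iL: "integrable P (?L c d)"
      using L0 by (intro integrableI_nonneg) (auto simp: nn)
    moreover have "integral\<^sup>L P (?L c d) = integral\<^sup>L (\<L> \<Otimes>\<^sub>M \<L>) (?R2 c d) + integral\<^sup>L \<L> (?R1 c d)"
    proof -
      have "0 \<le> integral\<^sup>L (\<L> \<Otimes>\<^sub>M \<L>) (?R2 c d) + integral\<^sup>L \<L> (?R1 c d)"
        using nonneg1 nonneg2 by (intro add_nonneg_nonneg Bochner_Integration.integral_nonneg)
      then show ?thesis using L0 by (subst integral_eq_nn_integral) (auto simp: nn)
    qed
    ultimately show ?thesis using i1 i2 by (simp add: ok_def)
  qed
  have meas: "(\<lambda>x. max 0 (a x)) \<in> borel_measurable \<L>" "(\<lambda>x. max 0 (- a x)) \<in> borel_measurable \<L>"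
    "(\<lambda>x. max 0 (b x)) \<in> borel_measurable \<L>" "(\<lambda>x. max 0 (- b x)) \<in> borel_measurable \<L>"
    using a b by measurable
  have "ok (\<lambda>x. max 0 (a x) - max 0 (- a x)) (\<lambda>x. max 0 (b x) - max 0 (- b x))"
    by (intro diff1 diff2 nonneg meas) auto
  moreover have "(\<lambda>x. max 0 (q x) - max 0 (- q x)) = q" for q :: "'a \<Rightarrow> real" by (auto simp: max_def)
  ultimately have "ok a b" by simp
  then show "integrable P (?L a b)" "integral\<^sup>L P (?L a b) = integral\<^sup>L (\<L> \<Otimes>\<^sub>M \<L>) (?R2 a b) + integral\<^sup>L \<L> (?R1 a b)"
    by (simp_all add: ok_def)
qed

end

section \<open>Independent copies of point processes\<close>

text \<open>Independence concerns finite subfamilies only, and an injection carries these to finite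
  subfamilies.\<close>

lemma (in prob_space) indep_vars_reindex:
  assumes "inj f" and indep: "indep_vars M' X (f ` I)"
  shows "indep_vars (\<lambda>i. M' (f i)) (\<lambda>i. X (f i)) I"
  unfolding indep_vars_def2 indep_sets_def
proof (intro conjI ballI allI impI)
  show "random_variable (M' (f i)) (X (f i))" if "i \<in> I" for i
    using indep that by (auto simp: indep_vars_def2)
  show "{X (f i) -` A \<inter> space M |A. A \<in> sets (M' (f i))} \<subseteq> events" if "i \<in> I" for i
    using indep that by (auto simp: indep_vars_def2 indep_sets_def)
  fix J A
  assume J: "J \<subseteq> I" "J \<noteq> {}" "finite J"
    and A: "A \<in> (\<Pi> j\<in>J. {X (f j) -` A \<inter> space M |A. A \<in> sets (M' (f j))})"
  have A': "A \<circ> inv f \<in> (\<Pi> j\<in>f ` J. {X j -` A \<inter> space M |A. A \<in> sets (M' j)})"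
    using A \<open>inj f\<close> by (auto simp: Pi_iff)
  have *: "\<forall>K\<subseteq>f ` I. K \<noteq> {} \<longrightarrow> finite K \<longrightarrow> (\<forall>B\<in>(\<Pi> j\<in>K. {X j -` A \<inter> space M |A. A \<in> sets (M' j)}).
      prob (\<Inter>j\<in>K. B j) = (\<Prod>j\<in>K. prob (B j)))"
    using indep unfolding indep_vars_def2 indep_sets_def by blast
  have "prob (\<Inter>j\<in>f ` J. (A \<circ> inv f) j) = (\<Prod>j\<in>f ` J. prob ((A \<circ> inv f) j))"
    by (rule *[rule_format, OF _ _ _ A']) (use J in auto)
  then show "prob (\<Inter>j\<in>J. A j) = (\<Prod>j\<in>J. prob (A j))"
    using \<open>inj f\<close> by (simp add: prod.reindex inj_on_subset[OF \<open>inj f\<close>] image_comp comp_def)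
qed

text \<open>Processes are numbered from 1 but the limit theorems from 0, whence the shift by
  \<open>Suc\<close> that recurs below.\<close>

lemma iid_functional:
  fixes G :: "'a::topological_space multiset \<Rightarrow> real"
  assumes P: "prob_space P" and iid: "iid_point_processes P S Y"
    and G[measurable]: "G \<in> borel_measurable (config S)"
  shows "prob_space.indep_vars P (\<lambda>_. borel) (\<lambda>i \<omega>. G (Y (Suc i) \<omega>)) UNIV"
    and "distr P borel (\<lambda>\<omega>. G (Y (Suc i) \<omega>)) = distr P borel (\<lambda>\<omega>. G (Y (Suc 0) \<omega>))"
proof -
  interpret prob_space P by (rule P)
  have "indep_vars (\<lambda>_. config S) Y (range Suc)"
    using iid by (simp add: iid_point_processes_def greaterThan_0[symmetric] atLeast_Suc_greaterThan)
  from indep_vars_compose2[OF indep_vars_reindex[OF inj_Suc this], of "\<lambda>_. G" "\<lambda>_. borel"]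
  show "indep_vars (\<lambda>_. borel) (\<lambda>i \<omega>. G (Y (Suc i) \<omega>)) UNIV" by simp
  have [measurable]: "Y (Suc j) \<in> measurable P (config S)" for j
    using iid by (simp add: iid_point_processes_def point_process_def)
  have "distr P borel (\<lambda>\<omega>. G (Y (Suc j) \<omega>)) = distr (distr P (config S) (Y (Suc j))) borel G" for j
    by (simp add: distr_distr comp_def)
  moreover have "\<forall>j\<ge>1. distr P (config S) (Y j) = distr P (config S) (Y 1)"
    using iid unfolding iid_point_processes_def by blast
  then have "distr P (config S) (Y (Suc j)) = distr P (config S) (Y 1)" for j
    by (rule allE[of _ "Suc j"]) simp
  ultimately show "distr P borel (\<lambda>\<omega>. G (Y (Suc i) \<omega>)) = distr P borel (\<lambda>\<omega>. G (Y (Suc 0) \<omega>))"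
    by metis
qed

text \<open>The two whole sequences are independent as random elements of an infinite product, and a
  partial sum is a measurable function of one of them.\<close>

lemma indep_var_partial_sums:
  fixes G H :: "'a::topological_space multiset \<Rightarrow> real"
  assumes P: "prob_space P" and indep: "independent_sequences P S Y E"
    and [measurable]: "G \<in> borel_measurable (config S)" "H \<in> borel_measurable (config S)"
  shows "prob_space.indep_var P borel (\<lambda>\<omega>. \<Sum>i<n. G (Y (Suc i) \<omega>)) borel (\<lambda>\<omega>. \<Sum>i<n. H (E (Suc i) \<omega>))"
proof -
  interpret prob_space P by (rule P)
  have [measurable]: "(\<lambda>y. y (Suc i)) \<in> measurable (\<Pi>\<^sub>M i\<in>{1..}. config S) (config S)" for i
    by (rule measurable_component_singleton) simp
  have "indep_var borel ((\<lambda>y. \<Sum>i<n. G (y (Suc i))) \<circ> (\<lambda>\<omega>. \<lambda>i\<in>{1..}. Y i \<omega>))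
    borel ((\<lambda>y. \<Sum>i<n. H (y (Suc i))) \<circ> (\<lambda>\<omega>. \<lambda>i\<in>{1..}. E i \<omega>))"
    using indep unfolding independent_sequences_def
    by (rule indep_var_compose) measurable
  then show ?thesis by (simp add: comp_def)
qed

lemma sum_mset_superposition:
  "(\<Sum>x\<in>#superposition Y n \<omega>. q x) = (\<Sum>i<n. \<Sum>x\<in>#Y (Suc i) \<omega>. q x)"
proof -
  have "(\<Sum>x\<in>#superposition Y n \<omega>. q x) = (\<Sum>i=1..n. \<Sum>x\<in>#Y i \<omega>. q x)"
    unfolding superposition_def by (induction n) (simp_all add: add.commute)
  also have "\<dots> = (\<Sum>i<n. \<Sum>x\<in>#Y (Suc i) \<omega>. q x)"
    by (rule sum.reindex_bij_witness[of _ Suc "\<lambda>i. i - 1"]) auto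
  finally show ?thesis .
qed

text \<open>It suffices to test the generating sets, and point counts add up under
  superposition.\<close>

lemma measurable_superposition:
  assumes "\<And>i. i \<ge> 1 \<Longrightarrow> Y i \<in> measurable P (config S)"
  shows "superposition Y n \<in> measurable P (config S)"
proof -
  have count: "(\<lambda>\<omega>. size (filter_mset (\<lambda>x. x \<in> B) (superposition Y n \<omega>))) \<in> measurable P (count_space UNIV)"
    if B: "B \<in> sets borel" for B
  proof -
    have eq: "size (filter_mset (\<lambda>x. x \<in> B) (superposition Y n \<omega>)) =
      (\<Sum>i=1..n. size (filter_mset (\<lambda>x. x \<in> B) (Y i \<omega>)))" for \<omega>
      unfolding superposition_def by (induction n) simp_all
    show ?thesis
      unfolding eq
      using measurable_compose[OF assms measurable_count_in[OF B]] by measurable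
  qed
  show ?thesis
    unfolding config_def
  proof (rule measurable_measure_of)
    show "superposition Y n \<in> space P \<rightarrow> {Z. set_mset Z \<subseteq> S}"
    proof
      fix \<omega> assume "\<omega> \<in> space P"
      then have "set_mset (Y i \<omega>) \<subseteq> S" if "i \<in> {1..n}" for i
        using measurable_space[OF assms, of i \<omega>] that by (auto simp: space_config)
      then show "superposition Y n \<omega> \<in> {Z. set_mset Z \<subseteq> S}"
        unfolding superposition_def by (fastforce simp: set_mset_sum)
    qed
    fix C assume "C \<in> {{Z. set_mset Z \<subseteq> S \<and> size (filter_mset (\<lambda>x. x \<in> B) Z) = k} |B k. B \<in> sets borel}"
    then obtain B k where B: "B \<in> sets borel"
      and C: "C = {Z. set_mset Z \<subseteq> S \<and> size (filter_mset (\<lambda>x. x \<in> B) Z) = k}" by blast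
    have "superposition Y n -` C \<inter> space P =
      (\<lambda>\<omega>. size (filter_mset (\<lambda>x. x \<in> B) (superposition Y n \<omega>))) -` {k} \<inter> space P"
      using \<open>superposition Y n \<in> space P \<rightarrow> {Z. set_mset Z \<subseteq> S}\<close> by (auto simp: C)
    also have "\<dots> \<in> sets P" using count[OF B] by (rule measurable_sets) simp
    finally show "superposition Y n -` C \<inter> space P \<in> sets P" .
  qed auto
qed

section \<open>Random functions at random arguments, a Taylor bound and fixed points\<close>

lemma measurable_caratheodory:
  fixes F :: "'b::euclidean_space \<Rightarrow> 'c \<Rightarrow> 'd::{real_normed_vector,second_countable_topology}"
  assumes F: "\<And>\<theta>. F \<theta> \<in> borel_measurable M"
    and cont: "\<And>x. x \<in> space M \<Longrightarrow> continuous_on UNIV (\<lambda>\<theta>. F \<theta> x)"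
    and g: "g \<in> borel_measurable M"
  shows "(\<lambda>x. F (g x) x) \<in> borel_measurable M"
proof -
  obtain s where s: "\<And>i. simple_function M (s i)" "\<And>x. x \<in> space M \<Longrightarrow> (\<lambda>i. s i x) \<longlonglongrightarrow> g x"
    using borel_measurable_implies_sequence_metric[OF g, of 0] by blast
  \<comment> \<open>A simple function takes finitely many values, so only sections of
    \<open>F\<close> at fixed parameters enter; continuity in the parameter carries measurability to
    the limit.\<close>
  have "(\<lambda>x. F (s i x) x) \<in> borel_measurable M" for i
  proof (rule measurable_compose_countable'[where I="s i ` space M" and f=F])
    show "s i \<in> measurable M (count_space (s i ` space M))"
      using s(1)[of i] by (auto simp: simple_function_def measurable_count_space_eq2)
    show "countable (s i ` space M)"
      using s(1)[of i] by (simp add: simple_function_def countable_finite)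
  qed (rule F)
  then show ?thesis
  proof (rule borel_measurable_LIMSEQ_metric)
    fix x assume x: "x \<in> space M"
    show "(\<lambda>i. F (s i x) x) \<longlonglongrightarrow> F (g x) x"
      using continuous_on_tendsto_compose[OF cont[OF x] s(2)[OF x]] by simp
  qed
qed

text \<open>The mean value inequality acts twice: on the components of the gradient, to bound their
  variation on the small ball, and then on \<open>\<psi>\<close> minus its linear part at \<theta>0.
  Both points are free in that ball, because a contraction estimate compares arbitrary
  pairs.\<close>

lemma taylor_bound:
  fixes \<psi> :: "real^'m::finite \<Rightarrow> real" and G :: "real^'m \<Rightarrow> real^'m" and H :: "real^'m \<Rightarrow> real^'m^'m"
  assumes \<psi>: "\<And>\<theta>. \<theta> \<in> cball \<theta>0 r \<Longrightarrow> (\<psi> has_derivative (\<lambda>v. G \<theta> \<bullet> v)) (at \<theta>)"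
    and G: "\<And>\<theta> l. \<theta> \<in> cball \<theta>0 r \<Longrightarrow> ((\<lambda>\<theta>. G \<theta> $ l) has_derivative (\<lambda>v. (\<Sum>k\<in>UNIV. H \<theta> $ k $ l * v $ k))) (at \<theta>)"
    and H: "\<And>\<theta> k l. \<theta> \<in> cball \<theta>0 r \<Longrightarrow> \<bar>H \<theta> $ k $ l\<bar> \<le> D k l"
    and \<theta>: "\<theta> \<in> cball \<theta>0 \<delta>" "\<theta>' \<in> cball \<theta>0 \<delta>" and \<delta>: "\<delta> \<le> r"
  shows "\<bar>\<psi> \<theta> - \<psi> \<theta>' - G \<theta>0 \<bullet> (\<theta> - \<theta>')\<bar> \<le> (\<Sum>k\<in>UNIV. \<Sum>l\<in>UNIV. D k l) * \<delta> * norm (\<theta> - \<theta>')"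
proof -
  have sub: "cball \<theta>0 \<delta> \<subseteq> cball \<theta>0 r" using \<delta> by auto
  have \<delta>0: "0 \<le> \<delta>" using \<theta>(1) by (meson dist_not_less_zero mem_cball order_trans zero_le_dist)
  then have \<theta>0: "\<theta>0 \<in> cball \<theta>0 \<delta>" by simp
  have D0: "0 \<le> D k l" for k l using H[of \<theta>0 k l] \<theta>0 sub by force
  have Gdiff: "\<bar>G \<eta> $ l - G \<theta>0 $ l\<bar> \<le> (\<Sum>k\<in>UNIV. D k l) * \<delta>" if \<eta>: "\<eta> \<in> cball \<theta>0 \<delta>" for \<eta> l
  proof -
    have "norm (G \<eta> $ l - G \<theta>0 $ l) \<le> (\<Sum>k\<in>UNIV. D k l) * norm (\<eta> - \<theta>0)"
    proof (rule differentiable_bound[OF convex_cball[of \<theta>0 \<delta>] _ _ \<eta> \<theta>0])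
      fix x assume x: "x \<in> cball \<theta>0 \<delta>"
      show "((\<lambda>\<theta>. G \<theta> $ l) has_derivative (\<lambda>v. (\<Sum>k\<in>UNIV. H x $ k $ l * v $ k))) (at x within cball \<theta>0 \<delta>)"
        by (rule has_derivative_at_withinI[OF G[OF subsetD[OF sub x]]])
      show "onorm (\<lambda>v. (\<Sum>k\<in>UNIV. H x $ k $ l * v $ k)) \<le> (\<Sum>k\<in>UNIV. D k l)"
      proof (rule onorm_le)
        fix v :: "real^'m"
        have "norm (\<Sum>k\<in>UNIV. H x $ k $ l * v $ k) \<le> (\<Sum>k\<in>UNIV. D k l * norm v)"
        proof (rule sum_norm_le)
          fix k
          have "\<bar>H x $ k $ l\<bar> * \<bar>v $ k\<bar> \<le> D k l * norm v"
            using H[OF subsetD[OF sub x]] component_le_norm_cart D0 by (intro mult_mono) auto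
          then show "norm (H x $ k $ l * v $ k) \<le> D k l * norm v" by (simp add: abs_mult)
        qed
        then show "norm (\<Sum>k\<in>UNIV. H x $ k $ l * v $ k) \<le> (\<Sum>k\<in>UNIV. D k l) * norm v"
          by (simp add: sum_distrib_right)
      qed
    qed
    also have "\<dots> \<le> (\<Sum>k\<in>UNIV. D k l) * \<delta>"
      using \<eta> D0 by (intro mult_left_mono sum_nonneg) (auto simp: dist_norm norm_minus_commute)
    finally show ?thesis by simp
  qed
  have "norm ((\<psi> \<theta> - G \<theta>0 \<bullet> \<theta>) - (\<psi> \<theta>' - G \<theta>0 \<bullet> \<theta>')) \<le> ((\<Sum>k\<in>UNIV. \<Sum>l\<in>UNIV. D k l) * \<delta>) * norm (\<theta> - \<theta>')"
  proof (rule differentiable_bound[OF convex_cball[of \<theta>0 \<delta>] _ _ \<theta>])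
    fix x assume x: "x \<in> cball \<theta>0 \<delta>"
    have "(\<psi> has_derivative (\<lambda>v. G x \<bullet> v)) (at x within cball \<theta>0 \<delta>)"
      by (rule has_derivative_at_withinI[OF \<psi>[OF subsetD[OF sub x]]])
    then show "((\<lambda>\<theta>. \<psi> \<theta> - G \<theta>0 \<bullet> \<theta>) has_derivative (\<lambda>v. G x \<bullet> v - G \<theta>0 \<bullet> v)) (at x within cball \<theta>0 \<delta>)"
      by (auto intro!: derivative_eq_intros)
    show "onorm (\<lambda>v. G x \<bullet> v - G \<theta>0 \<bullet> v) \<le> (\<Sum>k\<in>UNIV. \<Sum>l\<in>UNIV. D k l) * \<delta>"
    proof (rule onorm_le)
      fix v :: "real^'m"
      have "norm (G x \<bullet> v - G \<theta>0 \<bullet> v) = norm (\<Sum>l\<in>UNIV. (G x $ l - G \<theta>0 $ l) * v $ l)"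
        by (simp add: inner_vec_def left_diff_distrib sum_subtractf)
      also have "\<dots> \<le> (\<Sum>l\<in>UNIV. ((\<Sum>k\<in>UNIV. D k l) * \<delta>) * norm v)"
      proof (rule sum_norm_le)
        fix l
        have "\<bar>G x $ l - G \<theta>0 $ l\<bar> * \<bar>v $ l\<bar> \<le> ((\<Sum>k\<in>UNIV. D k l) * \<delta>) * norm v"
          by (intro mult_mono Gdiff[OF x] component_le_norm_cart mult_nonneg_nonneg sum_nonneg D0 \<delta>0) simp
        then show "norm ((G x $ l - G \<theta>0 $ l) * v $ l) \<le> ((\<Sum>k\<in>UNIV. D k l) * \<delta>) * norm v"
          by (simp add: abs_mult)
      qed
      also have "\<dots> = (\<Sum>l\<in>UNIV. \<Sum>k\<in>UNIV. D k l) * \<delta> * norm v"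
        by (simp add: sum_distrib_right)
      also have "(\<Sum>l\<in>UNIV. \<Sum>k\<in>UNIV. D k l) = (\<Sum>k\<in>UNIV. \<Sum>l\<in>UNIV. D k l)" by (rule sum.swap)
      finally show "norm (G x \<bullet> v - G \<theta>0 \<bullet> v) \<le> (\<Sum>k\<in>UNIV. \<Sum>l\<in>UNIV. D k l) * \<delta> * norm v" .
    qed
  qed
  then show ?thesis by (simp add: inner_diff_right algebra_simps)
qed

text \<open>The map \<open>\<theta> \<mapsto> \<theta> + A (F \<theta>)\<close> is a contraction of the ball. Clamping to the ball keeps the
  iterates inside it for every \<open>F\<close>, so that their limit is a measurable function of the data.\<close>

primrec newton_iterate ::
    "('v::euclidean_space \<Rightarrow> 'v) \<Rightarrow> 'v \<Rightarrow> real \<Rightarrow> ('v \<Rightarrow> 'v) \<Rightarrow> nat \<Rightarrow> 'v" where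
  "newton_iterate A \<theta>0 \<delta> F 0 = \<theta>0"
| "newton_iterate A \<theta>0 \<delta> F (Suc k) =
     closest_point (cball \<theta>0 \<delta>) (newton_iterate A \<theta>0 \<delta> F k + A (F (newton_iterate A \<theta>0 \<delta> F k)))"

text \<open>The value \<theta>0 for divergent iterates keeps the estimator total and inside the
  ball, also for data whose map is no contraction.\<close>

definition newton_limit ::
    "('v::euclidean_space \<Rightarrow> 'v) \<Rightarrow> 'v \<Rightarrow> real \<Rightarrow> ('v \<Rightarrow> 'v) \<Rightarrow> 'v" where
  "newton_limit A \<theta>0 \<delta> F =
     (if convergent (newton_iterate A \<theta>0 \<delta> F) then lim (newton_iterate A \<theta>0 \<delta> F) else \<theta>0)"

lemma newton_iterate_in: "0 < \<delta> \<Longrightarrow> newton_iterate A \<theta>0 \<delta> F k \<in> cball \<theta>0 \<delta>"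
  by (cases k) (auto intro!: closest_point_in_set simp del: mem_cball)

lemma newton_limit_in:
  assumes "0 < \<delta>" shows "newton_limit A \<theta>0 \<delta> F \<in> cball \<theta>0 \<delta>"
proof (cases "convergent (newton_iterate A \<theta>0 \<delta> F)")
  case True
  then have "newton_iterate A \<theta>0 \<delta> F \<longlonglongrightarrow> lim (newton_iterate A \<theta>0 \<delta> F)"
    by (simp add: convergent_LIMSEQ_iff)
  then have "lim (newton_iterate A \<theta>0 \<delta> F) \<in> cball \<theta>0 \<delta>"
    by (rule Lim_in_closed_set[OF closed_cball always_eventually trivial_limit_sequentially, rotated])
      (simp add: newton_iterate_in[OF assms] del: mem_cball)
  then show ?thesis using True by (simp add: newton_limit_def del: mem_cball)
qed (use assms in \<open>simp add: newton_limit_def\<close>)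

text \<open>The condition at \<theta>0 makes the map send the ball into itself, so that the clamping
  never acts and Banach's theorem applies. The contraction constant 1/2 yields the factor 2 = 1/(1 -
  1/2) in the distance bound; injectivity of \<open>A\<close> turns the fixed point into a
  root.\<close>

lemma newton_limit_root:
  fixes A :: "'v::euclidean_space \<Rightarrow> 'v"
  assumes "0 < \<delta>" and A: "linear A" "inj A"
    and contr: "\<And>\<theta> \<theta>'. \<theta> \<in> cball \<theta>0 \<delta> \<Longrightarrow> \<theta>' \<in> cball \<theta>0 \<delta> \<Longrightarrow>
      norm (A (F \<theta> - F \<theta>') + (\<theta> - \<theta>')) \<le> 1/2 * norm (\<theta> - \<theta>')"
    and start: "norm (A (F \<theta>0)) \<le> \<delta> / 2"
  shows "F (newton_limit A \<theta>0 \<delta> F) = 0"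
    and "norm (newton_limit A \<theta>0 \<delta> F - \<theta>0) \<le> 2 * norm (A (F \<theta>0))"
proof -
  interpret A: linear A by fact
  define B where "B = cball \<theta>0 \<delta>"
  define G where "G \<theta> = \<theta> + A (F \<theta>)" for \<theta>
  have \<theta>0: "\<theta>0 \<in> B" using \<open>0 < \<delta>\<close> by (simp add: B_def)
  have G_contr: "dist (G \<theta>) (G \<theta>') \<le> 1/2 * dist \<theta> \<theta>'" if "\<theta> \<in> B" "\<theta>' \<in> B" for \<theta> \<theta>'
    using contr[of \<theta> \<theta>'] that by (simp add: B_def G_def dist_norm A.diff algebra_simps)
  have G_in: "G \<theta> \<in> B" if "\<theta> \<in> B" for \<theta>
  proof -
    have "dist \<theta>0 (G \<theta>) \<le> dist (G \<theta>) (G \<theta>0) + dist (G \<theta>0) \<theta>0"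
      by (metis dist_commute dist_triangle)
    also have "dist (G \<theta>0) \<theta>0 = norm (A (F \<theta>0))" by (simp add: G_def dist_norm)
    finally show ?thesis using G_contr[OF that \<theta>0] start that by (simp add: B_def dist_commute)
  qed
  have "closed B" by (simp add: B_def)
  then have "\<exists>!x. x \<in> B \<and> G x = x"
    by (rule Banach_fix[OF complete_eq_closed[THEN iffD2], of B "1/2"]) (use \<theta>0 G_in G_contr in auto)
  then obtain x where x: "x \<in> B" "G x = x" by blast
  define t where "t = newton_iterate A \<theta>0 \<delta> F"
  have t_in: "t k \<in> B" for k unfolding t_def B_def using \<open>0 < \<delta>\<close> by (rule newton_iterate_in)
  have t_Suc: "t (Suc k) = G (t k)" for k
    using closest_point_self[OF G_in[OF t_in[of k]]] by (simp add: t_def G_def B_def)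
  \<comment> \<open>Banach's theorem supplies the fixed point; the geometric rate identifies the
    limit of the iterates with it.\<close>
  have rate: "dist (t k) x \<le> (1/2)^k * dist \<theta>0 x" for k
  proof (induction k)
    case (Suc k)
    have "dist (t (Suc k)) x \<le> 1/2 * dist (t k) x"
      unfolding t_Suc using G_contr[OF t_in[of k] x(1)] x(2) by simp
    also have "\<dots> \<le> 1/2 * ((1/2)^k * dist \<theta>0 x)" using Suc by (intro mult_left_mono) auto
    finally show ?case by simp
  qed (simp add: t_def)
  have zero: "(\<lambda>k. (1/2)^k * dist \<theta>0 x) \<longlonglongrightarrow> 0"
    by (intro tendsto_mult_left_zero LIMSEQ_power_zero) simp
  have "(\<lambda>k. dist (t k) x) \<longlonglongrightarrow> 0"
    by (rule tendsto_sandwich[OF _ _ tendsto_const zero]) (simp_all add: rate)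
  then have lim: "t \<longlonglongrightarrow> x" by (rule tendsto_dist_iff[THEN iffD2])
  then have limit: "newton_limit A \<theta>0 \<delta> F = x"
    unfolding newton_limit_def t_def[symmetric] using limI[OF lim] by (auto simp: convergent_def)
  have "A (F x) = A 0" using x(2) by (simp add: G_def A.zero)
  then show "F (newton_limit A \<theta>0 \<delta> F) = 0" unfolding limit by (rule injD[OF A(2)])
  have "dist x \<theta>0 \<le> dist (G x) (G \<theta>0) + dist (G \<theta>0) \<theta>0"
    using x(2) by (metis dist_triangle)
  also have "dist (G \<theta>0) \<theta>0 = norm (A (F \<theta>0))" by (simp add: G_def dist_norm)
  finally show "norm (newton_limit A \<theta>0 \<delta> F - \<theta>0) \<le> 2 * norm (A (F \<theta>0))"
    using G_contr[OF x(1) \<theta>0] by (simp add: limit dist_norm)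
qed

text \<open>Composition with the clamp extends \<open>F z\<close> to a continuous function on the
  whole space, as the Caratheodory argument demands. The second conclusion makes the event that the
  limit is a root measurable.\<close>

lemma newton_limit_measurable:
  fixes A :: "'v::euclidean_space \<Rightarrow> 'v" and F :: "'c \<Rightarrow> 'v \<Rightarrow> 'v"
  assumes "0 < \<delta>" and A: "linear A"
    and F: "\<And>\<theta>. \<theta> \<in> cball \<theta>0 \<delta> \<Longrightarrow> (\<lambda>z. F z \<theta>) \<in> borel_measurable M"
    and cont: "\<And>z. z \<in> space M \<Longrightarrow> continuous_on (cball \<theta>0 \<delta>) (F z)"
  shows "(\<lambda>z. newton_limit A \<theta>0 \<delta> (F z)) \<in> borel_measurable M"
    and "(\<lambda>z. F z (newton_limit A \<theta>0 \<delta> (F z))) \<in> borel_measurable M"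
proof -
  define c where "c = closest_point (cball \<theta>0 \<delta>)"
  have c: "continuous_on UNIV c" "c \<theta> \<in> cball \<theta>0 \<delta>" "\<theta> \<in> cball \<theta>0 \<delta> \<Longrightarrow> c \<theta> = \<theta>" for \<theta>
    unfolding c_def using \<open>0 < \<delta>\<close>
    by (auto intro!: continuous_on_closest_point closest_point_in_set closest_point_self simp del: mem_cball)
  have compose: "(\<lambda>z. F z (g z)) \<in> borel_measurable M"
    if "g \<in> borel_measurable M" "\<And>z. g z \<in> cball \<theta>0 \<delta>" for g
  proof -
    have "(\<lambda>z. F z (c (g z))) \<in> borel_measurable M"
    proof (rule measurable_caratheodory[where F="\<lambda>\<theta> z. F z (c \<theta>)"])
      show "continuous_on UNIV (\<lambda>\<theta>. F z (c \<theta>))" if "z \<in> space M" for z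
        using c by (intro continuous_on_compose2[OF cont[OF that]]) auto
    qed (use F c that in auto)
    then show ?thesis using c(3) that(2) by simp
  qed
  have cm: "c \<in> borel_measurable borel" using c by (intro borel_measurable_continuous_onI)
  have Am: "A \<in> borel_measurable borel"
    using A by (intro borel_measurable_continuous_onI linear_continuous_on) (simp add: linear_conv_bounded_linear)
  have iter[measurable]: "(\<lambda>z. newton_iterate A \<theta>0 \<delta> (F z) k) \<in> borel_measurable M" for k
  proof (induction k)
    case (Suc k)
    note Suc[measurable] compose[OF Suc newton_iterate_in[OF \<open>0 < \<delta>\<close>], measurable]
    show ?case
      unfolding newton_iterate.simps c_def[symmetric]
      by (intro measurable_compose[OF _ cm] borel_measurable_add Suc measurable_compose[OF _ Am]
        compose newton_iterate_in \<open>0 < \<delta>\<close>)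
  qed simp
  \<comment> \<open>Convergence is expressed by the Cauchy condition, a countable combination of
    measurable conditions.\<close>
  show m: "(\<lambda>z. newton_limit A \<theta>0 \<delta> (F z)) \<in> borel_measurable M"
    unfolding newton_limit_def Cauchy_convergent_iff[symmetric] by measurable
  show "(\<lambda>z. F z (newton_limit A \<theta>0 \<delta> (F z))) \<in> borel_measurable M"
    using m newton_limit_in[OF \<open>0 < \<delta>\<close>] by (rule compose)
qed

section \<open>Convergence in probability\<close>

text \<open>The estimates for the estimator hold only on good events of probability tending to one
  and for positive \<open>n\<close>, since normalisation by \<open>n\<close> degenerates at
  0.\<close>

lemma (in prob_space) vanish_mono:
  fixes X :: "nat \<Rightarrow> 'a \<Rightarrow> 'b::real_normed_vector" and Y :: "nat \<Rightarrow> 'a \<Rightarrow> real"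
  assumes Y: "converges_in_probability M Y 0" and [measurable]: "\<And>n. Y n \<in> borel_measurable M"
    and G: "\<And>n. G n \<in> events" "(\<lambda>n. prob (space M - G n)) \<longlonglongrightarrow> 0"
    and le: "\<And>n \<omega>. 0 < n \<Longrightarrow> \<omega> \<in> G n \<Longrightarrow> norm (X n \<omega> - c) \<le> \<bar>Y n \<omega>\<bar>"
  shows "converges_in_probability M X c"
  unfolding converges_in_probability_def
proof (intro allI impI)
  fix \<epsilon> :: real assume "0 < \<epsilon>"
  let ?y = "\<lambda>n. prob {\<omega>\<in>space M. dist (Y n \<omega>) 0 > \<epsilon>}"
  have "(\<lambda>n. ?y n + prob (space M - G n)) \<longlonglongrightarrow> 0 + 0"
    using Y \<open>0 < \<epsilon>\<close> G(2) unfolding converges_in_probability_def by (intro tendsto_add) auto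
  then have lim: "(\<lambda>n. ?y n + prob (space M - G n)) \<longlonglongrightarrow> 0" by simp
  show "(\<lambda>n. prob {\<omega>\<in>space M. dist (X n \<omega>) c > \<epsilon>}) \<longlonglongrightarrow> 0"
  proof (rule tendsto_sandwich[OF _ _ tendsto_const lim])
    show "\<forall>\<^sub>F n in sequentially. prob {\<omega>\<in>space M. dist (X n \<omega>) c > \<epsilon>} \<le> ?y n + prob (space M - G n)"
      using eventually_gt_at_top[of 0]
    proof eventually_elim
      case (elim n)
      have "prob {\<omega>\<in>space M. dist (X n \<omega>) c > \<epsilon>} \<le>
          prob ({\<omega>\<in>space M. dist (Y n \<omega>) 0 > \<epsilon>} \<union> (space M - G n))"
      proof (rule finite_measure_mono)
        show "{\<omega>\<in>space M. dist (X n \<omega>) c > \<epsilon>} \<subseteq> {\<omega>\<in>space M. dist (Y n \<omega>) 0 > \<epsilon>} \<union> (space M - G n)"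
          using le[OF elim] by (auto simp: dist_norm) (meson less_le_trans)
      qed (use G in measurable)
      also have "\<dots> \<le> ?y n + prob (space M - G n)"
        using G by (intro measure_Un_le) auto
      finally show ?case .
    qed
  qed simp
qed

lemma (in prob_space) vanish_add:
  fixes X Y :: "nat \<Rightarrow> 'a \<Rightarrow> real"
  assumes X: "converges_in_probability M X 0" and Y: "converges_in_probability M Y 0"
    and [measurable]: "\<And>n. X n \<in> borel_measurable M" "\<And>n. Y n \<in> borel_measurable M"
  shows "converges_in_probability M (\<lambda>n \<omega>. X n \<omega> + Y n \<omega>) 0"
  unfolding converges_in_probability_def
proof (intro allI impI)
  fix \<epsilon> :: real assume "0 < \<epsilon>"
  let ?p = "\<lambda>X n. prob {\<omega>\<in>space M. dist (X n \<omega>) (0::real) > \<epsilon> / 2}"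
  have "(\<lambda>n. ?p X n + ?p Y n) \<longlonglongrightarrow> 0 + 0"
    by (intro tendsto_add X[unfolded converges_in_probability_def, rule_format]
      Y[unfolded converges_in_probability_def, rule_format] half_gt_zero \<open>0 < \<epsilon>\<close>)
  then have lim: "(\<lambda>n. ?p X n + ?p Y n) \<longlonglongrightarrow> 0" by simp
  have "prob {\<omega>\<in>space M. dist (X n \<omega> + Y n \<omega>) 0 > \<epsilon>} \<le> ?p X n + ?p Y n" for n
  proof -
    have "prob {\<omega>\<in>space M. dist (X n \<omega> + Y n \<omega>) 0 > \<epsilon>} \<le>
      prob ({\<omega>\<in>space M. dist (X n \<omega>) 0 > \<epsilon> / 2} \<union> {\<omega>\<in>space M. dist (Y n \<omega>) 0 > \<epsilon> / 2})"
      by (intro finite_measure_mono) auto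
    also have "\<dots> \<le> ?p X n + ?p Y n" by (intro measure_Un_le) auto
    finally show ?thesis .
  qed
  then show "(\<lambda>n. prob {\<omega>\<in>space M. dist (X n \<omega> + Y n \<omega>) 0 > \<epsilon>}) \<longlonglongrightarrow> 0"
    by (intro tendsto_sandwich[OF _ _ tendsto_const lim]) simp_all
qed

lemma (in prob_space) vanish_sum:
  fixes X :: "'i \<Rightarrow> nat \<Rightarrow> 'a \<Rightarrow> real"
  assumes "finite I" "\<And>i. i \<in> I \<Longrightarrow> converges_in_probability M (X i) 0"
    and "\<And>i n. i \<in> I \<Longrightarrow> X i n \<in> borel_measurable M"
  shows "converges_in_probability M (\<lambda>n \<omega>. \<Sum>i\<in>I. X i n \<omega>) 0"
  using assms
proof (induction I)
  case (insert i I)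
  have "(\<lambda>\<omega>. \<Sum>i\<in>I. X i n \<omega>) \<in> borel_measurable M" for n using insert.prems by simp
  with insert show ?case by (simp add: vanish_add)
qed (simp add: converges_in_probability_def)

lemma vanish_abs: "converges_in_probability M X 0 \<Longrightarrow> converges_in_probability M (\<lambda>n \<omega>. \<bar>X n \<omega> :: real\<bar>) 0"
  by (simp add: converges_in_probability_def)

lemma vanish_cmult:
  assumes X: "converges_in_probability M X (0::real)"
  shows "converges_in_probability M (\<lambda>n \<omega>. c * X n \<omega>) 0"
proof (cases "c = 0")
  case False
  have "{\<omega>\<in>space M. dist (c * X n \<omega>) 0 > \<epsilon>} = {\<omega>\<in>space M. dist (X n \<omega>) 0 > \<epsilon> / \<bar>c\<bar>}" for n \<epsilon>
    using False by (auto simp: abs_mult field_simps)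
  then show ?thesis using X False by (simp add: converges_in_probability_def)
qed (simp add: converges_in_probability_def)

lemma (in prob_space) prob_abs_gt_le_second_moment:
  fixes X :: "'a \<Rightarrow> real"
  assumes [measurable]: "X \<in> borel_measurable M" and int: "integrable M (\<lambda>\<omega>. (X \<omega>)\<^sup>2)" and "0 < k"
  shows "prob {\<omega>\<in>space M. \<bar>X \<omega>\<bar> > k} \<le> expectation (\<lambda>\<omega>. (X \<omega>)\<^sup>2) / k\<^sup>2"
proof -
  have "{\<omega>\<in>space M. \<bar>X \<omega>\<bar> > k} = {\<omega>\<in>space M. \<bar>(X \<omega>)\<^sup>2\<bar> > k\<^sup>2}"
    using \<open>0 < k\<close> by (auto simp: abs_le_square_iff[of _ k, symmetric] not_le[symmetric])
  then show ?thesis using prob_abs_gt_le_expectation[OF int, of "k\<^sup>2"] \<open>0 < k\<close> by simp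
qed

lemma (in prob_space) vanish_second_moment:
  fixes X :: "nat \<Rightarrow> 'a \<Rightarrow> real"
  assumes [measurable]: "\<And>n. X n \<in> borel_measurable M" and int: "\<And>n. integrable M (\<lambda>\<omega>. (X n \<omega>)\<^sup>2)"
    and le: "\<And>n. 0 < n \<Longrightarrow> expectation (\<lambda>\<omega>. (X n \<omega>)\<^sup>2) \<le> C / real n"
  shows "converges_in_probability M X 0"
  unfolding converges_in_probability_def
proof (intro allI impI)
  fix \<epsilon> :: real assume "0 < \<epsilon>"
  have lim: "(\<lambda>n. C / real n / \<epsilon>\<^sup>2) \<longlonglongrightarrow> 0"
    using lim_const_over_n[of C] by (rule tendsto_divide_zero)
  show "(\<lambda>n. prob {\<omega>\<in>space M. dist (X n \<omega>) 0 > \<epsilon>}) \<longlonglongrightarrow> 0"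
  proof (rule tendsto_sandwich[OF _ _ tendsto_const lim])
    show "\<forall>\<^sub>F n in sequentially. prob {\<omega>\<in>space M. dist (X n \<omega>) 0 > \<epsilon>} \<le> C / real n / \<epsilon>\<^sup>2"
      using eventually_gt_at_top[of 0]
    proof eventually_elim
      case (elim n)
      have "prob {\<omega>\<in>space M. dist (X n \<omega>) 0 > \<epsilon>} \<le> expectation (\<lambda>\<omega>. (X n \<omega>)\<^sup>2) / \<epsilon>\<^sup>2"
        using prob_abs_gt_le_second_moment[OF _ int \<open>0 < \<epsilon>\<close>, of n] by simp
      also have "\<dots> \<le> C / real n / \<epsilon>\<^sup>2" using le[OF elim] by (intro divide_right_mono) auto
      finally show ?case .
    qed
  qed simp
qed

text \<open>Bounded second moments keep \<open>X\<close> below a level \<open>k\<close> up to a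
  small probability, uniformly in \<open>n\<close>; below it the product is small once
  \<open>Y\<close> is at most \<epsilon>/k. This handles the linearisation error after
  multiplication by the square root of \<open>n\<close>.\<close>

lemma (in prob_space) vanish_mult_tight:
  fixes X Y :: "nat \<Rightarrow> 'a \<Rightarrow> real"
  assumes Y: "converges_in_probability M Y 0"
    and [measurable]: "\<And>n. X n \<in> borel_measurable M" "\<And>n. Y n \<in> borel_measurable M"
    and int: "\<And>n. integrable M (\<lambda>\<omega>. (X n \<omega>)\<^sup>2)" and le: "\<And>n. expectation (\<lambda>\<omega>. (X n \<omega>)\<^sup>2) \<le> C"
  shows "converges_in_probability M (\<lambda>n \<omega>. Y n \<omega> * X n \<omega>) 0"
  unfolding converges_in_probability_def
proof (intro allI impI)
  fix \<epsilon> :: real assume "0 < \<epsilon>"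
  show "(\<lambda>n. prob {\<omega>\<in>space M. dist (Y n \<omega> * X n \<omega>) 0 > \<epsilon>}) \<longlonglongrightarrow> 0"
  proof (rule LIMSEQ_I)
    fix r :: real assume "0 < r"
    \<comment> \<open>Makes the Chebyshev bound smaller than r/2; the added 1 keeps \<open>k\<close>
      positive.\<close>
    define k where "k = sqrt (2 * (\<bar>C\<bar> + 1) / r)"
    have k: "0 < k" "k\<^sup>2 = 2 * (\<bar>C\<bar> + 1) / r" using \<open>0 < r\<close> by (auto simp: k_def)
    have Ck: "\<bar>C\<bar> / k\<^sup>2 < r / 2"
      using \<open>0 < r\<close> unfolding k(2) by (simp add: field_simps)
    have "(\<lambda>n. prob {\<omega>\<in>space M. dist (Y n \<omega>) 0 > \<epsilon> / k}) \<longlonglongrightarrow> 0"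
      using Y k \<open>0 < \<epsilon>\<close> by (simp add: converges_in_probability_def)
    from order_tendstoD(2)[OF this, of "r / 2"] \<open>0 < r\<close> obtain N
      where N: "\<And>n. N \<le> n \<Longrightarrow> prob {\<omega>\<in>space M. dist (Y n \<omega>) 0 > \<epsilon> / k} < r / 2"
      by (auto simp: eventually_sequentially)
    have "prob {\<omega>\<in>space M. dist (Y n \<omega> * X n \<omega>) 0 > \<epsilon>} < r" if "N \<le> n" for n
    proof -
      have "prob {\<omega>\<in>space M. dist (Y n \<omega> * X n \<omega>) 0 > \<epsilon>} \<le>
        prob ({\<omega>\<in>space M. \<bar>X n \<omega>\<bar> > k} \<union> {\<omega>\<in>space M. dist (Y n \<omega>) 0 > \<epsilon> / k})"
      proof (rule finite_measure_mono, safe)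
        fix \<omega> assume *: "\<epsilon> < dist (Y n \<omega> * X n \<omega>) 0" "\<not> \<epsilon> / k < dist (Y n \<omega>) 0"
        show "k < \<bar>X n \<omega>\<bar>"
        proof (rule ccontr)
          assume "\<not> k < \<bar>X n \<omega>\<bar>"
          then have "\<bar>Y n \<omega>\<bar> * \<bar>X n \<omega>\<bar> \<le> \<epsilon> / k * k"
            using * k by (intro mult_mono) auto
          then show False using * k by (simp add: abs_mult)
        qed
      qed measurable
      also have "\<dots> \<le> prob {\<omega>\<in>space M. \<bar>X n \<omega>\<bar> > k} + prob {\<omega>\<in>space M. dist (Y n \<omega>) 0 > \<epsilon> / k}"
        by (intro measure_Un_le) auto
      also have "prob {\<omega>\<in>space M. \<bar>X n \<omega>\<bar> > k} \<le> expectation (\<lambda>\<omega>. (X n \<omega>)\<^sup>2) / k\<^sup>2"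
        by (rule prob_abs_gt_le_second_moment[OF _ int k(1)]) simp
      also have "\<dots> \<le> \<bar>C\<bar> / k\<^sup>2" using le[of n] by (intro divide_right_mono) auto
      finally show ?thesis using Ck N[OF that] by linarith
    qed
    then show "\<exists>N. \<forall>n\<ge>N. norm (prob {\<omega>\<in>space M. dist (Y n \<omega> * X n \<omega>) 0 > \<epsilon>} - 0) < r"
      by auto
  qed
qed

lemma (in prob_space) prob_complement_Int_vanish:
  assumes "\<And>n. A n \<in> events" "\<And>n. B n \<in> events"
    and "(\<lambda>n. prob (space M - A n)) \<longlonglongrightarrow> 0" "(\<lambda>n. prob (space M - B n)) \<longlonglongrightarrow> 0"
  shows "(\<lambda>n. prob (space M - A n \<inter> B n)) \<longlonglongrightarrow> 0"
proof -
  have lim: "(\<lambda>n. prob (space M - A n) + prob (space M - B n)) \<longlonglongrightarrow> 0"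
    using tendsto_add[OF assms(3,4)] by simp
  have "prob (space M - A n \<inter> B n) \<le> prob (space M - A n) + prob (space M - B n)" for n
    unfolding Diff_Int using assms(1,2) by (intro measure_Un_le) auto
  then show ?thesis by (intro tendsto_sandwich[OF _ _ tendsto_const lim]) simp_all
qed

lemma (in prob_space) prob_complement_le_vanish:
  fixes X :: "nat \<Rightarrow> 'a \<Rightarrow> real"
  assumes X: "converges_in_probability M X c" and "c < k"
    and [measurable]: "\<And>n. X n \<in> borel_measurable M"
  shows "(\<lambda>n. prob (space M - {\<omega>\<in>space M. X n \<omega> \<le> k})) \<longlonglongrightarrow> 0"
proof -
  have lim: "(\<lambda>n. prob {\<omega>\<in>space M. dist (X n \<omega>) c > (k - c) / 2}) \<longlonglongrightarrow> 0"
    by (rule X[unfolded converges_in_probability_def, rule_format]) (use \<open>c < k\<close> in simp)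
  have "prob (space M - {\<omega>\<in>space M. X n \<omega> \<le> k}) \<le> prob {\<omega>\<in>space M. dist (X n \<omega>) c > (k - c) / 2}" for n
    using \<open>c < k\<close> by (intro finite_measure_mono) (auto simp: dist_real_def abs_if field_simps)
  then show ?thesis by (intro tendsto_sandwich[OF _ _ tendsto_const lim]) simp_all
qed

section \<open>Roots of random estimating equations\<close>

lemma inner_matrix_vector_transpose: "x \<bullet> (A *v y) = (transpose A *v x) \<bullet> y" for A :: "real^'n^'m"
  by (simp add: dot_lmul_matrix transpose_matrix_vector)

text \<open>All that is used of the model: a first-order expansion of the score with matrix
  \<open>J n\<close> and modulus \<open>L n\<close>, laws of large numbers for both, second moments
  of order \<open>n\<close> at \<theta>0, and a scalar central limit theorem. The expansion is
  demanded for every radius \<delta> up to \<open>r\<close>, because it serves on the fixed ball and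
  again at the random distance of the estimator from \<theta>0.\<close>

theorem z_estimator_asymptotics:
  fixes sc :: "'z \<Rightarrow> real^'m \<Rightarrow> real^'m" and X :: "nat \<Rightarrow> 'w \<Rightarrow> 'z"
    and J :: "nat \<Rightarrow> 'w \<Rightarrow> real^'m^'m" and L :: "nat \<Rightarrow> 'w \<Rightarrow> real" and U V :: "real^'m^'m"
  assumes P: "prob_space P" and r: "0 < r" "cball \<theta>0 r \<subseteq> \<Theta>"
    and X[measurable]: "\<And>n. X n \<in> measurable P N"
    and sc_meas: "\<And>\<theta>. \<theta> \<in> cball \<theta>0 r \<Longrightarrow> (\<lambda>z. sc z \<theta>) \<in> borel_measurable N"
    and sc_cont: "\<And>z. z \<in> space N \<Longrightarrow> continuous_on (cball \<theta>0 r) (sc z)"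
    and J_meas[measurable]: "\<And>n i l. (\<lambda>\<omega>. J n \<omega> $ i $ l) \<in> borel_measurable P"
    and L_meas[measurable]: "\<And>n. L n \<in> borel_measurable P"
    and expansion: "\<And>n \<omega> \<theta> \<theta>' \<delta> i. \<omega> \<in> space P \<Longrightarrow> \<delta> \<le> r \<Longrightarrow> \<theta> \<in> cball \<theta>0 \<delta> \<Longrightarrow> \<theta>' \<in> cball \<theta>0 \<delta> \<Longrightarrow>
      \<bar>sc (X n \<omega>) \<theta> $ i - sc (X n \<omega>) \<theta>' $ i - (\<Sum>l\<in>UNIV. J n \<omega> $ i $ l * (\<theta> - \<theta>') $ l)\<bar> \<le> L n \<omega> * \<delta> * norm (\<theta> - \<theta>')"
    and J_lim: "\<And>i l. converges_in_probability P (\<lambda>n \<omega>. J n \<omega> $ i $ l / real n) (- (U $ i $ l))"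
    and L_lim: "converges_in_probability P (\<lambda>n \<omega>. L n \<omega> / real n) q"
    and int_sq: "\<And>n i. integrable P (\<lambda>\<omega>. (sc (X n \<omega>) \<theta>0 $ i)\<^sup>2)"
    and sq_le: "\<And>n i. (\<integral>\<omega>. (sc (X n \<omega>) \<theta>0 $ i)\<^sup>2 \<partial>P) \<le> real n * v i"
    and U: "invertible U"
    and clt: "\<And>c t. (\<lambda>n. char (distr P borel (\<lambda>\<omega>. (c \<bullet> sc (X n \<omega>) \<theta>0) / sqrt (real n))) t)
      \<longlonglongrightarrow> complex_of_real (exp (- (t\<^sup>2 * (c \<bullet> (V *v c))) / 2))"
    and V: "transpose V = V" "\<And>c. 0 \<le> c \<bullet> (V *v c)"
  shows "\<exists>\<tau>. (\<forall>n. \<tau> n \<in> measurable N (restrict_space borel \<Theta>)) \<and>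
    (\<lambda>n. measure P {\<omega>\<in>space P. sc (X n \<omega>) (\<tau> n (X n \<omega>)) = 0}) \<longlonglongrightarrow> 1 \<and>
    converges_in_probability P (\<lambda>n \<omega>. \<tau> n (X n \<omega>)) \<theta>0 \<and>
    (\<exists>\<nu>. multivariate_normal 0 (matrix_inv U ** V ** transpose (matrix_inv U)) \<nu> \<and>
      converges_in_distribution P (\<lambda>n \<omega>. sqrt (real n) *\<^sub>R (\<tau> n (X n \<omega>) - \<theta>0)) \<nu>)"
proof -
  interpret prob_space P by (rule P)
  define Ui where "Ui = matrix_inv U"
  have UiU: "Ui ** U = mat 1" and UUi: "U ** Ui = mat 1"
    using someI_ex[OF U[unfolded invertible_def]] by (simp_all add: Ui_def matrix_inv_def)
  obtain K where K: "0 < K" "\<And>x. norm (Ui *v x) \<le> norm x * K"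
    using bounded_linear.pos_bounded[OF matrix_vector_mul_bounded_linear[of Ui]] by blast
  \<comment> \<open>The factor 1/n sits in the linear map, so the fixed point lemmas apply to the
    score without normalisation.\<close>
  define A where "A n x = (1 / real n) *\<^sub>R (Ui *v x)" for n :: nat and x
  have A_lin: "linear (A n)" for n
    unfolding A_def by (rule linear_compose_scale_right) (rule matrix_vector_mul_linear)
  have A_inj: "inj (A n)" if "0 < n" for n
  proof (rule injI)
    fix x y assume "A n x = A n y"
    then have "Ui *v x = Ui *v y" using that by (simp add: A_def)
    then have "U *v (Ui *v x) = U *v (Ui *v y)" by simp
    then show "x = y" by (simp add: matrix_vector_mul_assoc UUi)
  qed
  define m where "m = real CARD('m)"
  have m: "0 < m" by (simp add: m_def)
  define W where "W n \<omega> = (\<Sum>i\<in>UNIV. \<Sum>l\<in>UNIV. \<bar>J n \<omega> $ i $ l / real n + U $ i $ l\<bar>)" for n \<omega>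
  have [measurable]: "W n \<in> borel_measurable P" for n unfolding W_def[abs_def] by measurable
  have W_lim: "converges_in_probability P W 0"
    unfolding W_def
  proof (intro vanish_sum vanish_abs)
    fix i l :: 'm
    show "converges_in_probability P (\<lambda>n \<omega>. J n \<omega> $ i $ l / real n + U $ i $ l) 0"
      using J_lim[of i l] by (simp add: converges_in_probability_def dist_real_def)
  qed auto
  define s where "s n \<omega> \<theta> = sc (X n \<omega>) \<theta>" for n \<omega> \<theta>
  \<comment> \<open>Since \<open>Ui\<close> inverts \<open>U\<close>, the summand \<theta> -
    \<theta>' is \<open>Ui\<close> applied to \<open>U *v (\<theta> - \<theta>')\<close>. It cancels
    the linear part of the score up to \<open>J n \<omega>\<close> divided by \<open>n\<close>, plus
    \<open>U\<close>, an error that \<open>W n \<omega>\<close> measures entrywise.\<close>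
  have bound: "norm (A n (s n \<omega> \<theta> - s n \<omega> \<theta>') + (\<theta> - \<theta>')) \<le>
      K * (m * \<delta> * (L n \<omega> / real n) + W n \<omega>) * norm (\<theta> - \<theta>')"
    if "0 < n" "\<omega> \<in> space P" "\<delta> \<le> r" "\<theta> \<in> cball \<theta>0 \<delta>" "\<theta>' \<in> cball \<theta>0 \<delta>" for n \<omega> \<delta> \<theta> \<theta>'
  proof -
    define w where "w = (1 / real n) *\<^sub>R (s n \<omega> \<theta> - s n \<omega> \<theta>') + U *v (\<theta> - \<theta>')"
    have "A n (s n \<omega> \<theta> - s n \<omega> \<theta>') + (\<theta> - \<theta>') = Ui *v w"
      by (simp add: w_def A_def matrix_vector_right_distrib matrix_vector_mul_assoc UiU matrix_vector_mult_scaleR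
        del: matrix_vector_mult_diff_distrib)
    then have "norm (A n (s n \<omega> \<theta> - s n \<omega> \<theta>') + (\<theta> - \<theta>')) \<le> norm w * K" using K(2)[of w] by simp
    also have "norm w \<le> (\<Sum>i\<in>UNIV. \<bar>w $ i\<bar>)" by (rule norm_le_l1_cart)
    also have "\<dots> \<le> (\<Sum>i\<in>UNIV. \<delta> * (L n \<omega> / real n) * norm (\<theta> - \<theta>') +
        (\<Sum>l\<in>UNIV. \<bar>J n \<omega> $ i $ l / real n + U $ i $ l\<bar>) * norm (\<theta> - \<theta>'))"
    proof (rule sum_mono)
      fix i
      let ?R = "s n \<omega> \<theta> $ i - s n \<omega> \<theta>' $ i - (\<Sum>l\<in>UNIV. J n \<omega> $ i $ l * (\<theta> - \<theta>') $ l)"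
      let ?S = "\<Sum>l\<in>UNIV. (J n \<omega> $ i $ l / real n + U $ i $ l) * (\<theta> - \<theta>') $ l"
      have "(\<Sum>l\<in>UNIV. J n \<omega> $ i $ l / real n * (\<theta> - \<theta>') $ l) = (\<Sum>l\<in>UNIV. J n \<omega> $ i $ l * (\<theta> - \<theta>') $ l) / real n"
        unfolding sum_divide_distrib by (intro sum.cong refl) simp
      then have w_eq: "w $ i = ?R / real n + ?S"
        by (simp add: w_def matrix_vector_mult_def distrib_right sum.distrib diff_divide_distrib)
      have "\<bar>w $ i\<bar> \<le> \<bar>?R\<bar> / real n + \<bar>?S\<bar>"
        unfolding w_eq using abs_triangle_ineq[of "?R / real n" ?S] by (simp only: abs_divide abs_of_nat)
      moreover have "\<bar>?R\<bar> / real n \<le> L n \<omega> * \<delta> * norm (\<theta> - \<theta>') / real n"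
        unfolding s_def using that by (intro divide_right_mono expansion) auto
      moreover have "\<bar>?S\<bar> \<le> (\<Sum>l\<in>UNIV. \<bar>J n \<omega> $ i $ l / real n + U $ i $ l\<bar> * norm (\<theta> - \<theta>'))"
        by (intro order_trans[OF sum_abs] sum_mono) (simp only: abs_mult mult_left_mono component_le_norm_cart abs_ge_zero)
      ultimately show "\<bar>w $ i\<bar> \<le> \<delta> * (L n \<omega> / real n) * norm (\<theta> - \<theta>') +
        (\<Sum>l\<in>UNIV. \<bar>J n \<omega> $ i $ l / real n + U $ i $ l\<bar>) * norm (\<theta> - \<theta>')"
        unfolding sum_distrib_right[symmetric] by (simp add: mult_ac)
    qed
    also have "\<dots> = (m * \<delta> * (L n \<omega> / real n) + W n \<omega>) * norm (\<theta> - \<theta>')"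
      unfolding W_def by (simp add: sum.distrib sum_distrib_right distrib_right m_def mult.assoc)
    finally show ?thesis using K(1) by (simp add: mult_ac mult_right_mono)
  qed
  \<comment> \<open>A positive level strictly above the limit \<open>q\<close>, which the normalised
    moduli respect with probability tending to one.\<close>
  define q0 where "q0 = \<bar>q\<bar> + 1"
  have q0: "0 < q0" "q < q0" by (auto simp: q0_def)
  \<comment> \<open>With this deterministic radius the modulus contributes at most 1/4 to the
    contraction constant on the good event; the error \<open>W\<close> of the derivative contributes
    the other 1/4.\<close>
  define \<delta> where "\<delta> = min r (1 / (4 * K * m * q0))"
  have \<delta>: "0 < \<delta>" "\<delta> \<le> r" using r K m q0 by (auto simp: \<delta>_def)
  have "\<delta> \<le> 1 / (4 * K * m * q0)" by (simp add: \<delta>_def)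
  then have \<delta>_le: "K * (m * \<delta> * q0) \<le> 1/4"
    using K m q0 by (simp add: field_simps)
  have sub: "cball \<theta>0 \<delta> \<subseteq> cball \<theta>0 r" using \<delta> by auto
  have s_meas[measurable]: "(\<lambda>\<omega>. s n \<omega> \<theta>0) \<in> borel_measurable P" for n
    unfolding s_def using r by (intro measurable_compose[OF X sc_meas]) auto
  have A_cont: "continuous_on UNIV (A n)" for n
    using A_lin by (intro linear_continuous_on) (simp add: linear_conv_bounded_linear)
  have A_meas[measurable]: "A n \<in> borel_measurable borel" for n
    using A_cont by (rule borel_measurable_continuous_onI)
  \<comment> \<open>The length of the first step of the iteration. Its second moment is of order
    1/n, which gives both consistency and the rate.\<close>
  define b where "b n \<omega> = norm (A n (s n \<omega> \<theta>0))" for n \<omega>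
  have [measurable]: "b n \<in> borel_measurable P" for n unfolding b_def[abs_def] by measurable
  have b_sq: "(b n \<omega>)\<^sup>2 \<le> K\<^sup>2 / (real n)\<^sup>2 * (\<Sum>i\<in>UNIV. (s n \<omega> \<theta>0 $ i)\<^sup>2)" for n \<omega>
  proof -
    have "b n \<omega> \<le> K / real n * norm (s n \<omega> \<theta>0)"
      using K(2)[of "s n \<omega> \<theta>0"] by (simp add: b_def A_def divide_right_mono mult.commute)
    then have "(b n \<omega>)\<^sup>2 \<le> (K / real n * norm (s n \<omega> \<theta>0))\<^sup>2" by (intro power_mono) (auto simp: b_def)
    also have "\<dots> = K\<^sup>2 / (real n)\<^sup>2 * (\<Sum>i\<in>UNIV. (s n \<omega> \<theta>0 $ i)\<^sup>2)"
      unfolding power_mult_distrib power2_norm_eq_inner inner_vec_def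
      by (simp add: power_divide power2_eq_square)
    finally show ?thesis .
  qed
  have int_s: "integrable P (\<lambda>\<omega>. (s n \<omega> \<theta>0 $ i)\<^sup>2)" for n i unfolding s_def by (rule int_sq)
  have int_b: "integrable P (\<lambda>\<omega>. (b n \<omega>)\<^sup>2)" for n
  proof (rule Bochner_Integration.integrable_bound)
    show "integrable P (\<lambda>\<omega>. K\<^sup>2 / (real n)\<^sup>2 * (\<Sum>i\<in>UNIV. (s n \<omega> \<theta>0 $ i)\<^sup>2))"
      by (intro integrable_mult_right Bochner_Integration.integrable_sum int_s)
    show "AE \<omega> in P. norm ((b n \<omega>)\<^sup>2) \<le> norm (K\<^sup>2 / (real n)\<^sup>2 * (\<Sum>i\<in>UNIV. (s n \<omega> \<theta>0 $ i)\<^sup>2))"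
      using b_sq by (intro AE_I2) (simp add: sum_nonneg)
  qed measurable
  define C where "C = K\<^sup>2 * (\<Sum>i\<in>UNIV. \<bar>v i\<bar>)"
  have "0 \<le> C" by (simp add: C_def sum_nonneg)
  have E_b: "expectation (\<lambda>\<omega>. (b n \<omega>)\<^sup>2) \<le> C / real n" if "0 < n" for n
  proof -
    have "expectation (\<lambda>\<omega>. (b n \<omega>)\<^sup>2) \<le> expectation (\<lambda>\<omega>. K\<^sup>2 / (real n)\<^sup>2 * (\<Sum>i\<in>UNIV. (s n \<omega> \<theta>0 $ i)\<^sup>2))"
      by (intro integral_mono int_b b_sq integrable_mult_right Bochner_Integration.integrable_sum int_s)
    also have "\<dots> = K\<^sup>2 / (real n)\<^sup>2 * (\<Sum>i\<in>UNIV. expectation (\<lambda>\<omega>. (s n \<omega> \<theta>0 $ i)\<^sup>2))"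
      using int_s by (simp add: Bochner_Integration.integral_sum)
    also have "\<dots> \<le> K\<^sup>2 / (real n)\<^sup>2 * (\<Sum>i\<in>UNIV. real n * \<bar>v i\<bar>)"
    proof (intro mult_left_mono sum_mono)
      fix i
      have "expectation (\<lambda>\<omega>. (s n \<omega> \<theta>0 $ i)\<^sup>2) \<le> real n * v i" unfolding s_def by (rule sq_le)
      also have "\<dots> \<le> real n * \<bar>v i\<bar>" by (intro mult_left_mono) auto
      finally show "expectation (\<lambda>\<omega>. (s n \<omega> \<theta>0 $ i)\<^sup>2) \<le> real n * \<bar>v i\<bar>" .
    qed simp
    also have "\<dots> = C / real n"
      using that by (simp add: C_def sum_distrib_left[symmetric] power2_eq_square)
    finally show ?thesis .
  qed
  have b_lim: "converges_in_probability P b 0"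
    by (rule vanish_second_moment[OF _ int_b E_b]) measurable
  \<comment> \<open>In turn: the modulus, the error of the derivative, and the starting condition of
    the fixed point lemma.\<close>
  define G where "G n = {\<omega>\<in>space P. L n \<omega> / real n \<le> q0} \<inter>
    ({\<omega>\<in>space P. W n \<omega> \<le> 1 / (4 * K)} \<inter> {\<omega>\<in>space P. b n \<omega> \<le> \<delta> / 2})" for n
  have G_sets[measurable]: "G n \<in> sets P" for n unfolding G_def by measurable
  have G_lim: "(\<lambda>n. prob (space P - G n)) \<longlonglongrightarrow> 0"
  proof -
    have "0 < 1 / (4 * K)" "0 < \<delta> / 2" using K \<delta> by simp_all
    then show ?thesis
      unfolding G_def
      by (intro prob_complement_Int_vanish prob_complement_le_vanish[OF L_lim q0(2)]
           prob_complement_le_vanish[OF W_lim] prob_complement_le_vanish[OF b_lim]) simp_all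
  qed
  define \<tau> where "\<tau> n z = newton_limit (A n) \<theta>0 \<delta> (sc z)" for n z
  define \<theta>h where "\<theta>h n \<omega> = \<tau> n (X n \<omega>)" for n \<omega>
  have \<tau>_in: "\<tau> n z \<in> cball \<theta>0 \<delta>" for n z unfolding \<tau>_def by (rule newton_limit_in) (rule \<delta>)
  have sc_cont': "continuous_on (cball \<theta>0 \<delta>) (sc z)" if "z \<in> space N" for z
    using sc_cont[OF that] sub by (rule continuous_on_subset)
  have \<tau>_meas[measurable]: "\<tau> n \<in> borel_measurable N" and root_meas[measurable]: "(\<lambda>z. sc z (\<tau> n z)) \<in> borel_measurable N" for n
    unfolding \<tau>_def[abs_def]
    by (rule newton_limit_measurable[OF \<delta>(1) A_lin sc_meas[OF subsetD[OF sub]] sc_cont'], assumption+)+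
  have [measurable]: "\<theta>h n \<in> borel_measurable P" for n unfolding \<theta>h_def[abs_def] by measurable
  have good: "s n \<omega> (\<theta>h n \<omega>) = 0" "norm (\<theta>h n \<omega> - \<theta>0) \<le> 2 * b n \<omega>"
    "norm ((\<theta>h n \<omega> - \<theta>0) - A n (s n \<omega> \<theta>0)) \<le> K * (2 * m * q0 * b n \<omega> + W n \<omega>) * (2 * b n \<omega>)"
    if n: "0 < n" and \<omega>: "\<omega> \<in> G n" for n \<omega>
  proof -
    have w: "\<omega> \<in> space P" "L n \<omega> / real n \<le> q0" "W n \<omega> \<le> 1 / (4 * K)" "b n \<omega> \<le> \<delta> / 2"
      using \<omega> by (auto simp: G_def)
    have contr: "norm (A n (s n \<omega> \<theta> - s n \<omega> \<theta>') + (\<theta> - \<theta>')) \<le> 1/2 * norm (\<theta> - \<theta>')"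
      if "\<theta> \<in> cball \<theta>0 \<delta>" "\<theta>' \<in> cball \<theta>0 \<delta>" for \<theta> \<theta>'
    proof -
      have "K * (m * \<delta> * (L n \<omega> / real n)) \<le> K * (m * \<delta> * q0)"
        using w(2) K m \<delta> by (intro mult_left_mono) auto
      moreover have "K * W n \<omega> \<le> K * (1 / (4 * K))" using w(3) K by (intro mult_left_mono) auto
      moreover have "K * (1 / (4 * K)) = 1/4" using K by simp
      ultimately have "K * (m * \<delta> * (L n \<omega> / real n) + W n \<omega>) \<le> 1/2"
        using \<delta>_le unfolding distrib_left by linarith
      then show ?thesis
        using bound[OF n w(1) \<delta>(2) that] by (meson mult_right_mono norm_ge_zero order_trans)
    qed
    have eq: "\<theta>h n \<omega> = newton_limit (A n) \<theta>0 \<delta> (s n \<omega>)"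
      by (simp add: \<theta>h_def \<tau>_def s_def[abs_def])
    show root: "s n \<omega> (\<theta>h n \<omega>) = 0" and near: "norm (\<theta>h n \<omega> - \<theta>0) \<le> 2 * b n \<omega>"
      unfolding eq using newton_limit_root[where F="s n \<omega>", OF \<delta>(1) A_lin A_inj[OF n] contr] w(4)
      by (simp_all add: b_def)
    let ?d = "norm (\<theta>h n \<omega> - \<theta>0)"
    have b0: "0 \<le> b n \<omega>" by (simp add: b_def)
    have W0: "0 \<le> W n \<omega>" by (simp add: W_def sum_nonneg)
    \<comment> \<open>The expansion is used once more, now on the ball whose radius is the distance
      \<open>?d\<close> itself. This turns the linearisation error into a product of two small
      factors, where the fixed radius \<delta> would leave only one.\<close>
    have "?d \<le> r" using near w(4) \<delta>(2) by linarith
    then have "norm (A n (s n \<omega> (\<theta>h n \<omega>) - s n \<omega> \<theta>0) + (\<theta>h n \<omega> - \<theta>0)) \<le>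
      K * (m * ?d * (L n \<omega> / real n) + W n \<omega>) * ?d"
      using n w(1) by (intro bound) (auto simp: dist_norm norm_minus_commute)
    also have "A n (s n \<omega> (\<theta>h n \<omega>) - s n \<omega> \<theta>0) + (\<theta>h n \<omega> - \<theta>0) = (\<theta>h n \<omega> - \<theta>0) - A n (s n \<omega> \<theta>0)"
      unfolding root using linear_neg[OF A_lin, of n "s n \<omega> \<theta>0"] by simp
    also have "K * (m * ?d * (L n \<omega> / real n) + W n \<omega>) * ?d \<le> K * (2 * m * q0 * b n \<omega> + W n \<omega>) * (2 * b n \<omega>)"
    proof (rule mult_mono[OF _ near])
      have "m * ?d * (L n \<omega> / real n) \<le> m * ?d * q0"
        using w(2) m by (intro mult_left_mono) auto
      also have "\<dots> \<le> m * (2 * b n \<omega>) * q0"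
        using near m q0 by (intro mult_right_mono mult_left_mono) auto
      finally have "m * ?d * (L n \<omega> / real n) \<le> 2 * m * q0 * b n \<omega>" by (simp add: mult_ac)
      then show "K * (m * ?d * (L n \<omega> / real n) + W n \<omega>) \<le> K * (2 * m * q0 * b n \<omega> + W n \<omega>)"
        using K by (intro mult_left_mono add_right_mono) auto
      show "0 \<le> K * (2 * m * q0 * b n \<omega> + W n \<omega>)"
        using K m q0 b0 W0 by (intro mult_nonneg_nonneg add_nonneg_nonneg) auto
    qed simp
    finally show "norm ((\<theta>h n \<omega> - \<theta>0) - A n (s n \<omega> \<theta>0)) \<le> K * (2 * m * q0 * b n \<omega> + W n \<omega>) * (2 * b n \<omega>)" .
  qed
  have consistent: "converges_in_probability P \<theta>h \<theta>0"
  proof (rule vanish_mono[OF vanish_cmult[OF b_lim, of 2] _ G_sets G_lim])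
    fix n \<omega> assume "0 < (n::nat)" "\<omega> \<in> G n"
    from good(2)[OF this] show "norm (\<theta>h n \<omega> - \<theta>0) \<le> \<bar>2 * b n \<omega>\<bar>" by linarith
  qed measurable
  have root_prob: "(\<lambda>n. prob {\<omega>\<in>space P. s n \<omega> (\<theta>h n \<omega>) = 0}) \<longlonglongrightarrow> 1"
  proof (rule tendsto_sandwich)
    have "prob (G n) = 1 - prob (space P - G n)" for n by (simp add: prob_compl)
    then show "(\<lambda>n. prob (G n)) \<longlonglongrightarrow> 1" using tendsto_diff[OF tendsto_const[of 1] G_lim] by simp
    show "\<forall>\<^sub>F n in sequentially. prob (G n) \<le> prob {\<omega>\<in>space P. s n \<omega> (\<theta>h n \<omega>) = 0}"
      using eventually_gt_at_top[of 0]
    proof eventually_elim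
      case (elim n)
      have [measurable]: "(\<lambda>\<omega>. s n \<omega> (\<theta>h n \<omega>)) \<in> borel_measurable P"
        unfolding s_def \<theta>h_def by (rule measurable_compose[OF X root_meas])
      show ?case using good(1)[OF elim] by (intro finite_measure_mono) (auto simp: G_def)
    qed
  qed (auto intro: tendsto_const)
  \<comment> \<open>On the good event this is bounded by a vanishing factor times
    \<open>sqrt (real n) * b n \<omega>\<close>, whose second moments are bounded.\<close>
  define R where "R n \<omega> = sqrt (real n) *\<^sub>R ((\<theta>h n \<omega> - \<theta>0) - A n (s n \<omega> \<theta>0))" for n \<omega>
  have R_lim: "converges_in_probability P R 0"
  proof (rule vanish_mono[OF _ _ G_sets G_lim])
    have int_T: "integrable P (\<lambda>\<omega>. (sqrt (real n) * b n \<omega>)\<^sup>2)" for n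
      using int_b[of n] by (simp add: power_mult_distrib)
    have E_T: "expectation (\<lambda>\<omega>. (sqrt (real n) * b n \<omega>)\<^sup>2) \<le> C" for n
      using E_b[of n] \<open>0 \<le> C\<close> by (cases "n = 0") (simp_all add: power_mult_distrib field_simps)
    have "converges_in_probability P (\<lambda>n \<omega>. 2 * K * (2 * m * q0 * b n \<omega> + W n \<omega>)) 0"
      by (intro vanish_cmult vanish_add b_lim W_lim) measurable
    then show "converges_in_probability P (\<lambda>n \<omega>. 2 * K * (2 * m * q0 * b n \<omega> + W n \<omega>) * (sqrt (real n) * b n \<omega>)) 0"
      by (rule vanish_mult_tight[OF _ _ _ int_T E_T]) measurable
    fix n \<omega> assume n: "0 < (n::nat)" and \<omega>: "\<omega> \<in> G n"
    have "norm (R n \<omega> - 0) = sqrt (real n) * norm ((\<theta>h n \<omega> - \<theta>0) - A n (s n \<omega> \<theta>0))"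
      by (simp add: R_def)
    also have "\<dots> \<le> sqrt (real n) * (K * (2 * m * q0 * b n \<omega> + W n \<omega>) * (2 * b n \<omega>))"
      using good(3)[OF n \<omega>] by (intro mult_left_mono) auto
    also have "\<dots> = 2 * K * (2 * m * q0 * b n \<omega> + W n \<omega>) * (sqrt (real n) * b n \<omega>)" by (simp add: mult_ac)
    finally show "norm (R n \<omega> - 0) \<le> \<bar>2 * K * (2 * m * q0 * b n \<omega> + W n \<omega>) * (sqrt (real n) * b n \<omega>)\<bar>" by linarith
  qed measurable
  define \<Sigma> where "\<Sigma> = Ui ** V ** transpose Ui"
  have quad: "a \<bullet> (\<Sigma> *v a) = (transpose Ui *v a) \<bullet> (V *v (transpose Ui *v a))" for a
    by (simp add: \<Sigma>_def matrix_vector_mul_assoc[symmetric] inner_matrix_vector_transpose[of a Ui])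
  have \<Sigma>_psd: "0 \<le> a \<bullet> (\<Sigma> *v a)" for a unfolding quad by (rule V(2))
  have \<Sigma>_sym: "transpose \<Sigma> = \<Sigma>"
    by (simp add: \<Sigma>_def matrix_transpose_mul V(1) matrix_mul_assoc)
  obtain \<nu> where \<nu>: "multivariate_normal 0 \<Sigma> \<nu>"
    "\<And>a. distr \<nu> borel (\<lambda>x. a \<bullet> x) = distr std_normal_distribution borel (\<lambda>t. sqrt (a \<bullet> (\<Sigma> *v a)) * t)"
    using multivariate_normal_exists[OF \<Sigma>_sym \<Sigma>_psd] by blast
  interpret std: prob_space std_normal_distribution by (intro prob_space_normal_density) simp
  have "converges_in_distribution P (\<lambda>n \<omega>. sqrt (real n) *\<^sub>R (\<theta>h n \<omega> - \<theta>0)) \<nu>"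
  proof (rule cramer_wold[OF P])
    show "prob_space \<nu>" "sets \<nu> = sets borel" using \<nu>(1) by (simp_all add: multivariate_normal_def)
    show "(\<lambda>\<omega>. sqrt (real n) *\<^sub>R (\<theta>h n \<omega> - \<theta>0)) \<in> borel_measurable P" for n by measurable
    fix a
    show "weak_conv_m (\<lambda>n. distr P borel (\<lambda>\<omega>. a \<bullet> sqrt (real n) *\<^sub>R (\<theta>h n \<omega> - \<theta>0))) (distr \<nu> borel (\<lambda>x. a \<bullet> x))"
    proof (rule levy_continuity)
      show "real_distribution (distr P borel (\<lambda>\<omega>. a \<bullet> sqrt (real n) *\<^sub>R (\<theta>h n \<omega> - \<theta>0)))" for n
        by (intro real_distribution_distr) measurable
      show "real_distribution (distr \<nu> borel (\<lambda>x. a \<bullet> x))"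
        unfolding \<nu>(2) by (intro std.real_distribution_distr) measurable
      fix t
      let ?c = "transpose Ui *v a"
      \<comment> \<open>Projecting the linear term on \<open>a\<close> is projecting the score on
        \<open>transpose Ui *v a\<close>; this produces the sandwich form of the covariance
        matrix.\<close>
      have main: "a \<bullet> sqrt (real n) *\<^sub>R A n x = (?c \<bullet> x) / sqrt (real n)" for n x
      proof -
        have "sqrt (real n) / real n = 1 / sqrt (real n)"
          using sqrt_divide_self_eq[of "real n"] by (simp add: inverse_eq_divide)
        then show ?thesis
          unfolding A_def inner_scaleR_right inner_matrix_vector_transpose
          by (simp add: divide_inverse)
      qed
      have lim: "(\<lambda>n. char (distr P borel (\<lambda>\<omega>. a \<bullet> sqrt (real n) *\<^sub>R A n (s n \<omega> \<theta>0))) t)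
        \<longlonglongrightarrow> complex_of_real (exp (- (t\<^sup>2 * (a \<bullet> (\<Sigma> *v a))) / 2))"
        unfolding main quad s_def by (rule clt)
      have "(\<lambda>n. char (distr P borel (\<lambda>\<omega>. a \<bullet> sqrt (real n) *\<^sub>R (\<theta>h n \<omega> - \<theta>0))) t)
        \<longlonglongrightarrow> complex_of_real (exp (- (t\<^sup>2 * (a \<bullet> (\<Sigma> *v a))) / 2))"
      proof (rule char_slutsky[OF _ _ _ lim])
        fix \<epsilon> :: real assume "0 < \<epsilon>"
        have [measurable]: "R n \<in> borel_measurable P" for n unfolding R_def[abs_def] by measurable
        have "converges_in_probability P (\<lambda>n \<omega>. a \<bullet> R n \<omega>) 0"
        proof (rule vanish_mono[where G="\<lambda>_. space P" and Y="\<lambda>n \<omega>. norm a * norm (R n \<omega>)"])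
          have "converges_in_probability P (\<lambda>n \<omega>. norm (R n \<omega>)) 0"
            using R_lim by (simp add: converges_in_probability_def)
          then show "converges_in_probability P (\<lambda>n \<omega>. norm a * norm (R n \<omega>)) 0" by (rule vanish_cmult)
        qed (auto simp: Cauchy_Schwarz_ineq2)
        then show "(\<lambda>n. prob {\<omega>\<in>space P. \<bar>a \<bullet> sqrt (real n) *\<^sub>R (\<theta>h n \<omega> - \<theta>0) - a \<bullet> sqrt (real n) *\<^sub>R A n (s n \<omega> \<theta>0)\<bar> > \<epsilon>}) \<longlonglongrightarrow> 0"
          using \<open>0 < \<epsilon>\<close> unfolding converges_in_probability_def R_def
          by (simp add: inner_diff_right right_diff_distrib)
      qed measurable
      then show "(\<lambda>n. char (distr P borel (\<lambda>\<omega>. a \<bullet> sqrt (real n) *\<^sub>R (\<theta>h n \<omega> - \<theta>0))) t)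
        \<longlonglongrightarrow> char (distr \<nu> borel (\<lambda>x. a \<bullet> x)) t"
        unfolding \<nu>(2) char_scaled_std_normal using \<Sigma>_psd[of a] by simp
    qed
  qed
  moreover have "\<tau> n \<in> measurable N (restrict_space borel \<Theta>)" for n
    using subsetD[OF r(2) subsetD[OF sub \<tau>_in[of n]]] by (intro measurable_restrict_space2) auto
  ultimately show ?thesis
    using root_prob consistent \<nu>(1) unfolding \<theta>h_def s_def \<Sigma>_def Ui_def by blast
qed

section \<open>Sums over superpositions\<close>

lemma converges_in_probability_iff_diff:
  "converges_in_probability P X c \<longleftrightarrow> converges_in_probability P (\<lambda>n \<omega>. X n \<omega> - c) (0::real)"
  by (simp add: converges_in_probability_def dist_real_def)

lemma ereal_SUP_less_infinity_bound:
  assumes "(SUP x\<in>A. ereal (q x)) < \<infinity>"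
  obtains B where "0 \<le> B" "\<And>x. x \<in> A \<Longrightarrow> q x \<le> B"
proof -
  obtain n :: nat where n: "(SUP x\<in>A. ereal (q x)) < ereal (real n)"
    using assms less_PInf_Ex_of_nat[of "SUP x\<in>A. ereal (q x)"] by auto
  have "q x \<le> real n" if "x \<in> A" for x
    using SUP_upper[OF that, of "\<lambda>x. ereal (q x)"] n by (meson ereal_less_eq(3) less_imp_le order_trans)
  then show ?thesis using that[of "real n"] by simp
qed

lemma has_derivative_partial_deriv:
  fixes F :: "real^'m::finite \<Rightarrow> real"
  assumes "F differentiable_on \<Theta>" "open \<Theta>" "\<theta> \<in> \<Theta>"
  shows "(F has_derivative (\<lambda>v. \<Sum>l\<in>UNIV. partial_deriv l F \<theta> * v $ l)) (at \<theta>)"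
proof -
  have D: "(F has_derivative frechet_derivative F (at \<theta>)) (at \<theta>)"
    using assms by (simp add: differentiable_on_eq_differentiable_at frechet_derivative_works)
  interpret D: linear "frechet_derivative F (at \<theta>)"
    using D by (rule has_derivative_linear)
  have "frechet_derivative F (at \<theta>) v = (\<Sum>l\<in>UNIV. partial_deriv l F \<theta> * v $ l)" for v
  proof -
    have "frechet_derivative F (at \<theta>) v = frechet_derivative F (at \<theta>) (\<Sum>l\<in>UNIV. v $ l *\<^sub>R axis l 1)"
      using basis_expansion[of v] by (simp add: scalar_mult_eq_scaleR)
    then show ?thesis by (simp add: D.sum D.scaleR partial_deriv_def mult.commute)
  qed
  then have "frechet_derivative F (at \<theta>) = (\<lambda>v. \<Sum>l\<in>UNIV. partial_deriv l F \<theta> * v $ l)" by blast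
  with D show ?thesis by simp
qed

text \<open>A limit of difference quotients along a coordinate axis: measurability in
  \<open>u\<close> is known at each fixed parameter, and a sequence of steps keeps the limit
  countable.\<close>

lemma partial_deriv_measurable:
  fixes F :: "real^'m::finite \<Rightarrow> 'b \<Rightarrow> real"
  assumes "open \<Theta>" "\<theta>0 \<in> \<Theta>"
    and diff: "\<And>u. u \<in> space M \<Longrightarrow> (\<lambda>\<theta>. F \<theta> u) differentiable_on \<Theta>"
    and meas: "\<And>\<theta>. \<theta> \<in> \<Theta> \<Longrightarrow> F \<theta> \<in> borel_measurable M"
  shows "(\<lambda>u. partial_deriv l (\<lambda>\<theta>. F \<theta> u) \<theta>0) \<in> borel_measurable M"
proof -
  obtain r where r: "0 < r" "cball \<theta>0 r \<subseteq> \<Theta>"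
    using assms(1,2) open_contains_cball by blast
  \<comment> \<open>Positive steps that shrink to 0 without leaving the ball inside the parameter
    set.\<close>
  define t where "t n = r / real (Suc n)" for n
  have t: "0 < t n" "t n \<le> r" for n using r by (auto simp: t_def field_simps)
  have t_lim: "t \<longlonglongrightarrow> 0" unfolding t_def using LIMSEQ_Suc[OF lim_const_over_n[of r]] by simp
  have in_\<Theta>: "\<theta>0 + t n *\<^sub>R axis l 1 \<in> \<Theta>" for n
    using t[of n] r(2) by (intro subsetD[OF r(2)]) (simp add: dist_norm)
  show ?thesis
  proof (rule borel_measurable_LIMSEQ_metric)
    show "(\<lambda>u. (F (\<theta>0 + t n *\<^sub>R axis l 1) u - F \<theta>0 u) / t n) \<in> borel_measurable M" for n
      using meas[OF in_\<Theta>[of n]] meas[OF assms(2)] by simp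
    fix u assume u: "u \<in> space M"
    let ?p = "\<lambda>l. partial_deriv l (\<lambda>\<theta>. F \<theta> u) \<theta>0"
    have "((\<lambda>s. F (\<theta>0 + s *\<^sub>R axis l 1) u) has_derivative (\<lambda>s. \<Sum>k\<in>UNIV. ?p k * (s *\<^sub>R axis l 1) $ k)) (at (0::real))"
    proof (rule has_derivative_compose[of "\<lambda>s. \<theta>0 + s *\<^sub>R axis l 1" "\<lambda>s. s *\<^sub>R axis l 1" 0 UNIV "\<lambda>\<theta>. F \<theta> u", simplified])
      show "((\<lambda>s. \<theta>0 + s *\<^sub>R axis l 1) has_derivative (\<lambda>s. s *\<^sub>R axis l 1)) (at 0)"
        by (auto intro!: derivative_eq_intros)
      show "((\<lambda>\<theta>. F \<theta> u) has_derivative (\<lambda>v. \<Sum>k\<in>UNIV. ?p k * v $ k)) (at \<theta>0)"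
        by (rule has_derivative_partial_deriv[OF diff[OF u] assms(1,2)])
    qed
    moreover have "(\<lambda>s. \<Sum>k\<in>UNIV. ?p k * (s *\<^sub>R axis l 1) $ k) = (\<lambda>s. s * ?p l)"
    proof
      fix s :: real
      have "(\<Sum>k\<in>UNIV. ?p k * (s *\<^sub>R axis l 1) $ k) = (\<Sum>k\<in>UNIV. if k = l then s * ?p l else 0)"
        by (intro sum.cong refl) (simp add: axis_def)
      then show "(\<Sum>k\<in>UNIV. ?p k * (s *\<^sub>R axis l 1) $ k) = s * ?p l" by simp
    qed
    ultimately have "DERIV (\<lambda>s. F (\<theta>0 + s *\<^sub>R axis l 1) u) 0 :> ?p l"
      by (simp only: has_field_derivative_def mult_commute_abs)
    from DERIV_D[OF this] have lim: "((\<lambda>h. (F (\<theta>0 + h *\<^sub>R axis l 1) u - F \<theta>0 u) / h) \<longlongrightarrow> ?p l) (at 0)"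
      by simp
    have "t n \<in> UNIV - {0}" for n using t(1)[of n] by simp
    then have "((\<lambda>h. (F (\<theta>0 + h *\<^sub>R axis l 1) u - F \<theta>0 u) / h) \<circ> t) \<longlonglongrightarrow> ?p l"
      by (intro lim[unfolded tendsto_at_iff_sequentially, rule_format] t_lim)
    then show "(\<lambda>n. (F (\<theta>0 + t n *\<^sub>R axis l 1) u - F \<theta>0 u) / t n) \<longlonglongrightarrow> ?p l"
      by (simp add: comp_def)
  qed
qed

text \<open>Errors add up over the points; the factor \<open>c\<close> stays outside so that the
  modulus of the score is a plain sum over the configuration.\<close>

lemma sum_mset_linear_error:
  fixes a b e :: "'a \<Rightarrow> real"
  assumes "\<And>x. x \<in># Z \<Longrightarrow> \<bar>a x - b x - (\<Sum>l\<in>I. j l x * v l)\<bar> \<le> e x * c"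
  shows "\<bar>(\<Sum>x\<in>#Z. a x) - (\<Sum>x\<in>#Z. b x) - (\<Sum>l\<in>I. (\<Sum>x\<in>#Z. j l x) * v l)\<bar> \<le> (\<Sum>x\<in>#Z. e x) * c"
  using assms
proof (induction Z)
  case (add x Z)
  have "(\<Sum>l\<in>I. (\<Sum>y\<in>#add_mset x Z. j l y) * v l) = (\<Sum>l\<in>I. j l x * v l) + (\<Sum>l\<in>I. (\<Sum>y\<in>#Z. j l y) * v l)"
    by (simp add: distrib_right sum.distrib)
  moreover have "(\<Sum>y\<in>#add_mset x Z. e y) * c = e x * c + (\<Sum>y\<in>#Z. e y) * c" by (simp add: distrib_right)
  moreover have "\<bar>(\<Sum>x\<in>#Z. a x) - (\<Sum>x\<in>#Z. b x) - (\<Sum>l\<in>I. (\<Sum>x\<in>#Z. j l x) * v l)\<bar> \<le> (\<Sum>x\<in>#Z. e x) * c"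
    using add by simp
  ultimately show ?case using add.prems[of x] by simp
qed simp

lemma sum_mset_component: "(\<Sum>x\<in>#Z. F x) $ i = (\<Sum>x\<in>#Z. F x $ i)"
  by (induction Z) simp_all

lemma continuous_on_sum_mset:
  fixes F :: "'a \<Rightarrow> 'b::topological_space \<Rightarrow> 'c::real_normed_vector"
  shows "(\<And>x. x \<in># Z \<Longrightarrow> continuous_on A (F x)) \<Longrightarrow> continuous_on A (\<lambda>\<theta>. \<Sum>x\<in>#Z. F x \<theta>)"
  by (induction Z) (auto intro!: continuous_intros)

lemma borel_measurable_vec_componentwise:
  fixes F :: "'a \<Rightarrow> real^'m::finite"
  assumes "\<And>i. (\<lambda>x. F x $ i) \<in> borel_measurable M"
  shows "F \<in> borel_measurable M"
  unfolding borel_measurable_euclidean_space[of F]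
  using assms by (auto simp: Basis_vec_def inner_axis)

section \<open>One sequence of independent copies: averages and fluctuations\<close>

locale iid_processes = prob_space P for P :: "'w measure" +
  fixes S :: "'a::euclidean_space set" and Y :: "nat \<Rightarrow> 'w \<Rightarrow> 'a multiset" and \<kappa> :: "'a \<Rightarrow> real"
  assumes window_borel: "S \<in> sets borel" and iid: "iid_point_processes P S Y"
    and all_intensity: "\<And>j. j \<ge> 1 \<Longrightarrow> has_intensity P S (Y j) \<kappa>"
begin

lemma process: "j \<ge> 1 \<Longrightarrow> Y j \<in> measurable P (config S)"
  using iid by (simp add: iid_point_processes_def point_process_def)

sublocale first: intensity_process P S "Y (Suc 0)" \<kappa>
  using window_borel process[of "Suc 0"] all_intensity[of "Suc 0"]
  by unfold_locales (simp_all add: point_process_def)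

lemma functional_measurable:
  fixes q :: "'a \<Rightarrow> real"
  assumes "q \<in> borel_measurable first.\<L>"
  shows "(\<lambda>Z. \<Sum>x\<in>#Z. q x) \<in> borel_measurable (config S)"
  using assms by (intro borel_measurable_sum_mset[OF window_borel]) (simp add: measurable_cong_sets[OF first.sets_window refl])

lemma superposition_measurable: "superposition Y n \<in> measurable P (config S)"
  by (rule measurable_superposition) (rule process)

lemma functional_superposition_measurable:
  fixes q :: "'a \<Rightarrow> real"
  assumes "q \<in> borel_measurable first.\<L>"
  shows "(\<lambda>\<omega>. \<Sum>x\<in>#superposition Y n \<omega>. q x) \<in> borel_measurable P"
  by (rule measurable_compose[OF superposition_measurable functional_measurable[OF assms]])

text \<open>The centred form, with limit 0, lets the errors of two samples be added.\<close>

lemma functional_lln: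
  fixes q :: "'a \<Rightarrow> real"
  assumes q: "q \<in> borel_measurable first.\<L>" and int: "integrable first.\<L> (\<lambda>u. q u * \<kappa> u)"
  shows "converges_in_probability P (\<lambda>n \<omega>. (\<Sum>x\<in>#superposition Y n \<omega>. q x) / real n - (\<integral>u. q u * \<kappa> u \<partial>first.\<L>)) 0"
  unfolding converges_in_probability_def
proof (intro allI impI)
  fix \<epsilon> :: real assume "0 < \<epsilon>"
  have "(\<lambda>n. prob {\<omega>\<in>space P. \<bar>(\<Sum>i<n. \<Sum>x\<in>#Y (Suc i) \<omega>. q x) / real n - expectation (\<lambda>\<omega>. \<Sum>x\<in>#Y (Suc 0) \<omega>. q x)\<bar> > \<epsilon>}) \<longlonglongrightarrow> 0"
    using \<open>0 < \<epsilon>\<close>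
    by (intro weak_law_of_large_numbers[of "\<lambda>i \<omega>. \<Sum>x\<in>#Y (Suc i) \<omega>. q x"]
      iid_functional[OF prob_space_axioms iid functional_measurable[OF q]] first.campbell(1)[OF q int])
  then show "(\<lambda>n. prob {\<omega>\<in>space P. dist ((\<Sum>x\<in>#superposition Y n \<omega>. q x) / real n - (\<integral>u. q u * \<kappa> u \<partial>first.\<L>)) 0 > \<epsilon>}) \<longlonglongrightarrow> 0"
    by (simp add: sum_mset_superposition first.campbell(2)[OF q int])
qed

context
  fixes q :: "'a \<Rightarrow> real" and \<mu> v :: real
  assumes q: "q \<in> borel_measurable first.\<L>" and int: "integrable first.\<L> (\<lambda>u. q u * \<kappa> u)"
    and sq: "integrable P (\<lambda>\<omega>. (\<Sum>x\<in>#Y (Suc 0) \<omega>. q x)\<^sup>2)"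
    and mean: "(\<integral>u. q u * \<kappa> u \<partial>first.\<L>) = \<mu>"
    and var: "expectation (\<lambda>\<omega>. (\<Sum>x\<in>#Y (Suc 0) \<omega>. q x)\<^sup>2) - \<mu>\<^sup>2 = v"
begin

text \<open>Moments are computed for the first process and carried to the others by equality in
  law.\<close>

lemma centred_functional:
  shows "indep_vars (\<lambda>_. borel) (\<lambda>i \<omega>. (\<Sum>x\<in>#Y (Suc i) \<omega>. q x) - \<mu>) UNIV"
    and "distr P borel (\<lambda>\<omega>. (\<Sum>x\<in>#Y (Suc i) \<omega>. q x) - \<mu>) = distr P borel (\<lambda>\<omega>. (\<Sum>x\<in>#Y (Suc 0) \<omega>. q x) - \<mu>)"
    and "integrable P (\<lambda>\<omega>. ((\<Sum>x\<in>#Y (Suc i) \<omega>. q x) - \<mu>)\<^sup>2)"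
    and "expectation (\<lambda>\<omega>. (\<Sum>x\<in>#Y (Suc i) \<omega>. q x) - \<mu>) = 0"
    and "expectation (\<lambda>\<omega>. ((\<Sum>x\<in>#Y (Suc i) \<omega>. q x) - \<mu>)\<^sup>2) = v"
proof -
  let ?X = "\<lambda>i \<omega>. (\<Sum>x\<in>#Y (Suc i) \<omega>. q x) - \<mu>"
  have G: "(\<lambda>Z. (\<Sum>x\<in>#Z. q x) - \<mu>) \<in> borel_measurable (config S)"
    using functional_measurable[OF q] by simp
  show "indep_vars (\<lambda>_. borel) ?X UNIV" and ident: "distr P borel (?X i) = distr P borel (?X 0)" for i
    using iid_functional[OF prob_space_axioms iid G] by auto
  have rv: "?X i \<in> borel_measurable P" for i
    by (rule measurable_compose[OF process G]) simp
  have i1: "integrable P (\<lambda>\<omega>. \<Sum>x\<in>#Y (Suc 0) \<omega>. q x)" by (rule first.campbell(1)[OF q int])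
  have E1: "expectation (\<lambda>\<omega>. \<Sum>x\<in>#Y (Suc 0) \<omega>. q x) = \<mu>" using first.campbell(2)[OF q int] mean by simp
  have sq_eq: "(?X 0 \<omega>)\<^sup>2 = (\<Sum>x\<in>#Y (Suc 0) \<omega>. q x)\<^sup>2 - 2 * \<mu> * (\<Sum>x\<in>#Y (Suc 0) \<omega>. q x) + \<mu>\<^sup>2" for \<omega>
    by (simp add: power2_eq_square algebra_simps)
  have i2: "integrable P (\<lambda>\<omega>. (?X 0 \<omega>)\<^sup>2)"
    unfolding sq_eq using sq i1 by simp
  have E2: "expectation (\<lambda>\<omega>. (?X 0 \<omega>)\<^sup>2) = v"
    unfolding sq_eq using sq i1 by (simp add: E1 prob_space var[symmetric] power2_eq_square)
  have E0: "expectation (?X 0) = 0" using i1 by (simp add: E1 prob_space)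
  note transfer = expectation_eq_of_distr_eq[OF rv rv _ ident]
  show "integrable P (\<lambda>\<omega>. (?X i \<omega>)\<^sup>2)"
    using i2 by (subst transfer(2)[of "\<lambda>x. x\<^sup>2"]) simp_all
  show "expectation (?X i) = 0"
    using transfer(1)[of "\<lambda>x. x" i] E0 by simp
  show "expectation (\<lambda>\<omega>. (?X i \<omega>)\<^sup>2) = v"
    using transfer(1)[of "\<lambda>x. x\<^sup>2" i] E2 by simp
qed

lemma variance_nonneg: "0 \<le> v"
  unfolding centred_functional(5)[of 0, symmetric] by (rule Bochner_Integration.integral_nonneg) simp

lemma sum_centred_functional:
  "(\<Sum>i<n. (\<Sum>x\<in>#Y (Suc i) \<omega>. q x) - \<mu>) = (\<Sum>x\<in>#superposition Y n \<omega>. q x) - real n * \<mu>"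
  by (simp add: sum_mset_superposition sum_subtractf)

lemma functional_second_moment:
  shows "integrable P (\<lambda>\<omega>. ((\<Sum>x\<in>#superposition Y n \<omega>. q x) - real n * \<mu>)\<^sup>2)"
    and "expectation (\<lambda>\<omega>. ((\<Sum>x\<in>#superposition Y n \<omega>. q x) - real n * \<mu>)\<^sup>2) = real n * v"
  using integral_indep_sum_sq[OF centred_functional(1,3,4,5), of n] unfolding sum_centred_functional by auto

lemma functional_clt:
  "(\<lambda>n. char (distr P borel (\<lambda>\<omega>. ((\<Sum>x\<in>#superposition Y n \<omega>. q x) - real n * \<mu>) / sqrt (real n))) t)
    \<longlonglongrightarrow> complex_of_real (exp (- (t\<^sup>2 * v) / 2))"
  using char_clt[OF centred_functional(1,2,3,4,5), of t] unfolding sum_centred_functional .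

end

end

text \<open>The normalised sums of the two samples are independent, so their characteristic
  functions multiply and the variances add. The common mean \<mu> drops out; the second sample
  carries the sign inside its summands and so has mean - \<mu> per process.\<close>

lemma functional_clt_difference:
  fixes q q' :: "'a::euclidean_space \<Rightarrow> real"
  assumes P: "prob_space P" and indep: "independent_sequences P S Y E"
    and q: "q \<in> borel_measurable (restrict_space borel S)" "q' \<in> borel_measurable (restrict_space borel S)"
    and S: "S \<in> sets borel"
    and Y: "(\<lambda>n. char (distr P borel (\<lambda>\<omega>. ((\<Sum>x\<in>#superposition Y n \<omega>. q x) - real n * \<mu>) / sqrt (real n))) t)
      \<longlonglongrightarrow> complex_of_real (exp (- (t\<^sup>2 * v) / 2))"
    and E: "(\<lambda>n. char (distr P borel (\<lambda>\<omega>. ((\<Sum>x\<in>#superposition E n \<omega>. - q' x) - real n * (- \<mu>)) / sqrt (real n))) t)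
      \<longlonglongrightarrow> complex_of_real (exp (- (t\<^sup>2 * v') / 2))"
  shows "(\<lambda>n. char (distr P borel (\<lambda>\<omega>. ((\<Sum>x\<in>#superposition Y n \<omega>. q x) - (\<Sum>x\<in>#superposition E n \<omega>. q' x)) / sqrt (real n))) t)
      \<longlonglongrightarrow> complex_of_real (exp (- (t\<^sup>2 * (v + v')) / 2))"
proof -
  interpret prob_space P by (rule P)
  have "char (distr P borel (\<lambda>\<omega>. ((\<Sum>x\<in>#superposition Y n \<omega>. q x) - (\<Sum>x\<in>#superposition E n \<omega>. q' x)) / sqrt (real n))) t =
     char (distr P borel (\<lambda>\<omega>. ((\<Sum>x\<in>#superposition Y n \<omega>. q x) - real n * \<mu>) / sqrt (real n))) t *
     char (distr P borel (\<lambda>\<omega>. ((\<Sum>x\<in>#superposition E n \<omega>. - q' x) - real n * (- \<mu>)) / sqrt (real n))) t" for n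
  proof -
    let ?G = "\<lambda>Z. ((\<Sum>x\<in>#Z. q x) - \<mu>) / sqrt (real n)" and ?H = "\<lambda>Z. ((\<Sum>x\<in>#Z. - q' x) - (- \<mu>)) / sqrt (real n)"
    have ind: "indep_var borel (\<lambda>\<omega>. \<Sum>i<n. ?G (Y (Suc i) \<omega>)) borel (\<lambda>\<omega>. \<Sum>i<n. ?H (E (Suc i) \<omega>))"
      using q borel_measurable_sum_mset[OF S, of q] borel_measurable_sum_mset[OF S, of "\<lambda>x. - q' x"]
      by (intro indep_var_partial_sums[OF P indep]) simp_all
    have G: "(\<lambda>\<omega>. \<Sum>i<n. ?G (Y (Suc i) \<omega>)) = (\<lambda>\<omega>. ((\<Sum>x\<in>#superposition Y n \<omega>. q x) - real n * \<mu>) / sqrt (real n))"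
      by (simp add: sum_mset_superposition sum_subtractf sum_divide_distrib[symmetric])
    have H: "(\<lambda>\<omega>. \<Sum>i<n. ?H (E (Suc i) \<omega>)) = (\<lambda>\<omega>. ((\<Sum>x\<in>#superposition E n \<omega>. - q' x) - real n * (- \<mu>)) / sqrt (real n))"
      by (simp add: sum_mset_superposition sum.distrib sum_divide_distrib[symmetric])
    have sum: "((\<Sum>x\<in>#superposition Y n \<omega>. q x) - (\<Sum>x\<in>#superposition E n \<omega>. q' x)) / sqrt (real n) =
      ((\<Sum>x\<in>#superposition Y n \<omega>. q x) - real n * \<mu>) / sqrt (real n) +
      ((\<Sum>x\<in>#superposition E n \<omega>. - q' x) - real n * (- \<mu>)) / sqrt (real n)" for \<omega>
      by (simp add: add_divide_distrib[symmetric] sum_mset_diff[of "\<lambda>_. 0", simplified])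
    show ?thesis unfolding sum by (rule char_distr_add[OF ind[unfolded G H]])
  qed
  moreover have "complex_of_real (exp (- (t\<^sup>2 * (v + v')) / 2)) =
    complex_of_real (exp (- (t\<^sup>2 * v) / 2)) * complex_of_real (exp (- (t\<^sup>2 * v') / 2))"
    by (simp add: exp_add[symmetric] distrib_left add_divide_distrib flip: of_real_mult)
  ultimately show ?thesis using tendsto_mult[OF Y E] by simp
qed

section \<open>The two-sample model\<close>

context second_order_process
begin

lemma integrable_product:
  assumes A: "integrable \<L> (A :: 'a \<Rightarrow> real)" and B: "integrable \<L> (B :: 'a \<Rightarrow> real)"
  shows "integrable (\<L> \<Otimes>\<^sub>M \<L>) (\<lambda>p. A (fst p) * B (snd p))"
    and "(\<integral>p. A (fst p) * B (snd p) \<partial>(\<L> \<Otimes>\<^sub>M \<L>)) = (\<integral>u. A u \<partial>\<L>) * (\<integral>u. B u \<partial>\<L>)"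
proof -
  have [measurable]: "A \<in> borel_measurable \<L>" "B \<in> borel_measurable \<L>" using A B by auto
  show int: "integrable (\<L> \<Otimes>\<^sub>M \<L>) (\<lambda>p. A (fst p) * B (snd p))"
  proof (rule window.Fubini_integrable)
    show "integrable \<L> (\<lambda>x. \<integral>y. norm (A (fst (x, y)) * B (snd (x, y))) \<partial>\<L>)"
      using A by (simp add: abs_mult)
    show "AE x in \<L>. integrable \<L> (\<lambda>y. A (fst (x, y)) * B (snd (x, y)))"
      using B by simp
  qed measurable
  show "(\<integral>p. A (fst p) * B (snd p) \<partial>(\<L> \<Otimes>\<^sub>M \<L>)) = (\<integral>u. A u \<partial>\<L>) * (\<integral>u. B u \<partial>\<L>)"
    using window.integral_fst'[OF int] by simp
qed

text \<open>Here boundedness of the pair correlation acts: the density of pairs is at most a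
  multiple of the product of the intensities, which reduces integrability over pairs to first
  order.\<close>

lemma integrable_product_density:
  fixes a b :: "'a \<Rightarrow> real"
  assumes [measurable]: "a \<in> borel_measurable \<L>" "b \<in> borel_measurable \<L>"
    and int: "integrable \<L> (\<lambda>u. a u * \<kappa> u)" "integrable \<L> (\<lambda>u. b u * \<kappa> u)"
    and H: "\<And>u v. u \<in> S \<Longrightarrow> v \<in> S \<Longrightarrow> \<kappa>2 u v \<le> H * (\<kappa> u * \<kappa> v)"
  shows "integrable (\<L> \<Otimes>\<^sub>M \<L>) (\<lambda>p. a (fst p) * b (snd p) * \<kappa>2 (fst p) (snd p))"
proof (rule Bochner_Integration.integrable_bound)
  show "integrable (\<L> \<Otimes>\<^sub>M \<L>) (\<lambda>p. H * ((a (fst p) * \<kappa> (fst p)) * (b (snd p) * \<kappa> (snd p))))"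
    by (intro integrable_mult_right integrable_product(1) int)
  show "AE p in \<L> \<Otimes>\<^sub>M \<L>. norm (a (fst p) * b (snd p) * \<kappa>2 (fst p) (snd p)) \<le>
      norm (H * ((a (fst p) * \<kappa> (fst p)) * (b (snd p) * \<kappa> (snd p))))"
  proof (rule AE_I2)
    fix p assume "p \<in> space (\<L> \<Otimes>\<^sub>M \<L>)"
    then have S: "fst p \<in> S" "snd p \<in> S" by (auto simp: space_pair_measure space_window)
    have "\<bar>\<kappa>2 (fst p) (snd p)\<bar> \<le> \<bar>H\<bar> * (\<bar>\<kappa> (fst p)\<bar> * \<bar>\<kappa> (snd p)\<bar>)"
      using H[OF S] \<kappa>2_nonneg[OF S] by (simp flip: abs_mult)
    then have "\<bar>a (fst p) * b (snd p)\<bar> * \<bar>\<kappa>2 (fst p) (snd p)\<bar> \<le>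
        \<bar>a (fst p) * b (snd p)\<bar> * (\<bar>H\<bar> * (\<bar>\<kappa> (fst p)\<bar> * \<bar>\<kappa> (snd p)\<bar>))"
      by (rule mult_left_mono) simp
    then show "norm (a (fst p) * b (snd p) * \<kappa>2 (fst p) (snd p)) \<le>
      norm (H * ((a (fst p) * \<kappa> (fst p)) * (b (snd p) * \<kappa> (snd p))))"
      by (simp add: abs_mult mult_ac)
  qed
qed measurable

end

lemma sum_mset_sum: "(\<Sum>x\<in>#Z. \<Sum>k\<in>I. F k x) = (\<Sum>k\<in>I. \<Sum>x\<in>#Z. F k x)"
  by (induction Z) (simp_all add: sum.distrib)

lemma set_integrable_window:
  fixes q :: "'a::euclidean_space \<Rightarrow> 'b::{banach,second_countable_topology}"
  assumes "S \<in> sets borel"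
  shows "set_integrable lborel S q \<longleftrightarrow> integrable (restrict_space lborel S) q"
    and "(LINT u:S|lborel. q u) = (\<integral>u. q u \<partial>restrict_space lborel S)"
    and "set_borel_measurable lborel S q \<longleftrightarrow> q \<in> borel_measurable (restrict_space lborel S)"
proof -
  have "S \<inter> space lborel \<in> sets lborel" using assms by simp
  note this[THEN integrable_restrict_space, of q] this[THEN integral_restrict_space, of q]
    this[THEN borel_measurable_restrict_space_iff, of q]
  then show "set_integrable lborel S q \<longleftrightarrow> integrable (restrict_space lborel S) q"
    and "(LINT u:S|lborel. q u) = (\<integral>u. q u \<partial>restrict_space lborel S)"
    and "set_borel_measurable lborel S q \<longleftrightarrow> q \<in> borel_measurable (restrict_space lborel S)"
    by (simp_all add: set_integrable_def set_lebesgue_integral_def set_borel_measurable_def)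
qed

text \<open>The hypotheses with neighbourhoods and suprema replaced by explicit constants: the
  radius \<open>r\<close>, the bound \<open>C\<close> on the covariates, \<open>B\<close> on the
  weights, \<open>HY\<close> and \<open>HE\<close> on the pair correlations. Second-order densities
  are fixed for the first process of each sequence, the others having the same law.\<close>

locale two_sample_model = prob_space P for P :: "'w measure" +
  fixes S :: "'a::euclidean_space set" and \<Theta> :: "(real^'m::finite) set" and \<theta>0 :: "real^'m"
    and Y E :: "nat \<Rightarrow> 'w \<Rightarrow> 'a multiset" and b \<rho> :: "'a \<Rightarrow> real" and z :: "'a \<Rightarrow> real^'m"
    and f :: "real^'m \<Rightarrow> 'a \<Rightarrow> real^'m" and \<kappa>2Y \<kappa>2E :: "'a \<Rightarrow> 'a \<Rightarrow> real"
    and d :: "'m \<Rightarrow> 'a \<Rightarrow> real" and d1 :: "'m \<Rightarrow> 'm \<Rightarrow> 'a \<Rightarrow> real" and d2 :: "'m \<Rightarrow> 'm \<Rightarrow> 'm \<Rightarrow> 'a \<Rightarrow> real"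
    and r C B HY HE :: real
  assumes S_borel: "S \<in> sets borel" and \<Theta>: "open \<Theta>" and r: "0 < r" "cball \<theta>0 r \<subseteq> \<Theta>"
    and iid_Y: "iid_point_processes P S Y" and iid_E: "iid_point_processes P S E"
    and indep: "independent_sequences P S Y E"
    and b: "\<And>u. u \<in> S \<Longrightarrow> 0 < b u" "b \<in> borel_measurable (restrict_space lborel S)"
    and \<rho>: "\<And>u. u \<in> S \<Longrightarrow> 0 < \<rho> u" "\<rho> \<in> borel_measurable (restrict_space lborel S)"
    and z: "z \<in> borel_measurable (restrict_space lborel S)" "\<And>u. u \<in> S \<Longrightarrow> norm (z u) \<le> C"
    and f_meas: "\<And>\<theta>. \<theta> \<in> \<Theta> \<Longrightarrow> f \<theta> \<in> borel_measurable (restrict_space lborel S)"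
    and f_int: "\<And>i. integrable (restrict_space lborel S) (\<lambda>u. f \<theta>0 u $ i * loglinear_intensity b z \<theta>0 u)"
    and intensity_Y: "\<And>j. j \<ge> 1 \<Longrightarrow> has_intensity P S (Y j) (loglinear_intensity b z \<theta>0)"
    and intensity_E: "\<And>j. j \<ge> 1 \<Longrightarrow> has_intensity P S (E j) \<rho>"
    and density_Y: "has_second_product_density P S (Y (Suc 0)) \<kappa>2Y"
    and density_E: "has_second_product_density P S (E (Suc 0)) \<kappa>2E"
    and HY: "\<And>u v. u \<in> S \<Longrightarrow> v \<in> S \<Longrightarrow> \<kappa>2Y u v \<le> HY * (loglinear_intensity b z \<theta>0 u * loglinear_intensity b z \<theta>0 v)"
    and HE: "\<And>u v. u \<in> S \<Longrightarrow> v \<in> S \<Longrightarrow> \<kappa>2E u v \<le> HE * (\<rho> u * \<rho> v)"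
    and B: "\<And>u. u \<in> S \<Longrightarrow> loglinear_intensity b z \<theta>0 u / \<rho> u \<le> B"
    and smooth: "\<And>u i. u \<in> S \<Longrightarrow> twice_cont_differentiable_on (\<lambda>\<theta>. f \<theta> u $ i) \<Theta>"
    and bounds: "\<And>\<theta> u i k l. \<theta> \<in> cball \<theta>0 r \<Longrightarrow> u \<in> S \<Longrightarrow> \<bar>f \<theta> u $ i\<bar> \<le> d i u \<and>
      \<bar>partial_deriv l (\<lambda>\<theta>. f \<theta> u $ i) \<theta>\<bar> \<le> d1 i l u \<and>
      \<bar>partial_deriv k (partial_deriv l (\<lambda>\<theta>. f \<theta> u $ i)) \<theta>\<bar> \<le> d2 i k l u"
    and d_int: "\<And>i. integrable (restrict_space lborel S) (\<lambda>u. d i u * loglinear_intensity b z \<theta>0 u)"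
      "\<And>i l. integrable (restrict_space lborel S) (\<lambda>u. d1 i l u * loglinear_intensity b z \<theta>0 u)"
      "\<And>i k l. integrable (restrict_space lborel S) (\<lambda>u. d2 i k l u * loglinear_intensity b z \<theta>0 u)"
    and ff_int: "\<And>k l. integrable (restrict_space lborel S) (\<lambda>u. f \<theta>0 u $ k * f \<theta>0 u $ l * loglinear_intensity b z \<theta>0 u)"
begin

abbreviation "lam \<equiv> loglinear_intensity b z"
abbreviation "lam0 \<equiv> loglinear_intensity b z \<theta>0"
abbreviation "\<L> \<equiv> restrict_space lborel S"
abbreviation "f0 i u \<equiv> f \<theta>0 u $ i"
definition w :: "'a \<Rightarrow> real" where "w u = lam0 u / \<rho> u"
abbreviation "f1 i l u \<equiv> partial_deriv l (\<lambda>\<theta>. f \<theta> u $ i) \<theta>0"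

sublocale Y: iid_processes P S Y lam0
  using S_borel iid_Y intensity_Y by unfold_locales

sublocale E: iid_processes P S E \<rho>
  using S_borel iid_E intensity_E by unfold_locales

sublocale Y2: second_order_process P S "Y (Suc 0)" lam0 \<kappa>2Y
  using density_Y by unfold_locales

sublocale E2: second_order_process P S "E (Suc 0)" \<rho> \<kappa>2E
  using density_E by unfold_locales

lemma space_L: "space \<L> = S" by (simp add: space_restrict_space)

lemma \<theta>0_in: "\<theta>0 \<in> cball \<theta>0 r" "\<theta>0 \<in> \<Theta>" using r by auto

lemma lam_pos: "u \<in> S \<Longrightarrow> 0 < lam \<theta> u"
  using b(1) by (simp add: loglinear_intensity_def)

lemma C_nonneg: "u \<in> S \<Longrightarrow> 0 \<le> C"
  using z(2)[of u] norm_ge_zero[of "z u"] by linarith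

lemma z_component_le: "u \<in> S \<Longrightarrow> \<bar>z u $ l\<bar> \<le> C"
  using z(2)[of u] component_le_norm_cart[of "z u" l] by linarith

lemma component_measurable:
  "F \<in> borel_measurable M \<Longrightarrow> (\<lambda>u. F u $ i) \<in> borel_measurable M" for F :: "'b \<Rightarrow> real^'m"
  by (rule measurable_compose[of F _ borel]) (auto intro!: borel_measurable_continuous_onI continuous_intros)

lemma z_meas[measurable]: "(\<lambda>u. z u $ l) \<in> borel_measurable \<L>"
  using z(1) by (rule component_measurable)

lemma lam_meas[measurable]: "lam \<theta> \<in> borel_measurable \<L>"
  unfolding loglinear_intensity_def[abs_def] using b(2) z(1) by measurable

lemma rho_meas[measurable]: "\<rho> \<in> borel_measurable \<L>" by (rule \<rho>(2))

lemma w_meas[measurable]: "w \<in> borel_measurable \<L>"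
  unfolding w_def[abs_def] by measurable

lemma w_pos: "u \<in> S \<Longrightarrow> 0 < w u"
  using lam_pos[of u \<theta>0] \<rho>(1)[of u] by (simp add: w_def)

lemma f_comp_meas: "\<theta> \<in> \<Theta> \<Longrightarrow> (\<lambda>u. f \<theta> u $ i) \<in> borel_measurable \<L>"
  using f_meas by (intro component_measurable)

lemma f0_meas[measurable]: "f0 i \<in> borel_measurable \<L>"
  using f_comp_meas \<theta>0_in by blast

lemma f_diff: "u \<in> S \<Longrightarrow> (\<lambda>\<theta>. f \<theta> u $ i) differentiable_on \<Theta>"
  "u \<in> S \<Longrightarrow> partial_deriv l (\<lambda>\<theta>. f \<theta> u $ i) differentiable_on \<Theta>"
  using smooth[of u i] by (simp_all add: twice_cont_differentiable_on_def cont_differentiable_on_def)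

lemma f1_meas[measurable]: "f1 i l \<in> borel_measurable \<L>"
  by (rule partial_deriv_measurable[OF \<Theta> \<theta>0_in(2), where F="\<lambda>\<theta> u. f \<theta> u $ i"])
     (auto simp: space_L f_diff f_comp_meas)

text \<open>The dominating functions are known only through their products with the intensity;
  dividing by the positive intensity recovers their measurability.\<close>

lemma weighted_meas:
  assumes "integrable \<L> (\<lambda>u. q u * lam0 u)"
  shows "q \<in> borel_measurable \<L>"
proof -
  have "(\<lambda>u. (q u * lam0 u) / lam0 u) \<in> borel_measurable \<L>"
    using borel_measurable_integrable[OF assms] by measurable
  moreover have "(q u * lam0 u) / lam0 u = q u" if "u \<in> space \<L>" for u
    using lam_pos[of u \<theta>0] that by (simp add: space_L)
  ultimately show ?thesis by (simp cong: measurable_cong)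
qed

lemmas d_meas[measurable] = weighted_meas[OF d_int(1)] weighted_meas[OF d_int(2)] weighted_meas[OF d_int(3)]

text \<open>The weight cancels the intensity \<rho>. Integrals over the second sample are reduced to
  integrals against \<open>lam0\<close> by this identity, which is why the score is centred.\<close>

lemma weighted_rho:
  "integrable \<L> (\<lambda>u. w u * q u * \<rho> u) \<longleftrightarrow> integrable \<L> (\<lambda>u. q u * lam0 u)"
  "(\<integral>u. w u * q u * \<rho> u \<partial>\<L>) = (\<integral>u. q u * lam0 u \<partial>\<L>)"
proof -
  have "w u * q u * \<rho> u = q u * lam0 u" if "u \<in> space \<L>" for u
    using \<rho>(1)[of u] that by (simp add: space_L w_def)
  then show "integrable \<L> (\<lambda>u. w u * q u * \<rho> u) \<longleftrightarrow> integrable \<L> (\<lambda>u. q u * lam0 u)"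
    "(\<integral>u. w u * q u * \<rho> u \<partial>\<L>) = (\<integral>u. q u * lam0 u \<partial>\<L>)"
    by (intro Bochner_Integration.integrable_cong Bochner_Integration.integral_cong refl; assumption)+
qed

lemma f1_int: "integrable \<L> (\<lambda>u. f1 i l u * lam0 u)"
proof (rule Bochner_Integration.integrable_bound[OF d_int(2)[of i l]])
  show "AE u in \<L>. norm (f1 i l u * lam0 u) \<le> norm (d1 i l u * lam0 u)"
  proof (rule AE_I2)
    fix u assume "u \<in> space \<L>"
    then have "\<bar>f1 i l u\<bar> \<le> \<bar>d1 i l u\<bar>"
      using bounds[OF \<theta>0_in(1), of u i l] by (fastforce simp: space_L)
    then show "norm (f1 i l u * lam0 u) \<le> norm (d1 i l u * lam0 u)"
      by (simp add: abs_mult mult_right_mono)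
  qed
qed measurable

lemma fz_int: "integrable \<L> (\<lambda>u. f0 i u * z u $ l * lam0 u)"
proof (rule Bochner_Integration.integrable_bound)
  show "integrable \<L> (\<lambda>u. C * (f0 i u * lam0 u))" by (intro integrable_mult_right f_int)
  show "AE u in \<L>. norm (f0 i u * z u $ l * lam0 u) \<le> norm (C * (f0 i u * lam0 u))"
  proof (rule AE_I2)
    fix u assume "u \<in> space \<L>"
    then have "\<bar>z u $ l\<bar> \<le> \<bar>C\<bar>" using z_component_le[of u l] by (simp add: space_L)
    then have "\<bar>z u $ l\<bar> * \<bar>f0 i u * lam0 u\<bar> \<le> \<bar>C\<bar> * \<bar>f0 i u * lam0 u\<bar>" by (rule mult_right_mono) simp
    then show "norm (f0 i u * z u $ l * lam0 u) \<le> norm (C * (f0 i u * lam0 u))"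
      by (simp add: abs_mult mult_ac)
  qed
qed measurable

text \<open>The derivative of the score at \<theta>0. In the second sum the product rule meets a
  log-linear intensity, whose derivative in direction \<open>l\<close> is the intensity times
  \<open>z x $ l\<close>.\<close>

definition Jacobian :: "nat \<Rightarrow> 'w \<Rightarrow> real^'m^'m" where
  "Jacobian n \<omega> = (\<chi> i l. (\<Sum>x\<in>#superposition Y n \<omega>. f1 i l x)
     - (\<Sum>x\<in>#superposition E n \<omega>. w x * (f1 i l x + f0 i x * z x $ l)))"

lemma Jacobian_meas: "(\<lambda>\<omega>. Jacobian n \<omega> $ i $ l) \<in> borel_measurable P"
  unfolding Jacobian_def vec_lambda_beta
  by (intro borel_measurable_diff Y.functional_superposition_measurable E.functional_superposition_measurable) measurable

text \<open>The terms with derivatives of \<open>f\<close> have the same mean in both samples and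
  cancel; the term with \<open>z\<close> survives with a minus sign.\<close>

lemma Jacobian_lim:
  "converges_in_probability P (\<lambda>n \<omega>. Jacobian n \<omega> $ i $ l / real n) (- (U_matrix S (f \<theta>0) lam0 z $ i $ l))"
proof -
  let ?qY = "f1 i l" and ?qE = "\<lambda>u. w u * (f1 i l u + f0 i u * z u $ l)"
  let ?AY = "\<lambda>n \<omega>. (\<Sum>x\<in>#superposition Y n \<omega>. ?qY x) / real n - (\<integral>u. ?qY u * lam0 u \<partial>\<L>)"
  let ?AE = "\<lambda>n \<omega>. (\<Sum>x\<in>#superposition E n \<omega>. ?qE x) / real n - (\<integral>u. ?qE u * \<rho> u \<partial>\<L>)"
  have qE[measurable]: "?qE \<in> borel_measurable \<L>" by measurable
  have intE: "integrable \<L> (\<lambda>u. ?qE u * \<rho> u)"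
    unfolding weighted_rho using f1_int[of l i] fz_int[of i l] by (simp add: distrib_right)
  have "converges_in_probability P ?AY 0" by (rule Y.functional_lln[OF f1_meas f1_int])
  moreover have "converges_in_probability P (\<lambda>n \<omega>. - 1 * ?AE n \<omega>) 0"
    by (intro vanish_cmult E.functional_lln[OF qE intE])
  ultimately have lim: "converges_in_probability P (\<lambda>n \<omega>. ?AY n \<omega> + - 1 * ?AE n \<omega>) 0"
    using Y.functional_superposition_measurable[OF f1_meas] E.functional_superposition_measurable[OF qE]
    by (intro vanish_add) simp_all
  have U: "U_matrix S (f \<theta>0) lam0 z $ i $ l = (\<integral>u. f0 i u * z u $ l * lam0 u \<partial>\<L>)"
    unfolding U_matrix_def vec_lambda_beta set_integrable_window(2)[OF S_borel] by (simp add: mult_ac)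
  have "(\<integral>u. ?qE u * \<rho> u \<partial>\<L>) = (\<integral>u. ?qY u * lam0 u \<partial>\<L>) + U_matrix S (f \<theta>0) lam0 z $ i $ l"
    unfolding weighted_rho U using f1_int[of l i] fz_int[of i l] by (simp add: distrib_right)
  then have "?AY n \<omega> + - 1 * ?AE n \<omega> = Jacobian n \<omega> $ i $ l / real n - (- (U_matrix S (f \<theta>0) lam0 z $ i $ l))" for n \<omega>
    by (simp add: Jacobian_def diff_divide_distrib)
  then show ?thesis
    using lim by (subst converges_in_probability_iff_diff) simp
qed

text \<open>Summing over \<open>i\<close> as well makes one modulus serve all components of the
  score.\<close>

definition lipY :: "'a \<Rightarrow> real" where
  "lipY u = (\<Sum>i\<in>UNIV. \<Sum>k\<in>UNIV. \<Sum>l\<in>UNIV. d2 i k l u)"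

text \<open>Bounds the second derivatives of \<lambda>/\<rho> times \<open>f\<close> on the ball:
  the product rule yields four terms, each component of \<open>z\<close> is at most
  \<open>C\<close>, and \<open>exp (C * r)\<close> compares the intensity with its value at
  \<theta>0.\<close>

definition lipE :: "'a \<Rightarrow> real" where
  "lipE u = w u * (exp (C * r) * (\<Sum>i\<in>UNIV. \<Sum>k\<in>UNIV. \<Sum>l\<in>UNIV.
     d2 i k l u + C * d1 i k u + C * d1 i l u + C\<^sup>2 * d i u))"

definition lipschitz :: "nat \<Rightarrow> 'w \<Rightarrow> real" where
  "lipschitz n \<omega> = (\<Sum>x\<in>#superposition Y n \<omega>. lipY x) + (\<Sum>x\<in>#superposition E n \<omega>. lipE x)"

lemma lip_meas[measurable]: "lipY \<in> borel_measurable \<L>" "lipE \<in> borel_measurable \<L>"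
  unfolding lipY_def[abs_def] lipE_def[abs_def] by measurable

lemma lipschitz_meas: "lipschitz n \<in> borel_measurable P"
  unfolding lipschitz_def[abs_def]
  by (intro borel_measurable_add Y.functional_superposition_measurable E.functional_superposition_measurable) measurable

lemma lip_int: "integrable \<L> (\<lambda>u. lipY u * lam0 u)" "integrable \<L> (\<lambda>u. lipE u * \<rho> u)"
proof -
  show "integrable \<L> (\<lambda>u. lipY u * lam0 u)"
    unfolding lipY_def sum_distrib_right by (intro Bochner_Integration.integrable_sum d_int)
  have "integrable \<L> (\<lambda>u. exp (C * r) * (\<Sum>i\<in>UNIV. \<Sum>k\<in>UNIV. \<Sum>l\<in>UNIV.
     d2 i k l u * lam0 u + C * (d1 i k u * lam0 u) + C * (d1 i l u * lam0 u) + C\<^sup>2 * (d i u * lam0 u)))"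
    by (intro integrable_mult_right Bochner_Integration.integrable_sum Bochner_Integration.integrable_add d_int)
  then show "integrable \<L> (\<lambda>u. lipE u * \<rho> u)"
    unfolding lipE_def weighted_rho by (simp add: sum_distrib_right distrib_right mult.assoc)
qed

lemma lipschitz_lim:
  "converges_in_probability P (\<lambda>n \<omega>. lipschitz n \<omega> / real n) ((\<integral>u. lipY u * lam0 u \<partial>\<L>) + (\<integral>u. lipE u * \<rho> u \<partial>\<L>))"
proof (subst converges_in_probability_iff_diff)
  have "converges_in_probability P (\<lambda>n \<omega>. ((\<Sum>x\<in>#superposition Y n \<omega>. lipY x) / real n - (\<integral>u. lipY u * lam0 u \<partial>\<L>))
     + ((\<Sum>x\<in>#superposition E n \<omega>. lipE x) / real n - (\<integral>u. lipE u * \<rho> u \<partial>\<L>))) 0"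
    using Y.functional_superposition_measurable[OF lip_meas(1)] E.functional_superposition_measurable[OF lip_meas(2)]
    by (intro vanish_add Y.functional_lln E.functional_lln lip_int lip_meas) simp_all
  then show "converges_in_probability P (\<lambda>n \<omega>. lipschitz n \<omega> / real n -
     ((\<integral>u. lipY u * lam0 u \<partial>\<L>) + (\<integral>u. lipE u * \<rho> u \<partial>\<L>))) 0"
    by (simp add: lipschitz_def add_divide_distrib algebra_simps)
qed

lemma taylor_Y:
  assumes u: "u \<in> S" and \<delta>: "\<delta> \<le> r" and \<theta>: "\<theta> \<in> cball \<theta>0 \<delta>" "\<theta>' \<in> cball \<theta>0 \<delta>"
  shows "\<bar>f \<theta> u $ i - f \<theta>' u $ i - (\<Sum>l\<in>UNIV. f1 i l u * (\<theta> - \<theta>') $ l)\<bar> \<le> lipY u * (\<delta> * norm (\<theta> - \<theta>'))"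
proof -
  have "\<bar>f \<theta> u $ i - f \<theta>' u $ i - (\<chi> l. partial_deriv l (\<lambda>\<theta>. f \<theta> u $ i) \<theta>0) \<bullet> (\<theta> - \<theta>')\<bar>
      \<le> (\<Sum>k\<in>UNIV. \<Sum>l\<in>UNIV. d2 i k l u) * \<delta> * norm (\<theta> - \<theta>')"
  proof (rule taylor_bound[where \<psi>="\<lambda>\<theta>. f \<theta> u $ i" and G="\<lambda>\<theta>. \<chi> l. partial_deriv l (\<lambda>\<theta>. f \<theta> u $ i) \<theta>"
       and H="\<lambda>\<theta>. \<chi> k l. partial_deriv k (partial_deriv l (\<lambda>\<theta>. f \<theta> u $ i)) \<theta>" and D="\<lambda>k l. d2 i k l u", OF _ _ _ \<theta> \<delta>])
    fix \<eta> k l assume \<eta>: "\<eta> \<in> cball \<theta>0 r"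
    then have \<eta>': "\<eta> \<in> \<Theta>" using r by blast
    show "((\<lambda>\<theta>. f \<theta> u $ i) has_derivative (\<lambda>v. (\<chi> l. partial_deriv l (\<lambda>\<theta>. f \<theta> u $ i) \<eta>) \<bullet> v)) (at \<eta>)"
      using has_derivative_partial_deriv[OF f_diff(1)[OF u] \<Theta> \<eta>'] by (simp add: inner_vec_def)
    show "((\<lambda>\<theta>. (\<chi> l. partial_deriv l (\<lambda>\<theta>. f \<theta> u $ i) \<theta>) $ l) has_derivative
       (\<lambda>v. \<Sum>k\<in>UNIV. (\<chi> k l. partial_deriv k (partial_deriv l (\<lambda>\<theta>. f \<theta> u $ i)) \<eta>) $ k $ l * v $ k)) (at \<eta>)"
      using has_derivative_partial_deriv[OF f_diff(2)[OF u] \<Theta> \<eta>'] by simp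
    show "\<bar>(\<chi> k l. partial_deriv k (partial_deriv l (\<lambda>\<theta>. f \<theta> u $ i)) \<eta>) $ k $ l\<bar> \<le> d2 i k l u"
      using bounds[OF \<eta> u] by simp
  qed
  also have "\<dots> \<le> lipY u * (\<delta> * norm (\<theta> - \<theta>'))"
  proof -
    have d2: "0 \<le> d2 i k l u" for i k l using bounds[OF \<theta>0_in(1) u, of i l k] by linarith
    have "(\<Sum>k\<in>UNIV. \<Sum>l\<in>UNIV. d2 i k l u) \<le> lipY u"
      unfolding lipY_def using d2 by (intro member_le_sum[where f="\<lambda>i. \<Sum>k\<in>UNIV. \<Sum>l\<in>UNIV. d2 i k l u"] sum_nonneg) auto
    moreover have "0 \<le> \<delta>" using \<theta>(1) by (meson mem_cball order_trans zero_le_dist)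
    ultimately show ?thesis by (simp add: mult.assoc mult_right_mono)
  qed
  finally show ?thesis by (simp add: inner_vec_def)
qed

lemma lam_le:
  assumes u: "u \<in> S" and \<theta>: "\<theta> \<in> cball \<theta>0 r"
  shows "lam \<theta> u \<le> exp (C * r) * lam0 u"
proof -
  have "(\<theta> - \<theta>0) \<bullet> z u \<le> norm (\<theta> - \<theta>0) * norm (z u)" by (rule norm_cauchy_schwarz)
  also have "\<dots> \<le> r * C"
    using \<theta> z(2)[OF u] r by (intro mult_mono) (auto simp: dist_norm norm_minus_commute)
  finally have "exp (\<theta> \<bullet> z u) \<le> exp (C * r + \<theta>0 \<bullet> z u)" by (simp add: inner_diff_left mult.commute)
  then show ?thesis
    using b(1)[OF u] by (simp add: loglinear_intensity_def exp_add mult_ac)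
qed

lemma taylor_E:
  assumes u: "u \<in> S" and \<delta>: "\<delta> \<le> r" and \<theta>: "\<theta> \<in> cball \<theta>0 \<delta>" "\<theta>' \<in> cball \<theta>0 \<delta>"
  shows "\<bar>lam \<theta> u / \<rho> u * f \<theta> u $ i - lam \<theta>' u / \<rho> u * f \<theta>' u $ i - (\<Sum>l\<in>UNIV. w u * (f1 i l u + f0 i u * z u $ l) * (\<theta> - \<theta>') $ l)\<bar>
    \<le> lipE u * (\<delta> * norm (\<theta> - \<theta>'))"
proof -
  let ?p = "\<lambda>l \<theta>. partial_deriv l (\<lambda>\<theta>. f \<theta> u $ i) \<theta>"
  \<comment> \<open>Gradient and Hessian by the product rule; each derivative that falls on the
    intensity brings out one component of \<open>z u\<close>.\<close>
  let ?G = "\<lambda>\<theta>. \<chi> l. lam \<theta> u / \<rho> u * (?p l \<theta> + f \<theta> u $ i * z u $ l)"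
  let ?H = "\<lambda>\<theta>. \<chi> k l. lam \<theta> u / \<rho> u * (partial_deriv k (?p l) \<theta> + ?p k \<theta> * z u $ l + ?p l \<theta> * z u $ k + f \<theta> u $ i * z u $ k * z u $ l)"
  let ?D = "\<lambda>i k l. d2 i k l u + C * d1 i k u + C * d1 i l u + C\<^sup>2 * d i u"
  have C: "0 \<le> C" using C_nonneg[OF u] .
  have w0: "0 \<le> w u" using w_pos[OF u] by simp
  have dlam: "((\<lambda>\<theta>. lam \<theta> u / \<rho> u) has_derivative (\<lambda>v. lam \<eta> u / \<rho> u * (\<Sum>k\<in>UNIV. z u $ k * v $ k))) (at \<eta>)" for \<eta>
  proof -
    have "((\<lambda>\<theta>. lam \<theta> u / \<rho> u) has_derivative (\<lambda>v. b u * (exp (\<eta> \<bullet> z u) * (v \<bullet> z u)) / \<rho> u)) (at \<eta>)"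
      unfolding loglinear_intensity_def using \<rho>(1)[OF u] by (auto intro!: derivative_eq_intros)
    moreover have "b u * (exp (\<eta> \<bullet> z u) * (v \<bullet> z u)) / \<rho> u = lam \<eta> u / \<rho> u * (\<Sum>k\<in>UNIV. z u $ k * v $ k)" for v
      unfolding inner_commute[of v] by (simp add: loglinear_intensity_def inner_vec_def)
    ultimately show ?thesis by simp
  qed
  have "\<bar>lam \<theta> u / \<rho> u * f \<theta> u $ i - lam \<theta>' u / \<rho> u * f \<theta>' u $ i - ?G \<theta>0 \<bullet> (\<theta> - \<theta>')\<bar>
      \<le> (\<Sum>k\<in>UNIV. \<Sum>l\<in>UNIV. exp (C * r) * w u * ?D i k l) * \<delta> * norm (\<theta> - \<theta>')"
  proof (rule taylor_bound[where \<psi>="\<lambda>\<theta>. lam \<theta> u / \<rho> u * f \<theta> u $ i" and G="?G" and H="?H"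
      and D="\<lambda>k l. exp (C * r) * w u * ?D i k l", OF _ _ _ \<theta> \<delta>])
    fix \<eta> k l assume \<eta>: "\<eta> \<in> cball \<theta>0 r"
    then have \<eta>': "\<eta> \<in> \<Theta>" using r by blast
    note df = has_derivative_partial_deriv[OF f_diff(1)[OF u] \<Theta> \<eta>', of i]
    note dp = has_derivative_partial_deriv[OF f_diff(2)[OF u] \<Theta> \<eta>', of l i]
    have "((\<lambda>\<theta>. lam \<theta> u / \<rho> u * f \<theta> u $ i) has_derivative
       (\<lambda>v. lam \<eta> u / \<rho> u * (\<Sum>l\<in>UNIV. ?p l \<eta> * v $ l) + lam \<eta> u / \<rho> u * (\<Sum>k\<in>UNIV. z u $ k * v $ k) * f \<eta> u $ i)) (at \<eta>)"
      by (rule has_derivative_mult[OF dlam df])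
    moreover have "lam \<eta> u / \<rho> u * (\<Sum>l\<in>UNIV. ?p l \<eta> * v $ l) + lam \<eta> u / \<rho> u * (\<Sum>k\<in>UNIV. z u $ k * v $ k) * f \<eta> u $ i
        = ?G \<eta> \<bullet> v" for v
      unfolding inner_vec_def sum_distrib_left sum_distrib_right sum.distrib[symmetric]
      by (intro sum.cong refl) (simp add: algebra_simps)
    ultimately show "((\<lambda>\<theta>. lam \<theta> u / \<rho> u * f \<theta> u $ i) has_derivative (\<lambda>v. ?G \<eta> \<bullet> v)) (at \<eta>)" by simp
    have "((\<lambda>\<theta>. lam \<theta> u / \<rho> u * (?p l \<theta> + f \<theta> u $ i * z u $ l)) has_derivative
       (\<lambda>v. lam \<eta> u / \<rho> u * ((\<Sum>k\<in>UNIV. partial_deriv k (?p l) \<eta> * v $ k) + (\<Sum>k\<in>UNIV. ?p k \<eta> * v $ k) * z u $ l)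
          + lam \<eta> u / \<rho> u * (\<Sum>k\<in>UNIV. z u $ k * v $ k) * (?p l \<eta> + f \<eta> u $ i * z u $ l))) (at \<eta>)"
      by (intro has_derivative_mult dlam has_derivative_add dp has_derivative_mult_left df)
    moreover have "lam \<eta> u / \<rho> u * ((\<Sum>k\<in>UNIV. partial_deriv k (?p l) \<eta> * v $ k) + (\<Sum>k\<in>UNIV. ?p k \<eta> * v $ k) * z u $ l)
          + lam \<eta> u / \<rho> u * (\<Sum>k\<in>UNIV. z u $ k * v $ k) * (?p l \<eta> + f \<eta> u $ i * z u $ l) =
        (\<Sum>k\<in>UNIV. ?H \<eta> $ k $ l * v $ k)" for v
      unfolding sum_distrib_left sum_distrib_right sum.distrib[symmetric] vec_lambda_beta
      by (intro sum.cong refl) (simp add: algebra_simps)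
    ultimately show "((\<lambda>\<theta>. ?G \<theta> $ l) has_derivative (\<lambda>v. \<Sum>k\<in>UNIV. ?H \<eta> $ k $ l * v $ k)) (at \<eta>)" by simp
    have "\<bar>partial_deriv k (?p l) \<eta>\<bar> \<le> d2 i k l u" "\<bar>?p k \<eta>\<bar> \<le> d1 i k u" "\<bar>?p l \<eta>\<bar> \<le> d1 i l u" "\<bar>f \<eta> u $ i\<bar> \<le> d i u"
      using bounds[OF \<eta> u] by blast+
    note bd = this
    have "\<bar>?p k \<eta> * z u $ l\<bar> \<le> d1 i k u * C" "\<bar>?p l \<eta> * z u $ k\<bar> \<le> d1 i l u * C"
      unfolding abs_mult using bd z_component_le[OF u] by (auto intro!: mult_mono)
    moreover have "\<bar>f \<eta> u $ i * z u $ k * z u $ l\<bar> \<le> d i u * C * C"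
      unfolding abs_mult using bd z_component_le[OF u] C by (auto intro!: mult_mono mult_nonneg_nonneg)
    ultimately have "\<bar>partial_deriv k (?p l) \<eta> + ?p k \<eta> * z u $ l + ?p l \<eta> * z u $ k + f \<eta> u $ i * z u $ k * z u $ l\<bar>
        \<le> d2 i k l u + d1 i k u * C + d1 i l u * C + d i u * C * C"
      using bd(1) by linarith
    also have "\<dots> = ?D i k l" by (simp add: power2_eq_square)
    finally have D: "\<bar>partial_deriv k (?p l) \<eta> + ?p k \<eta> * z u $ l + ?p l \<eta> * z u $ k + f \<eta> u $ i * z u $ k * z u $ l\<bar> \<le> ?D i k l" .
    have "lam \<eta> u / \<rho> u \<le> exp (C * r) * w u"
      using lam_le[OF u \<eta>] \<rho>(1)[OF u] by (simp add: w_def divide_right_mono)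
    then have "\<bar>lam \<eta> u / \<rho> u\<bar> \<le> exp (C * r) * w u"
      using lam_pos[OF u, of \<eta>] \<rho>(1)[OF u] by simp
    then show "\<bar>?H \<eta> $ k $ l\<bar> \<le> exp (C * r) * w u * ?D i k l"
      unfolding vec_lambda_beta abs_mult[of "lam \<eta> u / \<rho> u"]
      by (rule mult_mono[OF _ D mult_nonneg_nonneg[OF _ w0]]) simp_all
  qed
  also have "(\<Sum>k\<in>UNIV. \<Sum>l\<in>UNIV. exp (C * r) * w u * ?D i k l) * \<delta> * norm (\<theta> - \<theta>') \<le> lipE u * (\<delta> * norm (\<theta> - \<theta>'))"
  proof -
    have D0: "0 \<le> ?D i k l" for i k l
      using bounds[OF \<theta>0_in(1) u, of i l k] bounds[OF \<theta>0_in(1) u, of i k l] C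
      by (intro add_nonneg_nonneg mult_nonneg_nonneg) auto
    have "(\<Sum>k\<in>UNIV. \<Sum>l\<in>UNIV. ?D i k l) \<le> (\<Sum>i\<in>UNIV. \<Sum>k\<in>UNIV. \<Sum>l\<in>UNIV. ?D i k l)"
      by (rule member_le_sum[where f="\<lambda>i. \<Sum>k\<in>UNIV. \<Sum>l\<in>UNIV. ?D i k l"]) (auto intro!: sum_nonneg D0)
    then have "w u * (exp (C * r) * (\<Sum>k\<in>UNIV. \<Sum>l\<in>UNIV. ?D i k l)) \<le> lipE u"
      unfolding lipE_def using w0 by (intro mult_left_mono) auto
    moreover have "(\<Sum>k\<in>UNIV. \<Sum>l\<in>UNIV. exp (C * r) * w u * ?D i k l) = w u * (exp (C * r) * (\<Sum>k\<in>UNIV. \<Sum>l\<in>UNIV. ?D i k l))"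
      unfolding sum_distrib_left by (intro sum.cong refl) (simp only: mult_ac)
    ultimately have "(\<Sum>k\<in>UNIV. \<Sum>l\<in>UNIV. exp (C * r) * w u * ?D i k l) \<le> lipE u" by (simp only:)
    moreover have "0 \<le> \<delta>" using \<theta>(1) by (meson mem_cball order_trans zero_le_dist)
    ultimately show ?thesis
      using mult_right_mono[of _ "lipE u" "\<delta> * norm (\<theta> - \<theta>')"] by (simp only: mult.assoc mult_nonneg_nonneg norm_ge_zero)
  qed
  finally show ?thesis by (simp add: inner_vec_def w_def)
qed

section \<open>Moments of the score and its covariance matrix\<close>

abbreviation "fE i u \<equiv> w u * f0 i u"

definition mean :: "'m \<Rightarrow> real" where
  "mean k = (\<integral>u. f0 k u * lam0 u \<partial>\<L>)"

definition momentY :: "'m \<Rightarrow> 'm \<Rightarrow> real" where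
  "momentY k l = expectation (\<lambda>\<omega>. (\<Sum>x\<in>#Y (Suc 0) \<omega>. f0 k x) * (\<Sum>x\<in>#Y (Suc 0) \<omega>. f0 l x))"

definition momentE :: "'m \<Rightarrow> 'm \<Rightarrow> real" where
  "momentE k l = expectation (\<lambda>\<omega>. (\<Sum>x\<in>#E (Suc 0) \<omega>. fE k x) * (\<Sum>x\<in>#E (Suc 0) \<omega>. fE l x))"

lemma fE_meas[measurable]: "fE k \<in> borel_measurable \<L>" by measurable

lemma fE_int: "integrable \<L> (\<lambda>u. fE k u * \<rho> u)"
  unfolding weighted_rho by (rule f_int)

text \<open>The weight enters the second sample squared while \<rho> cancels only one factor; the
  bound \<open>B\<close> takes care of the other.\<close>

lemma ffw_int: "integrable \<L> (\<lambda>u. f0 k u * f0 l u * w u * lam0 u)"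
proof (rule Bochner_Integration.integrable_bound)
  show "integrable \<L> (\<lambda>u. B * (f0 k u * f0 l u * lam0 u))" by (intro integrable_mult_right ff_int)
  show "AE u in \<L>. norm (f0 k u * f0 l u * w u * lam0 u) \<le> norm (B * (f0 k u * f0 l u * lam0 u))"
  proof (rule AE_I2)
    fix u assume "u \<in> space \<L>"
    then have u: "u \<in> S" by (simp add: space_L)
    have "\<bar>w u\<bar> \<le> \<bar>B\<bar>"
      using B[OF u] w_pos[OF u] by (simp add: w_def)
    then have "\<bar>w u\<bar> * \<bar>f0 k u * f0 l u * lam0 u\<bar> \<le> \<bar>B\<bar> * \<bar>f0 k u * f0 l u * lam0 u\<bar>"
      by (rule mult_right_mono) simp
    then show "norm (f0 k u * f0 l u * w u * lam0 u) \<le> norm (B * (f0 k u * f0 l u * lam0 u))"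
      by (simp add: abs_mult mult_ac)
  qed
qed measurable

text \<open>One of the two weights cancels against \<rho>, the other stays: this is the summand
  \<lambda>/\<rho> in the single integral of \<open>V_matrix\<close>.\<close>

lemma fEfE: "integrable \<L> (\<lambda>u. fE k u * fE l u * \<rho> u)"
  "(\<integral>u. fE k u * fE l u * \<rho> u \<partial>\<L>) = (\<integral>u. f0 k u * f0 l u * w u * lam0 u \<partial>\<L>)"
proof -
  have eq: "fE k u * fE l u * \<rho> u = w u * (f0 k u * f0 l u * w u) * \<rho> u" for u by (simp only: mult_ac)
  show "integrable \<L> (\<lambda>u. fE k u * fE l u * \<rho> u)" unfolding eq weighted_rho(1) by (rule ffw_int)
  show "(\<integral>u. fE k u * fE l u * \<rho> u \<partial>\<L>) = (\<integral>u. f0 k u * f0 l u * w u * lam0 u \<partial>\<L>)"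
    unfolding eq weighted_rho(2) ..
qed

lemma pairY_int: "integrable (\<L> \<Otimes>\<^sub>M \<L>) (\<lambda>p. f0 k (fst p) * f0 l (snd p) * \<kappa>2Y (fst p) (snd p))"
  by (rule Y2.integrable_product_density[OF f0_meas f0_meas f_int f_int HY])

lemma pairE_int: "integrable (\<L> \<Otimes>\<^sub>M \<L>) (\<lambda>p. fE k (fst p) * fE l (snd p) * \<kappa>2E (fst p) (snd p))"
  by (rule E2.integrable_product_density[OF fE_meas fE_meas fE_int fE_int HE])

lemma momentY_int: "integrable P (\<lambda>\<omega>. (\<Sum>x\<in>#Y (Suc 0) \<omega>. f0 k x) * (\<Sum>x\<in>#Y (Suc 0) \<omega>. f0 l x))"
  by (rule Y2.campbell2(1)[OF f0_meas f0_meas pairY_int ff_int])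

lemma momentE_int: "integrable P (\<lambda>\<omega>. (\<Sum>x\<in>#E (Suc 0) \<omega>. fE k x) * (\<Sum>x\<in>#E (Suc 0) \<omega>. fE l x))"
  by (rule E2.campbell2(1)[OF fE_meas fE_meas pairE_int fEfE(1)])

lemma momentY_eq: "momentY k l =
  (\<integral>p. f0 k (fst p) * f0 l (snd p) * \<kappa>2Y (fst p) (snd p) \<partial>(\<L> \<Otimes>\<^sub>M \<L>)) + (\<integral>u. f0 k u * f0 l u * lam0 u \<partial>\<L>)"
  unfolding momentY_def by (rule Y2.campbell2(2)[OF f0_meas f0_meas pairY_int ff_int])

lemma momentE_eq: "momentE k l =
  (\<integral>p. fE k (fst p) * fE l (snd p) * \<kappa>2E (fst p) (snd p) \<partial>(\<L> \<Otimes>\<^sub>M \<L>)) + (\<integral>u. fE k u * fE l u * \<rho> u \<partial>\<L>)"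
  unfolding momentE_def by (rule E2.campbell2(2)[OF fE_meas fE_meas pairE_int fEfE(1)])

text \<open>The diagonal parts of the second-order Campbell formulas give the single integral, the
  pair parts the double one. Multiplied by two weights, the pair density of the second sample
  becomes \<open>g\<close> times two values of \<open>lam0\<close>. The number 2 in
  \<open>g u v + h u v - 2\<close> stands for the product of means, subtracted once for each
  sample.\<close>

lemma V_matrix_eq:
  assumes g: "\<And>u v. u \<in> S \<Longrightarrow> v \<in> S \<Longrightarrow> g u v = \<kappa>2E u v / (\<rho> u * \<rho> v)"
    and h: "\<And>u v. u \<in> S \<Longrightarrow> v \<in> S \<Longrightarrow> h u v = \<kappa>2Y u v / (lam0 u * lam0 v)"
  shows "V_matrix S (f \<theta>0) lam0 \<rho> g h $ k $ l = momentY k l + momentE k l - 2 * mean k * mean l"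
proof -
  let ?I = "\<lambda>u v. f0 k u * lam0 u * (f0 l v * lam0 v) * (g u v + h u v - 2)"
  let ?Y = "\<lambda>p. f0 k (fst p) * f0 l (snd p) * \<kappa>2Y (fst p) (snd p)"
  let ?E = "\<lambda>p. fE k (fst p) * fE l (snd p) * \<kappa>2E (fst p) (snd p)"
  let ?M = "\<lambda>p. (f0 k (fst p) * lam0 (fst p)) * (f0 l (snd p) * lam0 (snd p))"
  have M: "integrable (\<L> \<Otimes>\<^sub>M \<L>) ?M" "integral\<^sup>L (\<L> \<Otimes>\<^sub>M \<L>) ?M = mean k * mean l"
    using Y2.integrable_product[OF f_int f_int, of k l] by (simp_all add: mean_def)
  have eq: "case_prod ?I p = ?Y p + ?E p - 2 * ?M p" if "p \<in> space (\<L> \<Otimes>\<^sub>M \<L>)" for p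
  proof -
    have S: "fst p \<in> S" "snd p \<in> S" using that by (auto simp: space_pair_measure space_L)
    have "lam0 (fst p) \<noteq> 0" "lam0 (snd p) \<noteq> 0" "\<rho> (fst p) \<noteq> 0" "\<rho> (snd p) \<noteq> 0"
      using lam_pos[OF S(1)] lam_pos[OF S(2)] \<rho>(1)[OF S(1)] \<rho>(1)[OF S(2)] by (auto simp: less_le)
    then show ?thesis
      unfolding case_prod_unfold g[OF S] h[OF S] w_def by (simp add: field_simps)
  qed
  have "integrable (\<L> \<Otimes>\<^sub>M \<L>) (\<lambda>p. ?Y p + ?E p - 2 * ?M p)"
    by (intro Bochner_Integration.integrable_diff Bochner_Integration.integrable_add integrable_mult_right pairY_int pairE_int M)
  then have int: "integrable (\<L> \<Otimes>\<^sub>M \<L>) (case_prod ?I)"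
    using eq by (subst Bochner_Integration.integrable_cong[OF refl, of _ _ "\<lambda>p. ?Y p + ?E p - 2 * ?M p"]) auto
  have "(\<integral>v. (\<integral>u. ?I u v \<partial>\<L>) \<partial>\<L>) = integral\<^sup>L (\<L> \<Otimes>\<^sub>M \<L>) (case_prod ?I)"
    by (rule Y2.window.integral_snd[OF int])
  also have "\<dots> = integral\<^sup>L (\<L> \<Otimes>\<^sub>M \<L>) (\<lambda>p. ?Y p + ?E p - 2 * ?M p)"
    using eq by (intro Bochner_Integration.integral_cong refl)
  also have "\<dots> = integral\<^sup>L (\<L> \<Otimes>\<^sub>M \<L>) ?Y + integral\<^sup>L (\<L> \<Otimes>\<^sub>M \<L>) ?E - 2 * (mean k * mean l)"
    using pairY_int[of k l] pairE_int[of k l] M by simp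
  finally have second: "(\<integral>v. (\<integral>u. ?I u v \<partial>\<L>) \<partial>\<L>) =
    integral\<^sup>L (\<L> \<Otimes>\<^sub>M \<L>) ?Y + integral\<^sup>L (\<L> \<Otimes>\<^sub>M \<L>) ?E - 2 * (mean k * mean l)" .
  have "(\<integral>u. f0 k u * f0 l u * lam0 u * (1 + w u) \<partial>\<L>) =
    (\<integral>u. f0 k u * f0 l u * lam0 u + f0 k u * f0 l u * w u * lam0 u \<partial>\<L>)"
    by (intro Bochner_Integration.integral_cong refl) (simp add: distrib_left mult_ac)
  also have "\<dots> = (\<integral>u. f0 k u * f0 l u * lam0 u \<partial>\<L>) + (\<integral>u. fE k u * fE l u * \<rho> u \<partial>\<L>)"
    unfolding fEfE(2) by (rule Bochner_Integration.integral_add[OF ff_int ffw_int])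
  finally have first: "(\<integral>u. f0 k u * f0 l u * lam0 u * (1 + w u) \<partial>\<L>) =
    (\<integral>u. f0 k u * f0 l u * lam0 u \<partial>\<L>) + (\<integral>u. fE k u * fE l u * \<rho> u \<partial>\<L>)" .
  have "V_matrix S (f \<theta>0) lam0 \<rho> g h $ k $ l =
    (\<integral>u. f0 k u * f0 l u * lam0 u * (1 + w u) \<partial>\<L>) + (\<integral>v. (\<integral>u. ?I u v \<partial>\<L>) \<partial>\<L>)"
    unfolding V_matrix_def set_integrable_window(2)[OF S_borel] by (simp add: w_def)
  also have "\<dots> = momentY k l + momentE k l - 2 * mean k * mean l"
    unfolding first second momentY_eq momentE_eq by simp
  finally show ?thesis .
qed

text \<open>Projecting the score on \<open>c\<close> leaves sums of two scalar functions, this one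
  over the first sample and \<open>combE\<close> over the second.\<close>

definition comb :: "real^'m \<Rightarrow> 'a \<Rightarrow> real" where
  "comb c u = (\<Sum>k\<in>UNIV. c $ k * f0 k u)"

definition combE :: "real^'m \<Rightarrow> 'a \<Rightarrow> real" where
  "combE c u = (\<Sum>k\<in>UNIV. c $ k * fE k u)"

text \<open>The variance of the sum of \<open>comb c\<close> over one process, spelt out through the
  moments so as to match the entries of \<open>V_matrix\<close>.\<close>

definition varY :: "real^'m \<Rightarrow> real" where
  "varY c = (\<Sum>k\<in>UNIV. \<Sum>l\<in>UNIV. c $ k * c $ l * momentY k l) - (\<Sum>k\<in>UNIV. c $ k * mean k)\<^sup>2"

definition varE :: "real^'m \<Rightarrow> real" where
  "varE c = (\<Sum>k\<in>UNIV. \<Sum>l\<in>UNIV. c $ k * c $ l * momentE k l) - (\<Sum>k\<in>UNIV. c $ k * mean k)\<^sup>2"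

lemma sum_mset_comb:
  "(\<Sum>x\<in>#Z. \<Sum>k\<in>UNIV. c $ k * F k x) = (\<Sum>k\<in>UNIV. c $ k * (\<Sum>x\<in>#Z. F k x))" for c :: "real^'m" and F :: "'m \<Rightarrow> 'a \<Rightarrow> real"
  by (simp add: sum_mset_sum sum_mset_distrib_left)

lemma square_comb:
  "(\<Sum>x\<in>#Z. \<Sum>k\<in>UNIV. c $ k * F k x)\<^sup>2 =
    (\<Sum>k\<in>UNIV. \<Sum>l\<in>UNIV. c $ k * c $ l * ((\<Sum>x\<in>#Z. F k x) * (\<Sum>x\<in>#Z. F l x)))"
  for c :: "real^'m" and F :: "'m \<Rightarrow> 'a \<Rightarrow> real"
  unfolding sum_mset_comb power2_eq_square sum_product by (intro sum.cong refl) (simp only: mult_ac)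

lemma comb_Y:
  shows "comb c \<in> borel_measurable \<L>" "integrable \<L> (\<lambda>u. comb c u * lam0 u)"
    "integrable P (\<lambda>\<omega>. (\<Sum>x\<in>#Y (Suc 0) \<omega>. comb c x)\<^sup>2)"
    "(\<integral>u. comb c u * lam0 u \<partial>\<L>) = (\<Sum>k\<in>UNIV. c $ k * mean k)"
    "expectation (\<lambda>\<omega>. (\<Sum>x\<in>#Y (Suc 0) \<omega>. comb c x)\<^sup>2) - (\<Sum>k\<in>UNIV. c $ k * mean k)\<^sup>2 = varY c"
proof -
  show "comb c \<in> borel_measurable \<L>" unfolding comb_def[abs_def] by measurable
  have eq: "comb c u * lam0 u = (\<Sum>k\<in>UNIV. c $ k * (f0 k u * lam0 u))" for u
    by (simp add: comb_def sum_distrib_right mult.assoc)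
  show "integrable \<L> (\<lambda>u. comb c u * lam0 u)"
    unfolding eq by (intro Bochner_Integration.integrable_sum integrable_mult_right f_int)
  show "(\<integral>u. comb c u * lam0 u \<partial>\<L>) = (\<Sum>k\<in>UNIV. c $ k * mean k)"
    unfolding eq mean_def using f_int by (simp add: Bochner_Integration.integral_sum)
  show "integrable P (\<lambda>\<omega>. (\<Sum>x\<in>#Y (Suc 0) \<omega>. comb c x)\<^sup>2)"
    unfolding comb_def square_comb by (intro Bochner_Integration.integrable_sum integrable_mult_right momentY_int)
  have "expectation (\<lambda>\<omega>. (\<Sum>x\<in>#Y (Suc 0) \<omega>. comb c x)\<^sup>2) = (\<Sum>k\<in>UNIV. \<Sum>l\<in>UNIV. c $ k * c $ l * momentY k l)"
    unfolding comb_def square_comb momentY_def using momentY_int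
    by (simp add: Bochner_Integration.integral_sum)
  then show "expectation (\<lambda>\<omega>. (\<Sum>x\<in>#Y (Suc 0) \<omega>. comb c x)\<^sup>2) - (\<Sum>k\<in>UNIV. c $ k * mean k)\<^sup>2 = varY c"
    by (simp add: varY_def)
qed

lemma comb_E:
  shows "combE c \<in> borel_measurable \<L>" "integrable \<L> (\<lambda>u. combE c u * \<rho> u)"
    "integrable P (\<lambda>\<omega>. (\<Sum>x\<in>#E (Suc 0) \<omega>. combE c x)\<^sup>2)"
    "(\<integral>u. combE c u * \<rho> u \<partial>\<L>) = (\<Sum>k\<in>UNIV. c $ k * mean k)"
    "expectation (\<lambda>\<omega>. (\<Sum>x\<in>#E (Suc 0) \<omega>. combE c x)\<^sup>2) - (\<Sum>k\<in>UNIV. c $ k * mean k)\<^sup>2 = varE c"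
proof -
  show "combE c \<in> borel_measurable \<L>" unfolding combE_def[abs_def] by measurable
  have eq: "combE c u * \<rho> u = (\<Sum>k\<in>UNIV. c $ k * (fE k u * \<rho> u))" for u
    by (simp only: combE_def sum_distrib_right mult.assoc)
  show "integrable \<L> (\<lambda>u. combE c u * \<rho> u)"
    unfolding eq by (intro Bochner_Integration.integrable_sum integrable_mult_right fE_int)
  show "(\<integral>u. combE c u * \<rho> u \<partial>\<L>) = (\<Sum>k\<in>UNIV. c $ k * mean k)"
    unfolding eq using fE_int by (simp add: Bochner_Integration.integral_sum weighted_rho(2) mean_def)
  show "integrable P (\<lambda>\<omega>. (\<Sum>x\<in>#E (Suc 0) \<omega>. combE c x)\<^sup>2)"
    unfolding combE_def square_comb by (intro Bochner_Integration.integrable_sum integrable_mult_right momentE_int)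
  have "expectation (\<lambda>\<omega>. (\<Sum>x\<in>#E (Suc 0) \<omega>. combE c x)\<^sup>2) = (\<Sum>k\<in>UNIV. \<Sum>l\<in>UNIV. c $ k * c $ l * momentE k l)"
    unfolding combE_def square_comb momentE_def using momentE_int
    by (simp add: Bochner_Integration.integral_sum)
  then show "expectation (\<lambda>\<omega>. (\<Sum>x\<in>#E (Suc 0) \<omega>. combE c x)\<^sup>2) - (\<Sum>k\<in>UNIV. c $ k * mean k)\<^sup>2 = varE c"
    by (simp add: varE_def)
qed

lemma varY_nonneg: "0 \<le> varY c" by (rule Y.variance_nonneg[OF comb_Y])

lemma varE_nonneg: "0 \<le> varE c" by (rule E.variance_nonneg[OF comb_E])

text \<open>The two variances add up as they must for independent samples; since both are
  nonnegative, this also shows that \<open>V_matrix\<close> is positive semidefinite.\<close>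

lemma quadratic_V:
  assumes "\<And>k l. V $ k $ l = momentY k l + momentE k l - 2 * mean k * mean l"
  shows "c \<bullet> (V *v c) = varY c + varE c"
proof -
  have "c \<bullet> (V *v c) = (\<Sum>k\<in>UNIV. \<Sum>l\<in>UNIV. c $ k * c $ l * V $ k $ l)"
    by (simp add: inner_vec_def matrix_vector_mult_def sum_distrib_left mult_ac)
  also have "\<dots> = (\<Sum>k\<in>UNIV. \<Sum>l\<in>UNIV. c $ k * c $ l * momentY k l + c $ k * c $ l * momentE k l
      - 2 * ((c $ k * mean k) * (c $ l * mean l)))"
    unfolding assms by (intro sum.cong refl) (simp add: algebra_simps)
  also have "\<dots> = varY c + varE c"
    unfolding varY_def varE_def power2_eq_square sum_product
    by (simp add: sum.distrib sum_subtractf sum_distrib_left sum_negf)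
  finally show ?thesis .
qed

section \<open>The score as a random function of the parameter\<close>

definition data :: "nat \<Rightarrow> 'w \<Rightarrow> 'a multiset \<times> 'a multiset" where
  "data n \<omega> = (superposition Y n \<omega>, superposition E n \<omega>)"

definition total_score :: "'a multiset \<times> 'a multiset \<Rightarrow> real^'m \<Rightarrow> real^'m" where
  "total_score Z \<theta> = score f lam \<rho> (fst Z) (snd Z) \<theta>"

lemma data_meas: "data n \<in> measurable P (config S \<Otimes>\<^sub>M config S)"
  unfolding data_def[abs_def] using Y.superposition_measurable E.superposition_measurable
  by (intro measurable_Pair)

lemma total_score_component:
  "total_score Z \<theta> $ i = (\<Sum>x\<in>#fst Z. f \<theta> x $ i) - (\<Sum>x\<in>#snd Z. lam \<theta> x / \<rho> x * f \<theta> x $ i)"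
  by (simp add: total_score_def score_def sum_mset_component)

lemma total_score_meas:
  assumes "\<theta> \<in> cball \<theta>0 r"
  shows "(\<lambda>Z. total_score Z \<theta>) \<in> borel_measurable (config S \<Otimes>\<^sub>M config S)"
proof (rule borel_measurable_vec_componentwise)
  fix i
  have [measurable]: "(\<lambda>u. f \<theta> u $ i) \<in> borel_measurable \<L>" using assms r by (intro f_comp_meas) auto
  have "(\<lambda>Z. \<Sum>x\<in>#Z. f \<theta> x $ i) \<in> borel_measurable (config S)"
    by (rule Y.functional_measurable) measurable
  moreover have "(\<lambda>Z. \<Sum>x\<in>#Z. lam \<theta> x / \<rho> x * f \<theta> x $ i) \<in> borel_measurable (config S)"
    by (rule E.functional_measurable) measurable
  ultimately show "(\<lambda>Z. total_score Z \<theta> $ i) \<in> borel_measurable (config S \<Otimes>\<^sub>M config S)"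
    unfolding total_score_component
    by (intro borel_measurable_diff measurable_compose[OF measurable_fst] measurable_compose[OF measurable_snd])
qed

lemma total_score_cont:
  assumes "Z \<in> space (config S \<Otimes>\<^sub>M config S)"
  shows "continuous_on (cball \<theta>0 r) (total_score Z)"
proof -
  have Z: "set_mset (fst Z) \<subseteq> S" "set_mset (snd Z) \<subseteq> S"
    using assms by (auto simp: space_pair_measure space_config)
  have f_cont: "continuous_on (cball \<theta>0 r) (\<lambda>\<theta>. f \<theta> x $ i)" if "x \<in> S" for x i
    using differentiable_imp_continuous_on[OF f_diff(1)[OF that]] r(2) by (rule continuous_on_subset)
  have lam_cont: "continuous_on A (\<lambda>\<theta>. lam \<theta> x / \<rho> x)" for x A
    unfolding loglinear_intensity_def divide_inverse by (intro continuous_intros)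
  have "continuous_on (cball \<theta>0 r) (\<lambda>\<theta>. \<chi> i. total_score Z \<theta> $ i)"
    unfolding total_score_component using Z
    by (intro continuous_on_vec_lambda continuous_on_diff continuous_on_sum_mset continuous_on_mult f_cont lam_cont) auto
  then show ?thesis by simp
qed

text \<open>The Taylor bounds hold at every point of the window with moduli \<open>lipY\<close> and
  \<open>lipE\<close>, so they can be summed over the random points.\<close>

lemma total_score_expansion:
  assumes \<omega>: "\<omega> \<in> space P" and \<delta>: "\<delta> \<le> r" and \<theta>: "\<theta> \<in> cball \<theta>0 \<delta>" "\<theta>' \<in> cball \<theta>0 \<delta>"
  shows "\<bar>total_score (data n \<omega>) \<theta> $ i - total_score (data n \<omega>) \<theta>' $ i - (\<Sum>l\<in>UNIV. Jacobian n \<omega> $ i $ l * (\<theta> - \<theta>') $ l)\<bar>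
    \<le> lipschitz n \<omega> * \<delta> * norm (\<theta> - \<theta>')"
proof -
  let ?X = "superposition Y n \<omega>" and ?D = "superposition E n \<omega>" and ?c = "\<delta> * norm (\<theta> - \<theta>')"
  have X: "x \<in># ?X \<Longrightarrow> x \<in> S" and D: "x \<in># ?D \<Longrightarrow> x \<in> S" for x
    using measurable_space[OF Y.superposition_measurable \<omega>] measurable_space[OF E.superposition_measurable \<omega>]
    by (auto simp: space_config)
  let ?eY = "(\<Sum>x\<in>#?X. f \<theta> x $ i) - (\<Sum>x\<in>#?X. f \<theta>' x $ i) - (\<Sum>l\<in>UNIV. (\<Sum>x\<in>#?X. f1 i l x) * (\<theta> - \<theta>') $ l)"
  let ?eE = "(\<Sum>x\<in>#?D. lam \<theta> x / \<rho> x * f \<theta> x $ i) - (\<Sum>x\<in>#?D. lam \<theta>' x / \<rho> x * f \<theta>' x $ i)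
      - (\<Sum>l\<in>UNIV. (\<Sum>x\<in>#?D. w x * (f1 i l x + f0 i x * z x $ l)) * (\<theta> - \<theta>') $ l)"
  have "\<bar>?eY\<bar> \<le> (\<Sum>x\<in>#?X. lipY x) * ?c"
    by (rule sum_mset_linear_error) (intro taylor_Y X \<delta> \<theta>)
  moreover have "\<bar>?eE\<bar> \<le> (\<Sum>x\<in>#?D. lipE x) * ?c"
    by (rule sum_mset_linear_error) (intro taylor_E D \<delta> \<theta>)
  moreover have "total_score (data n \<omega>) \<theta> $ i - total_score (data n \<omega>) \<theta>' $ i - (\<Sum>l\<in>UNIV. Jacobian n \<omega> $ i $ l * (\<theta> - \<theta>') $ l) = ?eY - ?eE"
    unfolding total_score_component data_def fst_conv snd_conv Jacobian_def vec_lambda_beta left_diff_distrib sum_subtractf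
    by simp
  moreover have "lipschitz n \<omega> * \<delta> * norm (\<theta> - \<theta>') = (\<Sum>x\<in>#?X. lipY x) * ?c + (\<Sum>x\<in>#?D. lipE x) * ?c"
    by (simp add: lipschitz_def distrib_right mult.assoc)
  ultimately show ?thesis by linarith
qed

lemma inner_total_score:
  "c \<bullet> total_score (data n \<omega>) \<theta>0 = (\<Sum>x\<in>#superposition Y n \<omega>. comb c x) - (\<Sum>x\<in>#superposition E n \<omega>. combE c x)"
  unfolding comb_def combE_def sum_mset_comb
  by (simp add: inner_vec_def total_score_component data_def right_diff_distrib sum_subtractf w_def)

text \<open>Only the order \<open>n\<close> matters, so the elementary bound
  \<open>2 * A^2 + 2 * B^2\<close> for the square of a difference disposes of the cross term. Both
  samples are centred at the same value, which cancels.\<close>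

lemma total_score_second_moment:
  shows "integrable P (\<lambda>\<omega>. (c \<bullet> total_score (data n \<omega>) \<theta>0)\<^sup>2)"
    and "expectation (\<lambda>\<omega>. (c \<bullet> total_score (data n \<omega>) \<theta>0)\<^sup>2) \<le> real n * (2 * (varY c + varE c))"
proof -
  let ?m = "\<Sum>k\<in>UNIV. c $ k * mean k"
  let ?A = "\<lambda>\<omega>. (\<Sum>x\<in>#superposition Y n \<omega>. comb c x) - real n * ?m"
  let ?B = "\<lambda>\<omega>. (\<Sum>x\<in>#superposition E n \<omega>. combE c x) - real n * ?m"
  have le: "(c \<bullet> total_score (data n \<omega>) \<theta>0)\<^sup>2 \<le> 2 * (?A \<omega>)\<^sup>2 + 2 * (?B \<omega>)\<^sup>2" for \<omega>
  proof -
    have "(c \<bullet> total_score (data n \<omega>) \<theta>0)\<^sup>2 = (?A \<omega> - ?B \<omega>)\<^sup>2" by (simp add: inner_total_score)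
    also have "\<dots> \<le> 2 * (?A \<omega>)\<^sup>2 + 2 * (?B \<omega>)\<^sup>2"
      using zero_le_power2[of "?A \<omega> + ?B \<omega>"] unfolding power2_eq_square by (simp only: algebra_simps)
    finally show ?thesis .
  qed
  note A = Y.functional_second_moment[OF comb_Y[of c], of n] and B = E.functional_second_moment[OF comb_E[of c], of n]
  have meas: "(\<lambda>\<omega>. c \<bullet> total_score (data n \<omega>) \<theta>0) \<in> borel_measurable P"
    unfolding inner_total_score
    by (intro borel_measurable_diff Y.functional_superposition_measurable E.functional_superposition_measurable comb_Y comb_E)
  have int: "integrable P (\<lambda>\<omega>. 2 * (?A \<omega>)\<^sup>2 + 2 * (?B \<omega>)\<^sup>2)" using A B by simp
  show i: "integrable P (\<lambda>\<omega>. (c \<bullet> total_score (data n \<omega>) \<theta>0)\<^sup>2)"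
    by (rule Bochner_Integration.integrable_bound[OF int]) (use le meas in auto)
  have "expectation (\<lambda>\<omega>. (c \<bullet> total_score (data n \<omega>) \<theta>0)\<^sup>2) \<le> expectation (\<lambda>\<omega>. 2 * (?A \<omega>)\<^sup>2 + 2 * (?B \<omega>)\<^sup>2)"
    by (intro integral_mono i int le)
  also have "\<dots> = 2 * (real n * varY c) + 2 * (real n * varE c)" using A B by simp
  finally show "expectation (\<lambda>\<omega>. (c \<bullet> total_score (data n \<omega>) \<theta>0)\<^sup>2) \<le> real n * (2 * (varY c + varE c))"
    by (simp add: algebra_simps)
qed

lemma total_score_clt:
  "(\<lambda>n. char (distr P borel (\<lambda>\<omega>. (c \<bullet> total_score (data n \<omega>) \<theta>0) / sqrt (real n))) t)
    \<longlonglongrightarrow> complex_of_real (exp (- (t\<^sup>2 * (varY c + varE c)) / 2))"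
  unfolding inner_total_score
proof (rule functional_clt_difference[OF prob_space_axioms indep _ _ S_borel])
  have cong: "borel_measurable \<L> = borel_measurable (restrict_space borel S)"
    by (rule measurable_cong_sets[OF Y.first.sets_window refl])
  show "comb c \<in> borel_measurable (restrict_space borel S)" "combE c \<in> borel_measurable (restrict_space borel S)"
    using comb_Y(1) comb_E(1) unfolding cong .
  show "(\<lambda>n. char (distr P borel (\<lambda>\<omega>. ((\<Sum>x\<in>#superposition Y n \<omega>. comb c x) - real n * (\<Sum>k\<in>UNIV. c $ k * mean k)) / sqrt (real n))) t)
    \<longlonglongrightarrow> complex_of_real (exp (- (t\<^sup>2 * varY c) / 2))"
    by (rule Y.functional_clt[OF comb_Y])
  \<comment> \<open>The second sample is used with \<open>- combE c\<close>: the mean changes its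
    sign, the variance does not.\<close>
  have neg: "(\<Sum>x\<in>#Z. - combE c x) = - (\<Sum>x\<in>#Z. combE c x)" for Z
    using sum_mset_diff[of "\<lambda>_. 0" "combE c" Z] by simp
  show "(\<lambda>n. char (distr P borel (\<lambda>\<omega>. ((\<Sum>x\<in>#superposition E n \<omega>. - combE c x) - real n * - (\<Sum>k\<in>UNIV. c $ k * mean k)) / sqrt (real n))) t)
    \<longlonglongrightarrow> complex_of_real (exp (- (t\<^sup>2 * varE c) / 2))"
    by (rule E.functional_clt) (use comb_E[of c] in \<open>simp_all add: neg\<close>)
qed

text \<open>Symmetry and positivity of \<open>V_matrix\<close> are read off from its expression by
  moments and variances; single components of the score are its projections on the coordinate
  axes.\<close>

theorem estimator_asymptotics:
  assumes g: "\<And>u v. u \<in> S \<Longrightarrow> v \<in> S \<Longrightarrow> g u v = \<kappa>2E u v / (\<rho> u * \<rho> v)"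
    and h: "\<And>u v. u \<in> S \<Longrightarrow> v \<in> S \<Longrightarrow> h u v = \<kappa>2Y u v / (lam0 u * lam0 v)"
    and U: "invertible (U_matrix S (f \<theta>0) lam0 z)"
  shows "\<exists>\<tau>. (\<forall>n. estimator S \<Theta> (\<tau> n)) \<and>
    (\<lambda>n. prob {\<omega>\<in>space P. score f lam \<rho> (superposition Y n \<omega>) (superposition E n \<omega>)
        (\<tau> n (superposition Y n \<omega>, superposition E n \<omega>)) = 0}) \<longlonglongrightarrow> 1 \<and>
    converges_in_probability P (\<lambda>n \<omega>. \<tau> n (superposition Y n \<omega>, superposition E n \<omega>)) \<theta>0 \<and>
    (\<exists>\<nu>. multivariate_normal 0 (matrix_inv (U_matrix S (f \<theta>0) lam0 z) ** V_matrix S (f \<theta>0) lam0 \<rho> g h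
          ** transpose (matrix_inv (U_matrix S (f \<theta>0) lam0 z))) \<nu> \<and>
      converges_in_distribution P (\<lambda>n \<omega>. sqrt (real n) *\<^sub>R (\<tau> n (superposition Y n \<omega>, superposition E n \<omega>) - \<theta>0)) \<nu>)"
proof -
  let ?V = "V_matrix S (f \<theta>0) lam0 \<rho> g h"
  have V: "?V $ k $ l = momentY k l + momentE k l - 2 * mean k * mean l" for k l
    by (rule V_matrix_eq[OF g h])
  have quad: "c \<bullet> (?V *v c) = varY c + varE c" for c by (rule quadratic_V[OF V])
  have "momentY k l = momentY l k" "momentE k l = momentE l k" for k l
    unfolding momentY_def momentE_def by (simp_all only: mult.commute)
  then have sym: "transpose ?V = ?V"
    by (simp add: vec_eq_iff transpose_def V)
  have comp: "x $ i = axis i 1 \<bullet> x" for x :: "real^'m" and i by (simp add: inner_axis')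
  have "\<exists>\<tau>. (\<forall>n. \<tau> n \<in> measurable (config S \<Otimes>\<^sub>M config S) (restrict_space borel \<Theta>)) \<and>
    (\<lambda>n. measure P {\<omega>\<in>space P. total_score (data n \<omega>) (\<tau> n (data n \<omega>)) = 0}) \<longlonglongrightarrow> 1 \<and>
    converges_in_probability P (\<lambda>n \<omega>. \<tau> n (data n \<omega>)) \<theta>0 \<and>
    (\<exists>\<nu>. multivariate_normal 0 (matrix_inv (U_matrix S (f \<theta>0) lam0 z) ** ?V ** transpose (matrix_inv (U_matrix S (f \<theta>0) lam0 z))) \<nu> \<and>
      converges_in_distribution P (\<lambda>n \<omega>. sqrt (real n) *\<^sub>R (\<tau> n (data n \<omega>) - \<theta>0)) \<nu>)"
  proof (rule z_estimator_asymptotics[OF prob_space_axioms r data_meas total_score_meas total_score_cont Jacobian_meas lipschitz_meas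
      total_score_expansion Jacobian_lim lipschitz_lim _ _ U _ sym])
    show "integrable P (\<lambda>\<omega>. (total_score (data n \<omega>) \<theta>0 $ i)\<^sup>2)" for n i
      unfolding comp[of "total_score _ _"] by (rule total_score_second_moment)
    show "expectation (\<lambda>\<omega>. (total_score (data n \<omega>) \<theta>0 $ i)\<^sup>2) \<le> real n * (2 * (varY (axis i 1) + varE (axis i 1)))" for n i
      unfolding comp[of "total_score _ _"] by (rule total_score_second_moment)
    show "(\<lambda>n. char (distr P borel (\<lambda>\<omega>. c \<bullet> total_score (data n \<omega>) \<theta>0 / sqrt (real n))) t)
      \<longlonglongrightarrow> complex_of_real (exp (- (t\<^sup>2 * (c \<bullet> (?V *v c))) / 2))" for c t
      unfolding quad by (rule total_score_clt)
    show "0 \<le> c \<bullet> (?V *v c)" for c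
      unfolding quad by (intro add_nonneg_nonneg varY_nonneg varE_nonneg)
  qed
  then show ?thesis by (simp add: estimator_def total_score_def data_def)
qed

end

section \<open>From the hypotheses to explicit constants\<close>

theorem theorem4p6:
  fixes W :: "(real^2) set" and T :: "real set"
    and \<Theta> :: "(real^'m::finite) set" and \<theta>0 :: "real^'m"
    and P :: "'w measure"
    and Y E :: "nat \<Rightarrow> 'w \<Rightarrow> ((real^2) \<times> real) multiset"
    and b \<rho> :: "(real^2) \<times> real \<Rightarrow> real"
    and z :: "(real^2) \<times> real \<Rightarrow> real^'m"
    and lam :: "real^'m \<Rightarrow> (real^2) \<times> real \<Rightarrow> real"
    and f :: "real^'m \<Rightarrow> (real^2) \<times> real \<Rightarrow> real^'m"
    and g h :: "(real^2) \<times> real \<Rightarrow> (real^2) \<times> real \<Rightarrow> real"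
    and d :: "'m \<Rightarrow> (real^2) \<times> real \<Rightarrow> real"
    and d1 :: "'m \<Rightarrow> 'm \<Rightarrow> (real^2) \<times> real \<Rightarrow> real"
    and d2 e :: "'m \<Rightarrow> 'm \<Rightarrow> 'm \<Rightarrow> (real^2) \<times> real \<Rightarrow> real"
    and \<alpha> :: real
  assumes window: "bounded (W \<times> T)" "W \<times> T \<noteq> {}" "open (W \<times> T)"
    and parameter: "open \<Theta>" "\<theta>0 \<in> \<Theta>"
    and lam: "lam = loglinear_intensity b z"
    and test_measurable: "\<forall>\<theta>\<in>\<Theta>. set_borel_measurable lborel (W \<times> T) (f \<theta>)"
    and test_integrable:
      "\<forall>\<theta>\<in>\<Theta>. \<forall>i. set_integrable lborel (W \<times> T) (\<lambda>u. f \<theta> u $ i * lam \<theta> u)"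
    and i: "prob_space P" "iid_point_processes P (W \<times> T) Y" "iid_point_processes P (W \<times> T) E"
      "independent_sequences P (W \<times> T) Y E"
    and ii_Y: "\<forall>u\<in>W \<times> T. 0 < b u" "set_integrable lborel (W \<times> T) b"
      "set_borel_measurable lborel (W \<times> T) z"
      "\<forall>j\<ge>1. has_intensity P (W \<times> T) (Y j) (lam \<theta>0)"
    and ii_E: "\<forall>u\<in>W \<times> T. 0 < \<rho> u" "set_integrable lborel (W \<times> T) \<rho>"
      "\<forall>j\<ge>1. has_intensity P (W \<times> T) (E j) \<rho>"
    and iii_E: "\<forall>j\<ge>1. has_pair_correlation P (W \<times> T) (E j) \<rho> g"
      "(SUP (u, v)\<in>(W \<times> T) \<times> (W \<times> T). ereal (g u v)) < \<infinity>"
    and iii_Y: "\<forall>j\<ge>1. has_pair_correlation P (W \<times> T) (Y j) (lam \<theta>0) h"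
      "(SUP (u, v)\<in>(W \<times> T) \<times> (W \<times> T). ereal (h u v)) < \<infinity>"
    and iv: "\<forall>\<theta>\<in>\<Theta>. \<exists>\<epsilon>1>0. \<exists>\<epsilon>2>0.
      ereal \<epsilon>1 < (INF u\<in>W \<times> T. ereal (\<rho> u / lam \<theta> u)) \<and>
      (SUP u\<in>W \<times> T. ereal (\<rho> u / lam \<theta> u)) < ereal \<epsilon>2"
    and v: "(SUP u\<in>W \<times> T. ereal (norm (z u))) < \<infinity>"
    and vi_smooth: "\<forall>u\<in>W \<times> T. \<forall>i. twice_cont_differentiable_on (\<lambda>\<theta>. f \<theta> u $ i) \<Theta>"
    and vi_bounds: "\<forall>\<^sub>F \<theta> in nhds \<theta>0. \<forall>u\<in>W \<times> T. \<forall>i k l.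
      \<bar>f \<theta> u $ i\<bar> \<le> d i u \<and>
      \<bar>partial_deriv l (\<lambda>\<theta>. f \<theta> u $ i) \<theta>\<bar> \<le> d1 i l u \<and>
      \<bar>partial_deriv k (partial_deriv l (\<lambda>\<theta>. f \<theta> u $ i)) \<theta>\<bar> \<le> d2 i k l u"
    and vi_integrable: "\<forall>i k l.
      set_integrable lborel (W \<times> T) (\<lambda>u. d i u * lam \<theta>0 u) \<and>
      set_integrable lborel (W \<times> T) (\<lambda>u. d1 i l u * lam \<theta>0 u) \<and>
      set_integrable lborel (W \<times> T) (\<lambda>u. d2 i k l u * lam \<theta>0 u)"
    and vii: "0 < \<alpha>" "\<alpha> \<le> 1"
      "\<forall>i k l. set_integrable lborel (W \<times> T) (\<lambda>u. e i k l u * lam \<theta>0 u)"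
      "\<forall>\<^sub>F \<theta> in nhds \<theta>0. \<forall>u\<in>W \<times> T. \<forall>i k l.
        \<bar>partial_deriv k (partial_deriv l (\<lambda>\<theta>. f \<theta> u $ i)) \<theta> -
          partial_deriv k (partial_deriv l (\<lambda>\<theta>. f \<theta> u $ i)) \<theta>0\<bar>
        \<le> e i k l u * norm (\<theta> - \<theta>0) powr \<alpha>"
    and viii: "invertible (U_matrix (W \<times> T) (f \<theta>0) (lam \<theta>0) z)"
    and ix: "\<forall>k l. set_integrable lborel (W \<times> T) (\<lambda>u. f \<theta>0 u $ k * f \<theta>0 u $ l * lam \<theta>0 u)"
  shows "\<exists>\<tau> \<theta>hat.
      (\<forall>n. estimator (W \<times> T) \<Theta> (\<tau> n)) \<and>
      (\<forall>n \<omega>. \<theta>hat n \<omega> = \<tau> n (superposition Y n \<omega>, superposition E n \<omega>)) \<and>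
      (\<lambda>n. measure P {\<omega> \<in> space P.
         score f lam \<rho> (superposition Y n \<omega>) (superposition E n \<omega>) (\<theta>hat n \<omega>) = 0}) \<longlonglongrightarrow> 1 \<and>
      converges_in_probability P \<theta>hat \<theta>0 \<and>
      (\<exists>\<nu>. multivariate_normal 0
           (matrix_inv (U_matrix (W \<times> T) (f \<theta>0) (lam \<theta>0) z)
             ** V_matrix (W \<times> T) (f \<theta>0) (lam \<theta>0) \<rho> g h
             ** transpose (matrix_inv (U_matrix (W \<times> T) (f \<theta>0) (lam \<theta>0) z))) \<nu> \<and>
         converges_in_distribution P (\<lambda>n \<omega>. sqrt (real n) *\<^sub>R (\<theta>hat n \<omega> - \<theta>0)) \<nu>)"
proof -
  interpret prob_space P by (rule i(1))
  let ?S = "W \<times> T" and ?L = "restrict_space lborel (W \<times> T)"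
  have S: "?S \<in> sets borel" using window(3) by simp
  note window_simps = set_integrable_window[OF S]
  obtain r0 where r0: "0 < r0" "cball \<theta>0 r0 \<subseteq> \<Theta>"
    using parameter open_contains_cball by blast
  obtain e0 where e0: "0 < e0" "\<And>\<theta>. dist \<theta> \<theta>0 < e0 \<Longrightarrow> \<forall>u\<in>?S. \<forall>i k l.
      \<bar>f \<theta> u $ i\<bar> \<le> d i u \<and>
      \<bar>partial_deriv l (\<lambda>\<theta>. f \<theta> u $ i) \<theta>\<bar> \<le> d1 i l u \<and>
      \<bar>partial_deriv k (partial_deriv l (\<lambda>\<theta>. f \<theta> u $ i)) \<theta>\<bar> \<le> d2 i k l u"
    using vi_bounds unfolding eventually_nhds_metric by blast
  \<comment> \<open>Half of \<open>e0\<close>, because the bounds hold on an open ball of radius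
    \<open>e0\<close> and the model uses a closed one.\<close>
  define r where "r = min r0 (e0 / 2)"
  have r: "0 < r" "cball \<theta>0 r \<subseteq> \<Theta>" "\<And>\<theta>. \<theta> \<in> cball \<theta>0 r \<Longrightarrow> dist \<theta> \<theta>0 < e0"
    using r0 e0(1) by (auto simp: r_def dist_commute subset_iff)
  obtain C where C: "\<And>u. u \<in> ?S \<Longrightarrow> norm (z u) \<le> C"
    using ereal_SUP_less_infinity_bound[OF v] by blast
  have SUP_prod: "(SUP (u, v)\<in>?S \<times> ?S. ereal (q u v)) = (SUP p\<in>?S \<times> ?S. ereal (q (fst p) (snd p)))" for q
    by (simp add: case_prod_unfold)
  obtain HE where HE: "\<And>p. p \<in> ?S \<times> ?S \<Longrightarrow> g (fst p) (snd p) \<le> HE"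
    using ereal_SUP_less_infinity_bound[OF iii_E(2)[unfolded SUP_prod]] by blast
  obtain HY where HY: "\<And>p. p \<in> ?S \<times> ?S \<Longrightarrow> h (fst p) (snd p) \<le> HY"
    using ereal_SUP_less_infinity_bound[OF iii_Y(2)[unfolded SUP_prod]] by blast
  have lam_pos: "0 < lam \<theta> u" if "u \<in> ?S" for \<theta> u
    using bspec[OF ii_Y(1) that] by (simp add: lam loglinear_intensity_def)
  have rho_pos: "0 < \<rho> u" if "u \<in> ?S" for u
    by (rule bspec[OF ii_E(1) that])
  \<comment> \<open>The density behind \<open>g\<close> is taken from the first process; equality in
    law makes its moments valid for all.\<close>
  obtain \<kappa>2E where \<kappa>2E: "has_second_product_density P ?S (E (Suc 0)) \<kappa>2E"
    "\<forall>u\<in>?S. \<forall>v\<in>?S. g u v = \<kappa>2E u v / (\<rho> u * \<rho> v)"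
    using iii_E(1)[rule_format, of "Suc 0"] unfolding has_pair_correlation_def by auto
  obtain \<kappa>2Y where \<kappa>2Y: "has_second_product_density P ?S (Y (Suc 0)) \<kappa>2Y"
    "\<forall>u\<in>?S. \<forall>v\<in>?S. h u v = \<kappa>2Y u v / (lam \<theta>0 u * lam \<theta>0 v)"
    using iii_Y(1)[rule_format, of "Suc 0"] unfolding has_pair_correlation_def by auto
  \<comment> \<open>Clearing the positive denominator turns a bound on the pair correlation into one
    on the density.\<close>
  have density_le: "\<kappa>2 u v \<le> H * (\<kappa> u * \<kappa> v)"
    if "q u v = \<kappa>2 u v / (\<kappa> u * \<kappa> v)" "q u v \<le> H" "0 < \<kappa> u" "0 < \<kappa> v"
    for q \<kappa>2 :: "(real^2) \<times> real \<Rightarrow> (real^2) \<times> real \<Rightarrow> real" and \<kappa> H u v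
    using that by (simp add: pos_divide_le_eq)
  \<comment> \<open>A positive lower bound for \<rho>/\<lambda> at the true parameter is an upper
    bound for the weight \<lambda>/\<rho>, the constant \<open>B\<close> of the model.\<close>
  obtain \<epsilon> where \<epsilon>: "0 < \<epsilon>" "ereal \<epsilon> < (INF u\<in>?S. ereal (\<rho> u / lam \<theta>0 u))"
    using iv parameter(2) by blast
  have B: "lam \<theta>0 u / \<rho> u \<le> 1 / \<epsilon>" if u: "u \<in> ?S" for u
  proof -
    have "ereal \<epsilon> \<le> ereal (\<rho> u / lam \<theta>0 u)"
      using \<epsilon>(2) INF_lower[OF u, of "\<lambda>u. ereal (\<rho> u / lam \<theta>0 u)"] by (meson less_imp_le order_trans)
    then show ?thesis using lam_pos[OF u, of \<theta>0] rho_pos[OF u] \<epsilon>(1) by (simp add: field_simps)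
  qed
  interpret model: two_sample_model P ?S \<Theta> \<theta>0 Y E b \<rho> z f \<kappa>2Y \<kappa>2E d d1 d2 r C "1 / \<epsilon>" HY HE
  proof (unfold_locales, unfold lam[symmetric])
    show "?S \<in> sets borel" "open \<Theta>" "0 < r" "cball \<theta>0 r \<subseteq> \<Theta>" by (fact S parameter r)+
    show "iid_point_processes P ?S Y" "iid_point_processes P ?S E" "independent_sequences P ?S Y E" by (fact i)+
    show "0 < b u" "0 < \<rho> u" "norm (z u) \<le> C" "lam \<theta>0 u / \<rho> u \<le> 1 / \<epsilon>" if "u \<in> ?S" for u
      using that ii_Y(1) rho_pos C B by auto
    show "b \<in> borel_measurable ?L" "\<rho> \<in> borel_measurable ?L"
      using ii_Y(2) ii_E(2) unfolding window_simps by (simp_all add: borel_measurable_integrable)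
    show "z \<in> borel_measurable ?L" using ii_Y(3) unfolding window_simps .
    show "f \<theta> \<in> borel_measurable ?L" if "\<theta> \<in> \<Theta>" for \<theta>
      using test_measurable that unfolding window_simps by blast
    show "integrable ?L (\<lambda>u. f \<theta>0 u $ i * lam \<theta>0 u)" for i
      using test_integrable parameter(2) unfolding window_simps by blast
    show "has_intensity P ?S (Y j) (lam \<theta>0)" "has_intensity P ?S (E j) \<rho>" if "1 \<le> j" for j
      using ii_Y(4) ii_E(3) that by blast+
    show "has_second_product_density P ?S (Y (Suc 0)) \<kappa>2Y" "has_second_product_density P ?S (E (Suc 0)) \<kappa>2E"
      by (fact \<kappa>2Y \<kappa>2E)+
    show "\<kappa>2Y u v \<le> HY * (lam \<theta>0 u * lam \<theta>0 v)" "\<kappa>2E u v \<le> HE * (\<rho> u * \<rho> v)"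
      if uv: "u \<in> ?S" "v \<in> ?S" for u v
    proof -
      have p: "(u, v) \<in> ?S \<times> ?S" using uv by (rule SigmaI)
      show "\<kappa>2Y u v \<le> HY * (lam \<theta>0 u * lam \<theta>0 v)"
        using \<kappa>2Y(2)[rule_format, OF uv] HY[OF p] lam_pos[OF uv(1)] lam_pos[OF uv(2)]
        by (intro density_le[of h]) simp_all
      show "\<kappa>2E u v \<le> HE * (\<rho> u * \<rho> v)"
        using \<kappa>2E(2)[rule_format, OF uv] HE[OF p] rho_pos[OF uv(1)] rho_pos[OF uv(2)]
        by (intro density_le[of g]) simp_all
    qed
    show "twice_cont_differentiable_on (\<lambda>\<theta>. f \<theta> u $ i) \<Theta>" if "u \<in> ?S" for u i
      using vi_smooth that by blast
    show "\<bar>f \<theta> u $ i\<bar> \<le> d i u \<and> \<bar>partial_deriv l (\<lambda>\<theta>. f \<theta> u $ i) \<theta>\<bar> \<le> d1 i l u \<and>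
      \<bar>partial_deriv k (partial_deriv l (\<lambda>\<theta>. f \<theta> u $ i)) \<theta>\<bar> \<le> d2 i k l u"
      if "\<theta> \<in> cball \<theta>0 r" "u \<in> ?S" for \<theta> u i k l
      using e0(2)[OF r(3)[OF that(1)]] that(2) by blast
    show "integrable ?L (\<lambda>u. d i u * lam \<theta>0 u)" "integrable ?L (\<lambda>u. d1 i l u * lam \<theta>0 u)"
      "integrable ?L (\<lambda>u. d2 i k l u * lam \<theta>0 u)" for i k l
      using vi_integrable unfolding window_simps by blast+
    show "integrable ?L (\<lambda>u. f \<theta>0 u $ k * f \<theta>0 u $ l * lam \<theta>0 u)" for k l
      using ix unfolding window_simps by blast
  qed
  obtain \<tau> where \<tau>: "\<forall>n. estimator ?S \<Theta> (\<tau> n)"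
    "(\<lambda>n. prob {\<omega>\<in>space P. score f lam \<rho> (superposition Y n \<omega>) (superposition E n \<omega>)
        (\<tau> n (superposition Y n \<omega>, superposition E n \<omega>)) = 0}) \<longlonglongrightarrow> 1"
    "converges_in_probability P (\<lambda>n \<omega>. \<tau> n (superposition Y n \<omega>, superposition E n \<omega>)) \<theta>0"
    "\<exists>\<nu>. multivariate_normal 0 (matrix_inv (U_matrix ?S (f \<theta>0) (lam \<theta>0) z) ** V_matrix ?S (f \<theta>0) (lam \<theta>0) \<rho> g h
          ** transpose (matrix_inv (U_matrix ?S (f \<theta>0) (lam \<theta>0) z))) \<nu> \<and>
      converges_in_distribution P (\<lambda>n \<omega>. sqrt (real n) *\<^sub>R (\<tau> n (superposition Y n \<omega>, superposition E n \<omega>) - \<theta>0)) \<nu>"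
    using model.estimator_asymptotics[unfolded lam[symmetric], OF \<kappa>2E(2)[rule_format] \<kappa>2Y(2)[rule_format] viii]
    by blast
  show ?thesis
    by (rule exI[of _ \<tau>], rule exI[of _ "\<lambda>n \<omega>. \<tau> n (superposition Y n \<omega>, superposition E n \<omega>)"])
       (use \<tau> in blast)
qed

end
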